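(* Let $k,m,n\in\mathbb N$ and $b,c\in L^\infty(\mathbb C^k)$. Then $0\le r:=\|b\|_{\gamma_k^{\mathbb C}}^2<\infty$ and $\|b\|_\infty\ge\sqrt r$. Moreover: (i) $|\operatorname{tr}(A^*h^{\mathbb C}_{b,c}[S])|\le\|b\|_\infty\|c\|_\infty\|A\|^{\mathbb C}_{\infty,1}$ for all complex $m\times n$ matrices $A$ and all $S\in\mathcal Q_{m,n}(\mathbb C)$. (ii) Assume that $b\neq0$, that $b(\alpha z)=\alpha b(z)$ for all $\alpha\in\mathbb C$ with $|\alpha|=1$ and all $z\in\mathbb C^k$, and that $H_{r(b),s(b)}^{-1}|_{(-r,r)}\in W^\omega_+((-r,r))$. Put $c^*:=H^{\mathrm{hyp}}_{\frac{r(b)}{\sqrt r},\frac{s(b)}{\sqrt r}}(1)$. Then $c^*\in(0,1)$, and: (ii-1) $r\,K_G^{\mathbb C}\le\dfrac{\|b\|_\infty^2}{c^*}$. In particular, if $\operatorname{sign}\big((H^{-1}_{\frac{r(b)}{\sqrt r},\frac{s(b)}{\sqrt r}}|_{(-1,1)})^{(2n+1)}(0)\big)=(-1)^n$ for all $n\in\mathbb N_0$, then $r\,K_G^{\mathbb C}\le i\,\dfrac{\|b\|_\infty^2}{F_b(i)}$, where $F_b:=\widetilde\psi$ with $\psi:=H_{\frac{r(b)}{\sqrt r},\frac{s(b)}{\sqrt r}}|_{(-1,1)}$. (ii-2) Let $1\le\kappa_*<K_G^{\mathbb C}$. If $\|b\|_\infty=\sqrt r$, then $0<H^{\mathrm{hyp}}_{\frac{r(b)}{\sqrt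 r},\frac{s(b)}{\sqrt r}}(\kappa_* )<1$ and there is exactly one number $\gamma^*\in\big(H^{\mathrm{hyp}}_{\frac{r(b)}{\sqrt r},\frac{s(b)}{\sqrt r}}(\kappa_* ),1\big]$ such that $$K_G^{\mathbb C}=\big(H_{r(b),s(b)}^{-1}|_{(-r,r)}\big)_{\mathrm{abs}}(r\gamma^* )\le\min\Big\{\frac1{c^*},\ \big(H_{r(b),s(b)}^{-1}|_{(-r,r)}\big)_{\mathrm{abs}}(r)\Big\}.$$
   Context: $K_G^{\mathbb C}$ is the complex Grothendieck constant: the smallest $K>0$ such that for all $m,n\in\mathbb N$, all complex $m\times n$ matrices $(a_{ij})$, all complex Hilbert spaces $H$ and all $u_i,v_j$ in the closed unit ball of $H$, $|\sum_{i,j} a_{ij}\langle u_i,v_j\rangle|\le K\|A\|^{\mathbb C}_{\infty,1}$, where $\|A\|^{\mathbb C}_{\infty,1}:=\sup\{|\sum_{i,j} a_{ij}p_iq_j|:p_i,q_j\in\mathbb C,|p_i|\le1,|q_j|\le1\}$. Inner products are linear in the first argument. $\mathcal Q_{m,n}(\mathbb C)$ is the set of matrices $(\langle v_j,u_i\rangle_H)_{i\le m,j\le n}$ with $H$ a complex Hilbert space and $u_i,v_j$ unit vectors. $h[S]$ means entrywise application of $h$. $\gamma_k^{\mathbb C}$ is the probability measure on $\mathbb C^k$ with Lebesgue density $\pi^{-k}e^{-\|z\|^2}$; $\|b\|_{\gamma_k^{\mathbb C}}$ is the $L^2(\gamma_k^{\mathbb C})$ norm. A random vector $V$ in $\mathbb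 C^N$ has law $\mathbb CN_N(0,\Gamma)$ ($\Gamma$ positive semidefinite Hermitian) if $\sqrt2(\Re V,\Im V)$ is centred real Gaussian with covariance $\begin{pmatrix}\Re\Gamma&-\Im\Gamma\\ \Im\Gamma&\Re\Gamma\end{pmatrix}$. For $|\zeta|\le1$, $\Sigma_{2k}(\zeta)=\begin{pmatrix}I_k&\zeta I_k\\ \bar\zeta I_k&I_k\end{pmatrix}$, and $h^{\mathbb C}_{b,c}(\zeta):=\mathbb E[b(\mathbf Z)\overline{c(\mathbf W)}]$ where $(\mathbf Z,\mathbf W)\sim\mathbb CN_{2k}(0,\Sigma_{2k}(\zeta))$, $\mathbf Z,\mathbf W$ in $\mathbb C^k$. For $b:\mathbb C^k\to\mathbb C$ define $r(b),s(b):\mathbb R^{2k}\to\mathbb R$ by $r(b)(x,y)=\Re\, b(\tfrac{x+iy}{\sqrt2})$, $s(b)(x,y)=\Im\, b(\tfrac{x+iy}{\sqrt2})$ ($x,y\in\mathbb R^k$). For real-valued $f,g\in L^2(\gamma_{N})$ ($\gamma_N$ standard Gaussian on $\mathbb R^N$; here $N=2k$): $h_{f,g}(\rho):=\mathbb E[f(\mathbf X)g(\mathbf Y)]$ for $\rho\in[-1,1]$, where $(\mathbf X,\mathbf Y)$ is centred Gaussian in $\mathbb R^{2N}$ with covariance $\begin{pmatrix}I_N&\rho I_N\\ \rho I_N&I_N\end{pmatrix}$; and $H_{f,g}:=h_{f,f}+h_{g,g}$. Under the symmetry assumption on $b\neq0$, $H_{r(b),s(b)}:[-1,1]\to[-r,r]$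 is an odd strictly increasing homeomorphism. For $\varrho>0$, $W^\omega_+((-\varrho,\varrho))$ is the set of real analytic $\psi$ on $(-\varrho,\varrho)$ with $\sum_n\frac{|\psi^{(n)}(0)|}{n!}\varrho^n<\infty$; for such $\psi$, $\psi_{\mathrm{abs}}(x)=\sum_n\frac{|\psi^{(n)}(0)|}{n!}x^n$ on $[-\varrho,\varrho]$ and $\widetilde\psi(z)=\sum_n\frac{\psi^{(n)}(0)}{n!}z^n$ for complex $|z|\le\varrho$. For an odd strictly increasing homeomorphism $H=H_{f,g}:[-1,1]\to[-1,1]$ with $H^{-1}|_{(-1,1)}\in W^\omega_+((-1,1))$, $H^{\mathrm{hyp}}:[-s,s]\to[-1,1]$ denotes the inverse of the strictly increasing homeomorphism $(H^{-1}|_{(-1,1)})_{\mathrm{abs}}:[-1,1]\to[-s,s]$, $s:=(H^{-1}|_{(-1,1)})_{\mathrm{abs}}(1)$. *)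

theory Defs
  imports "HOL-Probability.Probability" "Jordan_Normal_Form.Schur_Decomposition"
begin

no_notation Matrix.vec_index (infixl "$" 100)

section \<open>Complex Hilbert spaces\<close>

text \<open>A Hilbert space is a structure on an explicit carrier set, so that one can quantify
  over Hilbert spaces inside a formula.  The fields \<open>mult\<close> and \<open>one\<close> inherited from
  the record of modules play no role.\<close>

record 'h hilbert = "(complex, 'h) module" +
  sp :: "'h \<Rightarrow> 'h \<Rightarrow> complex"

definition hnorm :: "'h hilbert \<Rightarrow> 'h \<Rightarrow> real" where
  "hnorm H x = sqrt (Re (sp H x x))"

locale complex_hilbert_space = vectorspace "class_ring :: complex ring" H
  for H :: "'h hilbert" (structure) +
  assumes sp_add: "\<lbrakk>x \<in> carrier H; y \<in> carrier H; z \<in> carrier H\<rbrakk>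
      \<Longrightarrow> sp H (x \<oplus> y) z = sp H x z + sp H y z"
    and sp_smult: "\<lbrakk>x \<in> carrier H; y \<in> carrier H\<rbrakk> \<Longrightarrow> sp H (a \<odot>\<^bsub>H\<^esub> x) y = a * sp H x y"
    and sp_cnj: "\<lbrakk>x \<in> carrier H; y \<in> carrier H\<rbrakk> \<Longrightarrow> sp H y x = cnj (sp H x y)"
    and sp_pos: "\<lbrakk>x \<in> carrier H; x \<noteq> \<zero>\<rbrakk> \<Longrightarrow> 0 < Re (sp H x x)"
    and complete: "\<lbrakk>\<And>n. X n \<in> carrier H;
        \<And>e. e > 0 \<Longrightarrow> \<exists>N. \<forall>m\<ge>N. \<forall>n\<ge>N. hnorm H (X m \<ominus> X n) < e\<rbrakk>
      \<Longrightarrow> \<exists>l\<in>carrier H. (\<lambda>n. hnorm H (X n \<ominus> l)) \<longlonglongrightarrow> 0"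


section \<open>The complex Grothendieck constant\<close>

definition norm_inf_1 :: "complex mat \<Rightarrow> real" where
  "norm_inf_1 A = Sup {cmod (\<Sum>i<dim_row A. \<Sum>j<dim_col A. A $$ (i, j) * p i * q j) | p q.
     (\<forall>i<dim_row A. cmod (p i) \<le> 1) \<and> (\<forall>j<dim_col A. cmod (q j) \<le> 1)}"

text \<open>A definition cannot quantify over all types, so Hilbert spaces are taken with carriers
  inside the type \<^typ>\<open>nat \<Rightarrow> complex\<close>.  This loses nothing: the lemmas
  \<open>grothendieck_bound_all_spaces\<close> and \<open>Q_matI\<close> below recover Hilbert spaces over an
  arbitrary type.\<close>

definition grothendieck_bound :: "real \<Rightarrow> bool" where
  "grothendieck_bound K \<longleftrightarrow>
    (\<forall>m n. \<forall>A \<in> carrier_mat m n. \<forall>(H :: (nat \<Rightarrow> complex) hilbert) u v.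
       complex_hilbert_space H \<longrightarrow>
       (\<forall>i<m. u i \<in> carrier H \<and> hnorm H (u i) \<le> 1) \<longrightarrow>
       (\<forall>j<n. v j \<in> carrier H \<and> hnorm H (v j) \<le> 1) \<longrightarrow>
       cmod (\<Sum>i<m. \<Sum>j<n. A $$ (i, j) * sp H (u i) (v j)) \<le> K * norm_inf_1 A)"

definition K_G :: real where
  "K_G = (LEAST K. 0 < K \<and> grothendieck_bound K)"

definition Q_mat :: "nat \<Rightarrow> nat \<Rightarrow> complex mat set" where
  "Q_mat m n = {mat m n (\<lambda>(i, j). sp H (v j) (u i)) | (H :: (nat \<Rightarrow> complex) hilbert) u v.
     complex_hilbert_space H \<and>
     (\<forall>i<m. u i \<in> carrier H \<and> hnorm H (u i) = 1) \<and>
     (\<forall>j<n. v j \<in> carrier H \<and> hnorm H (v j) = 1)}"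

definition mat_trace :: "complex mat \<Rightarrow> complex" where
  "mat_trace A = (\<Sum>i<dim_row A. A $$ (i, i))"


subsection \<open>Independence of the underlying type\<close>

definition cspace :: "nat \<Rightarrow> (nat \<Rightarrow> complex) hilbert" where
  "cspace N = \<lparr>carrier = {x. \<forall>i\<ge>N. x i = 0}, mult = (\<lambda>x y i. x i * y i), one = (\<lambda>i. 1),
     zero = (\<lambda>i. 0), add = (\<lambda>x y i. x i + y i), smult = (\<lambda>a x i. a * x i),
     sp = (\<lambda>x y. \<Sum>i<N. x i * cnj (y i))\<rparr>"

lemma cspace_simps [simp]:
  "x \<in> carrier (cspace N) \<longleftrightarrow> (\<forall>i\<ge>N. x i = 0)"
  "zero (cspace N) = (\<lambda>i. 0)"
  "add (cspace N) x y = (\<lambda>i. x i + y i)"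
  "smult (cspace N) a x = (\<lambda>i. a * x i)"
  "sp (cspace N) x y = (\<Sum>i<N. x i * cnj (y i))"
  by (auto simp: cspace_def)

lemma abelian_group_cspace: "abelian_group (cspace N)"
proof (rule abelian_groupI)
  fix x assume "x \<in> carrier (cspace N)"
  then show "\<exists>y\<in>carrier (cspace N). y \<oplus>\<^bsub>cspace N\<^esub> x = \<zero>\<^bsub>cspace N\<^esub>"
    by (intro bexI[of _ "\<lambda>i. - x i"]) auto
qed (auto simp: algebra_simps)

lemma vectorspace_cspace: "vectorspace class_ring (cspace N)"
proof -
  interpret abelian_group "cspace N" by (rule abelian_group_cspace)
  have "module class_ring (cspace N)"
    by (rule moduleI) (auto simp: abelian_group_axioms algebra_simps intro: class_cring.cring_axioms)
  then show ?thesis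
    using class_field.field_axioms by (simp add: vectorspace_def)
qed

lemma cspace_minus:
  assumes "x \<in> carrier (cspace N)" "y \<in> carrier (cspace N)"
  shows "x \<ominus>\<^bsub>cspace N\<^esub> y = (\<lambda>i. x i - y i)"
proof -
  interpret abelian_group "cspace N" by (rule abelian_group_cspace)
  have "\<ominus>\<^bsub>cspace N\<^esub> y = (\<lambda>i. - y i)"
    by (rule minus_equality) (use assms in auto)
  then show ?thesis
    by (simp add: a_minus_def)
qed

lemma hnorm_cspace: "hnorm (cspace N) x = L2_set (\<lambda>i. cmod (x i)) {..<N}"
  by (simp add: hnorm_def L2_set_def flip: complex_norm_square)

lemma complex_hilbert_space_cspace: "complex_hilbert_space (cspace N)"
proof -
  interpret vectorspace class_ring "cspace N" by (rule vectorspace_cspace)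
  show ?thesis
  proof
    fix x y assume "x \<in> carrier (cspace N)" "y \<in> carrier (cspace N)"
    show "sp (cspace N) y x = cnj (sp (cspace N) x y)"
      by (simp add: mult.commute)
  next
    fix x assume x: "x \<in> carrier (cspace N)" "x \<noteq> \<zero>\<^bsub>cspace N\<^esub>"
    then obtain i where i: "x i \<noteq> 0" by auto
    with x have "i < N" using linorder_not_less by fastforce
    then have "0 < (\<Sum>i<N. (cmod (x i))\<^sup>2)"
      using i by (intro sum_pos2[of _ i]) auto
    then show "0 < Re (sp (cspace N) x x)"
      by (simp flip: complex_norm_square)
  next
    fix X :: "nat \<Rightarrow> nat \<Rightarrow> complex"
    assume X: "\<And>n. X n \<in> carrier (cspace N)"
      and Cauchy: "\<And>e. e > 0 \<Longrightarrow>
        \<exists>M. \<forall>m\<ge>M. \<forall>n\<ge>M. hnorm (cspace N) (X m \<ominus>\<^bsub>cspace N\<^esub> X n) < e"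
    have "convergent (\<lambda>n. X n i)" for i
    proof (cases "i < N")
      case True
      have "Cauchy (\<lambda>n. X n i)"
      proof (rule metric_CauchyI)
        fix e :: real assume "e > 0"
        then obtain M where M: "hnorm (cspace N) (X m \<ominus>\<^bsub>cspace N\<^esub> X n) < e"
          if "m \<ge> M" "n \<ge> M" for m n using Cauchy by meson
        have "dist (X m i) (X n i) < e" if "m \<ge> M" "n \<ge> M" for m n
        proof -
          have "cmod (X m i - X n i) \<le> L2_set (\<lambda>i. cmod (X m i - X n i)) {..<N}"
            using True by (intro member_le_L2_set) auto
          then show ?thesis
            using M[OF that] by (simp add: hnorm_cspace cspace_minus[OF X X] dist_norm)
        qed
        then show "\<exists>M. \<forall>m\<ge>M. \<forall>n\<ge>M. dist (X m i) (X n i) < e" by blast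
      qed
      then show ?thesis by (rule Cauchy_convergent)
    next
      case False
      then have "(\<lambda>n. X n i) = (\<lambda>n. 0)" using X by (auto simp: fun_eq_iff)
      then show ?thesis by (simp add: convergent_const)
    qed
    then obtain l where l: "(\<lambda>n. X n i) \<longlonglongrightarrow> l i" for i
      unfolding convergent_def by metis
    have lc: "l \<in> carrier (cspace N)"
    proof -
      have "l i = 0" if "i \<ge> N" for i
        using l[of i] X that by (simp add: LIMSEQ_const_iff)
      then show ?thesis by simp
    qed
    have "(\<lambda>n. sqrt (\<Sum>i<N. (cmod (X n i - l i))\<^sup>2)) \<longlonglongrightarrow> sqrt (\<Sum>i<N. (cmod (l i - l i))\<^sup>2)"
      by (intro tendsto_intros l)
    then have "(\<lambda>n. hnorm (cspace N) (X n \<ominus>\<^bsub>cspace N\<^esub> l)) \<longlonglongrightarrow> 0"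
      by (simp add: hnorm_cspace cspace_minus[OF X lc] L2_set_def)
    with lc show "\<exists>l\<in>carrier (cspace N). (\<lambda>n. hnorm (cspace N) (X n \<ominus>\<^bsub>cspace N\<^esub> l)) \<longlonglongrightarrow> 0"
      by blast
  qed (auto simp: sum.distrib sum_distrib_left algebra_simps)
qed

context complex_hilbert_space
begin

lemma sp_add_right: "\<lbrakk>x \<in> carrier H; y \<in> carrier H; z \<in> carrier H\<rbrakk>
    \<Longrightarrow> sp H z (x \<oplus> y) = sp H z x + sp H z y"
  using sp_cnj[of _ z] by (simp add: sp_add)

lemma sp_smult_right: "\<lbrakk>x \<in> carrier H; y \<in> carrier H\<rbrakk>
    \<Longrightarrow> sp H y (a \<odot>\<^bsub>H\<^esub> x) = cnj a * sp H y x"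
  using sp_cnj[of _ y] by (simp add: sp_smult)

lemma sp_zero_left: "x \<in> carrier H \<Longrightarrow> sp H \<zero> x = 0"
  using sp_add[of \<zero> \<zero> x] by simp

lemma sp_zero_right: "x \<in> carrier H \<Longrightarrow> sp H x \<zero> = 0"
  using sp_add_right[of \<zero> \<zero> x] by simp

lemma gram_matrix_in_cspace_aux:
  assumes "\<And>i. i < N \<Longrightarrow> x i \<in> carrier H"
  shows "\<exists>y :: nat \<Rightarrow> nat \<Rightarrow> complex. \<forall>i<N. \<forall>j<N. sp H (x i) (x j) = (\<Sum>k<N. y i k * cnj (y j k))"
  using assms
proof (induction N arbitrary: x)
  case (Suc N)
  have xNc: "x N \<in> carrier H" using Suc.prems by simp
  obtain e where e: "e \<in> carrier H" and xN: "x N = sp H (x N) e \<odot>\<^bsub>H\<^esub> e"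
    and ee: "e = \<zero> \<or> sp H e e = 1"
  proof (cases "x N = \<zero>")
    case True
    show ?thesis by (rule that[of \<zero>]) (use True in \<open>simp_all add: sp_zero_left\<close>)
  next
    case False
    define c where "c = hnorm H (x N)"
    have c: "c > 0" "sp H (x N) (x N) = of_real (c ^ 2)"
    proof -
      have pos: "Re (sp H (x N) (x N)) > 0" using False xNc by (rule sp_pos[rotated])
      then show "c > 0" by (simp add: c_def hnorm_def)
      have "Im (sp H (x N) (x N)) = 0"
        using arg_cong[OF sp_cnj[OF xNc xNc], of Im] by simp
      then show "sp H (x N) (x N) = of_real (c ^ 2)"
        using pos by (simp add: c_def hnorm_def complex_eq_iff)
    qed
    define e where "e = of_real (1 / c) \<odot>\<^bsub>H\<^esub> x N"
    have ec: "e \<in> carrier H" using xNc by (simp add: e_def)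
    have xe: "sp H (x N) e = of_real c"
      using c xNc by (simp add: e_def sp_smult_right power2_eq_square)
    have "sp H e e = of_real (1 / c) * sp H (x N) e"
      using xNc ec by (subst (1) e_def) (simp add: sp_smult)
    then have one: "sp H e e = 1" using c xe by simp
    have "sp H (x N) e \<odot>\<^bsub>H\<^esub> e = (of_real c * of_real (1 / c)) \<odot>\<^bsub>H\<^esub> x N"
      unfolding xe using xNc smult_assoc1[of "of_real c" "of_real (1 / c)" "x N"]
      by (simp del: of_real_divide add: e_def)
    then have "x N = sp H (x N) e \<odot>\<^bsub>H\<^esub> e"
      using c(1) xNc smult_one[OF xNc] by simp
    then show ?thesis using that ec one by blast
  qed
  define x' where "x' i = x i \<oplus> (- sp H (x i) e) \<odot>\<^bsub>H\<^esub> e" for i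
  have x'c: "x' i \<in> carrier H" if "i < Suc N" for i
    using Suc.prems[OF that] e by (simp add: x'_def)
  obtain y where y: "\<And>i j. i < N \<Longrightarrow> j < N \<Longrightarrow> sp H (x' i) (x' j) = (\<Sum>k<N. y i k * cnj (y j k))"
    using Suc.IH[of x'] x'c by (metis less_SucI)
  have split: "sp H (x i) (x j) = sp H (x' i) (x' j) + sp H (x i) e * cnj (sp H (x j) e)"
    if "i < Suc N" "j < Suc N" for i j
  proof -
    note c = Suc.prems[OF that(1)] Suc.prems[OF that(2)] e
    have "sp H (x' i) (x' j) = sp H (x i) (x j) - cnj (sp H (x j) e) * sp H (x i) e
        - sp H (x i) e * (sp H e (x j) - cnj (sp H (x j) e) * sp H e e)"
      unfolding x'_def using c
      by (simp add: sp_add sp_add_right sp_smult sp_smult_right algebra_simps)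
    also have "sp H (x i) e * (sp H e (x j) - cnj (sp H (x j) e) * sp H e e) = 0"
      using ee sp_cnj[of "x j" e] c by (auto simp: sp_zero_right)
    finally show ?thesis by (simp add: algebra_simps)
  qed
  have "x' N = (sp H (x N) e + - sp H (x N) e) \<odot>\<^bsub>H\<^esub> e"
    unfolding x'_def
    using smult_l_distr[of "sp H (x N) e" "- sp H (x N) e" e] e xN by simp
  then have "x' N = \<zero>" using e smult_l_null[of e] by simp
  then have x'N: "sp H (x' i) (x' N) = 0" "sp H (x' N) (x' i) = 0" if "i < Suc N" for i
    using x'c[OF that] by (simp_all add: sp_zero_left sp_zero_right)
  define z where "z i k = (if k = N then sp H (x i) e else if i = N then 0 else y i k)" for i k
  have "sp H (x i) (x j) = (\<Sum>k<Suc N. z i k * cnj (z j k))" if "i < Suc N" "j < Suc N" for i j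
    using that x'N y split[OF that] by (auto simp: z_def less_Suc_eq)
  then show ?case by blast
qed simp

lemma gram_matrix_in_cspace:
  fixes u v :: "nat \<Rightarrow> 'h"
  assumes "\<And>i. i < m \<Longrightarrow> u i \<in> carrier H" "\<And>j. j < n \<Longrightarrow> v j \<in> carrier H"
  obtains u' v' N where
    "\<And>i. u' i \<in> carrier (cspace N)" "\<And>j. v' j \<in> carrier (cspace N)"
    "\<And>i. i < m \<Longrightarrow> hnorm (cspace N) (u' i) = hnorm H (u i)"
    "\<And>j. j < n \<Longrightarrow> hnorm (cspace N) (v' j) = hnorm H (v j)"
    "\<And>i j. i < m \<Longrightarrow> j < n \<Longrightarrow> sp (cspace N) (u' i) (v' j) = sp H (u i) (v j)"
    "\<And>i j. i < m \<Longrightarrow> j < n \<Longrightarrow> sp (cspace N) (v' j) (u' i) = sp H (v j) (u i)"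
proof -
  define x where "x i = (if i < m then u i else v (i - m))" for i :: nat
  have "x i \<in> carrier H" if "i < m + n" for i
    using assms that by (auto simp: x_def)
  then obtain y where y: "\<And>i j. i < m + n \<Longrightarrow> j < m + n \<Longrightarrow>
      sp H (x i) (x j) = (\<Sum>k<m+n. y i k * cnj (y j k))"
    using gram_matrix_in_cspace_aux[of "m + n" x] by metis
  define z where "z i k = (if k < m + n then y i k else 0)" for i k
  have z: "sp (cspace (m + n)) (z i) (z j) = sp H (x i) (x j)" if "i < m + n" "j < m + n" for i j
    using y[OF that] by (simp add: z_def)
  show ?thesis
  proof (rule that[of z "m + n" "\<lambda>j. z (m + j)"])
    show "z i \<in> carrier (cspace (m + n))" "z (m + i) \<in> carrier (cspace (m + n))" for i
      by (simp_all add: z_def)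
    show "hnorm (cspace (m + n)) (z i) = hnorm H (u i)" if "i < m" for i
      using z[of i i] that by (simp add: hnorm_def x_def del: cspace_simps)
    show "hnorm (cspace (m + n)) (z (m + i)) = hnorm H (v i)" if "i < n" for i
      using z[of "m + i" "m + i"] that by (simp add: hnorm_def x_def del: cspace_simps)
    show "sp (cspace (m + n)) (z i) (z (m + j)) = sp H (u i) (v j)" if "i < m" "j < n" for i j
      using z[of i "m + j"] that by (simp add: x_def del: cspace_simps)
    show "sp (cspace (m + n)) (z (m + j)) (z i) = sp H (v j) (u i)" if "i < m" "j < n" for i j
      using z[of "m + j" i] that by (simp add: x_def del: cspace_simps)
  qed
qed

lemma grothendieck_bound_all_spaces:
  assumes "grothendieck_bound K" "A \<in> carrier_mat m n"
    and "\<And>i. i < m \<Longrightarrow> u i \<in> carrier H \<and> hnorm H (u i) \<le> 1"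
    and "\<And>j. j < n \<Longrightarrow> v j \<in> carrier H \<and> hnorm H (v j) \<le> 1"
  shows "cmod (\<Sum>i<m. \<Sum>j<n. A $$ (i, j) * sp H (u i) (v j)) \<le> K * norm_inf_1 A"
proof -
  obtain u' v' N where *:
    "\<And>i. u' i \<in> carrier (cspace N)" "\<And>j. v' j \<in> carrier (cspace N)"
    "\<And>i. i < m \<Longrightarrow> hnorm (cspace N) (u' i) = hnorm H (u i)"
    "\<And>j. j < n \<Longrightarrow> hnorm (cspace N) (v' j) = hnorm H (v j)"
    "\<And>i j. i < m \<Longrightarrow> j < n \<Longrightarrow> sp (cspace N) (u' i) (v' j) = sp H (u i) (v j)"
    by (rule gram_matrix_in_cspace[of m u n v]) (use assms in auto)
  have "cmod (\<Sum>i<m. \<Sum>j<n. A $$ (i, j) * sp (cspace N) (u' i) (v' j)) \<le> K * norm_inf_1 A"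
    using assms(1)[unfolded grothendieck_bound_def, rule_format, OF assms(2)
        complex_hilbert_space_cspace, of u' N v'] * assms(3,4)
    by (simp del: cspace_simps)
  then show ?thesis
    using *(5) by (simp del: cspace_simps)
qed

lemma Q_matI:
  assumes "\<And>i. i < m \<Longrightarrow> u i \<in> carrier H \<and> hnorm H (u i) = 1"
    and "\<And>j. j < n \<Longrightarrow> v j \<in> carrier H \<and> hnorm H (v j) = 1"
  shows "mat m n (\<lambda>(i, j). sp H (v j) (u i)) \<in> Q_mat m n"
proof -
  obtain u' v' N where *:
    "\<And>i. u' i \<in> carrier (cspace N)" "\<And>j. v' j \<in> carrier (cspace N)"
    "\<And>i. i < m \<Longrightarrow> hnorm (cspace N) (u' i) = hnorm H (u i)"
    "\<And>j. j < n \<Longrightarrow> hnorm (cspace N) (v' j) = hnorm H (v j)"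
    "\<And>i j. i < m \<Longrightarrow> j < n \<Longrightarrow> sp (cspace N) (v' j) (u' i) = sp H (v j) (u i)"
    by (rule gram_matrix_in_cspace[of m u n v]) (use assms in auto)
  have "mat m n (\<lambda>(i, j). sp H (v j) (u i)) = mat m n (\<lambda>(i, j). sp (cspace N) (v' j) (u' i))"
    by (rule eq_matI) (use *(5) in \<open>simp_all del: cspace_simps\<close>)
  then show ?thesis
    unfolding Q_mat_def using *(1-4) assms complex_hilbert_space_cspace[of N]
    by (intro CollectI exI[of _ "cspace N"] exI[of _ u'] exI[of _ v'])
      (simp_all del: cspace_simps)
qed

end


section \<open>Gaussian laws\<close>

definition std_gaussian :: "(real^'n) measure" where
  "std_gaussian = density lborel (\<lambda>x. ennreal (exp (- (norm x)\<^sup>2 / 2) / sqrt (2 * pi) ^ CARD('n)))"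

text \<open>The centred Gaussian law with positive semidefinite covariance matrix \<open>\<Sigma>\<close>, possibly
  degenerate: the law of \<open>A X\<close> with \<open>X\<close> standard Gaussian and \<open>A A\<^sup>T = \<Sigma>\<close>.
  By rotation invariance of the standard Gaussian law it does not depend on the choice of
  \<open>A\<close>.\<close>

definition gaussian_law :: "real^'n^'n \<Rightarrow> (real^'n) measure" where
  "gaussian_law \<Sigma> =
     distr std_gaussian borel (\<lambda>x. (SOME A :: real^'n^'n. A ** transpose A = \<Sigma>) *v x)"

text \<open>The vectors of \<open>\<real>\<^sup>2\<^sup>k\<close> are indexed by \<open>'k + 'k\<close>; those of \<open>\<complex>\<^sup>2\<^sup>k\<close>
  and \<open>\<real>\<^sup>4\<^sup>k\<close> likewise.\<close>

definition left_half :: "'a^('n + 'n) \<Rightarrow> 'a^'n" where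
  "left_half x = (\<chi> i. x $ Inl i)"

definition right_half :: "'a^('n + 'n) \<Rightarrow> 'a^'n" where
  "right_half x = (\<chi> i. x $ Inr i)"

definition block_matrix ::
  "'a^'n^'n \<Rightarrow> 'a^'n^'n \<Rightarrow> 'a^'n^'n \<Rightarrow> 'a^'n^'n \<Rightarrow> 'a^('n + 'n)^('n + 'n)" where
  "block_matrix P Q R S = (\<chi> i j. case (i, j) of
     (Inl a, Inl b) \<Rightarrow> P $ a $ b | (Inl a, Inr b) \<Rightarrow> Q $ a $ b
   | (Inr a, Inl b) \<Rightarrow> R $ a $ b | (Inr a, Inr b) \<Rightarrow> S $ a $ b)"

definition to_complex :: "real^('n + 'n) \<Rightarrow> complex^'n" where
  "to_complex w = (\<chi> i. Complex (w $ Inl i) (w $ Inr i) / complex_of_real (sqrt 2))"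

definition cgaussian_law :: "complex^'n^'n \<Rightarrow> (complex^'n) measure" where
  "cgaussian_law \<Gamma> = distr
     (gaussian_law (block_matrix (map_matrix Re \<Gamma>) (- map_matrix Im \<Gamma>)
                                 (map_matrix Im \<Gamma>) (map_matrix Re \<Gamma>)))
     borel to_complex"

definition std_cgaussian :: "(complex^'k) measure" where
  "std_cgaussian = density lborel (\<lambda>z. ennreal (exp (- (norm z)\<^sup>2) / pi ^ CARD('k)))"


section \<open>Function spaces and the functions h and H\<close>

definition Linf_norm :: "(complex^'k \<Rightarrow> complex) \<Rightarrow> ereal" where
  "Linf_norm b = esssup lborel (\<lambda>z. ereal (cmod (b z)))"

definition L_inf :: "(complex^'k \<Rightarrow> complex) set" where
  "L_inf = {b. b \<in> borel_measurable borel \<and> Linf_norm b < \<infinity>}"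

definition gauss_norm :: "(complex^'k \<Rightarrow> complex) \<Rightarrow> real" where
  "gauss_norm b = sqrt (\<integral>z. (cmod (b z))\<^sup>2 \<partial>std_cgaussian)"

definition h_complex ::
  "(complex^'k \<Rightarrow> complex) \<Rightarrow> (complex^'k \<Rightarrow> complex) \<Rightarrow> complex \<Rightarrow> complex" where
  "h_complex b c \<zeta> = (\<integral>x. b (left_half x) * cnj (c (right_half x)) \<partial>cgaussian_law
     (block_matrix (Finite_Cartesian_Product.mat 1) (Finite_Cartesian_Product.mat \<zeta>)
                   (Finite_Cartesian_Product.mat (cnj \<zeta>)) (Finite_Cartesian_Product.mat 1)))"

definition h_real :: "(real^'n \<Rightarrow> real) \<Rightarrow> (real^'n \<Rightarrow> real) \<Rightarrow> real \<Rightarrow> real" where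
  "h_real f g \<rho> = (\<integral>x. f (left_half x) * g (right_half x) \<partial>gaussian_law
     (block_matrix (Finite_Cartesian_Product.mat 1) (Finite_Cartesian_Product.mat \<rho>)
                   (Finite_Cartesian_Product.mat \<rho>) (Finite_Cartesian_Product.mat 1)))"

definition H_fun :: "(real^'n \<Rightarrow> real) \<Rightarrow> (real^'n \<Rightarrow> real) \<Rightarrow> real \<Rightarrow> real" where
  "H_fun f g \<rho> = h_real f f \<rho> + h_real g g \<rho>"

definition H_inv :: "(real^'n \<Rightarrow> real) \<Rightarrow> (real^'n \<Rightarrow> real) \<Rightarrow> real \<Rightarrow> real" where
  "H_inv f g = the_inv_into {-1..1} (H_fun f g)"

definition re_part :: "(complex^'k \<Rightarrow> complex) \<Rightarrow> real^('k + 'k) \<Rightarrow> real" where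
  "re_part b w = Re (b (to_complex w))"

definition im_part :: "(complex^'k \<Rightarrow> complex) \<Rightarrow> real^('k + 'k) \<Rightarrow> real" where
  "im_part b w = Im (b (to_complex w))"


section \<open>Real analytic functions with absolutely summable Taylor coefficients\<close>

definition real_analytic_on :: "(real \<Rightarrow> real) \<Rightarrow> real set \<Rightarrow> bool" (infix "real'_analytic'_on" 50)
  where "\<psi> real_analytic_on S \<longleftrightarrow>
    (\<forall>x\<in>S. \<exists>e>0. \<exists>a. \<forall>y. \<bar>y - x\<bar> < e \<longrightarrow> (\<lambda>n. a n * (y - x) ^ n) sums \<psi> y)"

text \<open>Functions on \<open>(-\<rho>, \<rho>)\<close> are represented by total functions; everything below depends
  only on their values on that interval.\<close>

definition W_plus :: "real \<Rightarrow> (real \<Rightarrow> real) set" where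
  "W_plus \<rho> = {\<psi>. \<psi> real_analytic_on {-\<rho><..<\<rho>} \<and>
     summable (\<lambda>n. \<bar>(deriv ^^ n) \<psi> 0\<bar> / fact n * \<rho> ^ n)}"

definition abs_series :: "(real \<Rightarrow> real) \<Rightarrow> real \<Rightarrow> real" where
  "abs_series \<psi> x = (\<Sum>n. \<bar>(deriv ^^ n) \<psi> 0\<bar> / fact n * x ^ n)"

definition complex_series :: "(real \<Rightarrow> real) \<Rightarrow> complex \<Rightarrow> complex" where
  "complex_series \<psi> z = (\<Sum>n. complex_of_real ((deriv ^^ n) \<psi> 0 / fact n) * z ^ n)"

definition H_hyp :: "(real^'n \<Rightarrow> real) \<Rightarrow> (real^'n \<Rightarrow> real) \<Rightarrow> real \<Rightarrow> real" where
  "H_hyp f g = the_inv_into {-1..1} (abs_series (H_inv f g))"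

end

theory Submission
  imports Defs "HOL-Complex_Analysis.Complex_Analysis"
begin

no_notation scalar_prod (infix "\<bullet>" 70)
unbundle no fps_syntax
hide_const (open) Matrix.mat
hide_fact (open) Matrix.mat_def Matrix.vec_eq_iff

text \<open>If \<open>Z\<^sub>u\<close> denotes the image of a standard complex Gaussian array under a unit vector \<open>u\<close>,
  then \<open>h\<^sub>b\<^sub>c(\<langle>u, v\<rangle>) = E (b(Z\<^sub>u) cnj (c(Z\<^sub>v)))\<close>, so that matrices of values of \<open>h\<^sub>b\<^sub>c\<close> are averages of
  rank-one matrices with bounded entries; this is part (i).  For circularly symmetric \<open>b\<close> the function
  \<open>h\<^sub>b\<^sub>b\<close> is \<open>\<alpha> x \<mapsto> \<alpha> r h(x)\<close>, where \<open>h\<close> is the normalized \<open>H\<close>.  Positive semidefiniteness of the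
  matrices \<open>h\<^sub>b\<^sub>b(\<langle>u, v\<rangle>)\<close> makes all finite differences of \<open>h\<close> at \<open>0\<close> nonnegative, and Bernstein
  polynomials turn this into a power series with nonnegative coefficients; no Hermite expansion is needed.
  Analyticity of the inverse \<open>\<phi>\<close> of \<open>h\<close> and the identity theorem extend both power series to the
  closed interval.

  For (ii-1), tensor powers show that the matrices \<open>\<phi>(c\<^sup>* \<langle>u, v\<rangle>)\<close> are again matrices of inner products of
  vectors in the unit ball, and \<open>h\<^sub>b\<^sub>b\<close> maps them to \<open>r c\<^sup>* \<langle>u, v\<rangle>\<close>.  For (ii-2), if \<open>|b|\<close> is constant,
  then \<open>h\<^sub>b\<^sub>b(\<langle>u, v\<rangle>) / r\<close> lies in the unit ball of the dual norm, which is closed under entrywise products,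
  so that \<open>\<langle>u, v\<rangle> = \<phi>(h(\<langle>u, v\<rangle>))\<close> has dual norm at most \<open>\<phi>\<^sub>a\<^sub>b\<^sub>s(1)\<close>.\<close>

text \<open>The laws of the definitions are images of a standard Gaussian vector under an
  unspecified square root of the covariance matrix. They are therefore identified through
  characteristic functions, and one product of independent standard complex Gaussians serves all
  vectors u at once. The coefficients of \<phi> may be negative, and each has to be paid for with
  its absolute value, whether vectors are combined or dual norms are added. This is the origin of
  \<open>abs_series\<close>, and \<open>hyp 1\<close> is the scale at which the combined vectors
  just fit into the unit ball. The strict inequality \<open>hyp 1 < 1\<close> does not follow from
  power series alone: it fails for h(x) = x, which is the correlation function of the unbounded
  symmetric function b(z) = z_1. Boundedness of b has to enter there. No Grothendieck inequality is
  presupposed. That admissible constants exist at all, so that \<open>K_G\<close> is a genuine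
  minimum, is part of what the argument for (ii-1) yields.\<close>

lemma sum_UNIV_Plus: "(\<Sum>i\<in>UNIV. f i) = (\<Sum>a\<in>UNIV. f (Inl a)) + (\<Sum>b\<in>UNIV. f (Inr b))"
  for f :: "'a::finite + 'b::finite \<Rightarrow> 'c::comm_monoid_add"
  by (subst UNIV_Plus_UNIV [symmetric], subst sum.Plus) auto

subsection \<open>The standard Gaussian measure on a Euclidean space\<close>

text \<open>One measure for all Euclidean spaces covers real^n and complex^k alike. The density is
  written as a product over the basis so that integrals factor into one-dimensional ones.\<close>

definition gauss :: "'a::euclidean_space measure" where
  "gauss = density lborel (\<lambda>x. ennreal (\<Prod>b\<in>Basis. std_normal_density (x \<bullet> b)))"

lemma sets_gauss [simp, measurable_cong]: "sets gauss = sets borel"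
  and space_gauss [simp]: "space gauss = UNIV"
  by (simp_all add: gauss_def)

lemma prod_std_normal_density:
  fixes x :: "'a::euclidean_space"
  shows "(\<Prod>b\<in>Basis. std_normal_density (x \<bullet> b)) = exp (- (norm x)\<^sup>2 / 2) / sqrt (2 * pi) ^ DIM('a)"
proof -
  have "(norm x)\<^sup>2 = (\<Sum>b\<in>Basis. (x \<bullet> b)\<^sup>2)"
    unfolding power2_norm_eq_inner euclidean_inner[of x x] by (simp add: power2_eq_square)
  then show ?thesis
    by (simp add: std_normal_density_def prod.distrib prod_dividef exp_sum [symmetric] sum_negf
        sum_divide_distrib)
qed

lemma prob_space_gauss: "prob_space (gauss :: 'a::euclidean_space measure)"
proof
  have 1: "(\<integral>\<^sup>+x. ennreal (std_normal_density x) \<partial>lborel) = 1"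
    using prob_space.emeasure_space_1[OF prob_space_normal_density[of 1 0]]
    by (simp add: emeasure_density)
  have "emeasure gauss (space (gauss :: 'a measure)) =
      (\<integral>\<^sup>+(x::'a). (\<Prod>b\<in>Basis. ennreal (std_normal_density (x \<bullet> b))) \<partial>lborel)"
    by (simp add: gauss_def emeasure_density prod_ennreal)
  also have "\<dots> = 1"
    by (subst nn_integral_lborel_prod) (auto simp: 1)
  finally show "emeasure gauss (space (gauss :: 'a measure)) = 1" .
qed

interpretation gauss: prob_space "gauss :: 'a::euclidean_space measure"
  by (rule prob_space_gauss)

text \<open>The multivariate counterpart of \<open>char\<close>.\<close>

definition echar :: "'a::euclidean_space measure \<Rightarrow> 'a \<Rightarrow> complex" where
  "echar M t = (\<integral>x. cis (t \<bullet> x) \<partial>M)"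

lemma cis_sum: "finite A \<Longrightarrow> cis (\<Sum>i\<in>A. f i) = (\<Prod>i\<in>A. cis (f i))"
  by (induction A rule: finite_induct) (auto simp: cis_mult [symmetric])

lemma measurable_cis [measurable]: "cis \<in> borel_measurable borel"
  by (intro borel_measurable_continuous_onI continuous_intros)

lemma measurable_cnj [measurable]: "cnj \<in> borel_measurable borel"
  by (intro borel_measurable_continuous_onI continuous_intros)

text \<open>Density and exponential both factor over the basis, so the integral is a product of
  one-dimensional characteristic functions of the standard normal law.\<close>

lemma echar_gauss:
  fixes t :: "'a::euclidean_space"
  shows "echar gauss t = complex_of_real (exp (- (norm t)\<^sup>2 / 2))"
proof -
  interpret product_sigma_finite "\<lambda>b::'a. lborel :: real measure" ..
  define F where "F b y = std_normal_density y *\<^sub>R cis ((t \<bullet> b) * y)" for b :: 'a and y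
  have [measurable]: "F b \<in> borel_measurable borel" for b
    unfolding F_def by measurable
  have int: "integrable lborel (F b)" for b
  proof -
    have "integrable lborel std_normal_density"
      using integrable_normal_density[of 1 0] by simp
    then show ?thesis
      by (rule Bochner_Integration.integrable_bound) (auto simp: F_def)
  qed
  have F: "(\<integral>y. F b y \<partial>lborel) = complex_of_real (exp (- (t \<bullet> b)\<^sup>2 / 2))" for b
  proof -
    have "(\<integral>y. F b y \<partial>lborel) = char std_normal_distribution (t \<bullet> b)"
      by (simp add: F_def char_def integral_density cis_conv_exp)
    then show ?thesis
      by (simp add: char_std_normal_distribution)
  qed
  have inner: "t \<bullet> x = (\<Sum>b\<in>Basis. (t \<bullet> b) * (x \<bullet> b))" for x
    by (rule euclidean_inner)
  have "echar gauss t = (\<integral>x. (\<Prod>b\<in>Basis. std_normal_density (x \<bullet> b)) *\<^sub>R cis (t \<bullet> x) \<partial>lborel)"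
    unfolding echar_def gauss_def
    by (subst integral_density) (auto intro!: prod_nonneg)
  also have "\<dots> = (\<integral>x. (\<Prod>b\<in>Basis. F b (x \<bullet> b)) \<partial>lborel)"
  proof (intro Bochner_Integration.integral_cong refl)
    fix x
    show "(\<Prod>b\<in>Basis. std_normal_density (x \<bullet> b)) *\<^sub>R cis (t \<bullet> x) = (\<Prod>b\<in>Basis. F b (x \<bullet> b))"
      by (subst inner) (simp add: F_def cis_sum scaleR_conv_of_real prod.distrib)
  qed
  \<comment> \<open>Lebesgue measure is the image of a product measure indexed by
    \<open>Basis\<close>; over that product measure the integral of a product splits.\<close>
  also have "\<dots> = (\<integral>f. (\<Prod>b\<in>Basis. F b ((\<Sum>b\<in>Basis. f b *\<^sub>R b) \<bullet> b)) \<partial>(\<Pi>\<^sub>M b\<in>Basis. lborel))"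
    unfolding lborel_eq[where 'a='a]
    by (subst integral_distr) (auto simp: F_def)
  also have "\<dots> = (\<integral>f. (\<Prod>b\<in>Basis. F b (f b)) \<partial>(\<Pi>\<^sub>M b\<in>(Basis::'a set). lborel))"
    by (intro Bochner_Integration.integral_cong prod.cong arg_cong2[where f=F] refl)
      (simp add: inner_sum_left inner_Basis if_distrib sum.delta cong: if_cong)
  also have "\<dots> = (\<Prod>b\<in>Basis. \<integral>y. F b y \<partial>lborel)"
    by (rule product_integral_prod) (auto simp: int)
  also have "\<dots> = complex_of_real (exp (- (\<Sum>b\<in>Basis. (t \<bullet> b)\<^sup>2) / 2))"
    by (simp add: F exp_sum [symmetric] sum_negf sum_divide_distrib flip: of_real_prod)
  also have "(\<Sum>b\<in>Basis. (t \<bullet> b)\<^sup>2) = (norm t)\<^sup>2"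
    unfolding power2_norm_eq_inner euclidean_inner[of t t] by (simp add: power2_eq_square)
  finally show ?thesis .
qed

lemma integrable_cis_inner:
  assumes "prob_space M" "sets M = sets borel" "f \<in> borel_measurable M"
  shows "integrable M (\<lambda>x. cis (f x))"
proof -
  interpret prob_space M by fact
  show ?thesis
    by (rule integrable_const_bound[where B=1]) (use assms in auto)
qed

subsection \<open>Uniqueness of characteristic functions\<close>

abbreviation gauss_kernel :: "'a::euclidean_space \<Rightarrow> real" where
  "gauss_kernel z \<equiv> exp (- (norm z)\<^sup>2 / 2)"

text \<open>The Gaussian kernel is itself a characteristic function, namely that of
  \<open>gauss\<close>. Inserting this and exchanging the integrals expresses the smoothed measure
  by values of \<open>echar M\<close> alone.\<close>

lemma gauss_smoothing_kernel:
  fixes M :: "'a::euclidean_space measure"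
  assumes M: "prob_space M" "sets M = sets borel"
  shows "complex_of_real (\<integral>x. gauss_kernel ((y - x) /\<^sub>R s) \<partial>M) =
    (\<integral>t. cis ((y /\<^sub>R s) \<bullet> t) * echar M (- t /\<^sub>R s) \<partial>gauss)"
proof -
  interpret M: prob_space M by fact
  interpret P: pair_prob_space M "gauss :: 'a measure" ..
  note M(2)[measurable_cong]
  have "complex_of_real (\<integral>x. gauss_kernel ((y - x) /\<^sub>R s) \<partial>M) =
      (\<integral>x. echar gauss ((y - x) /\<^sub>R s) \<partial>M)"
    by (simp add: echar_gauss)
  also have "\<dots> = (\<integral>x. (\<integral>t. cis ((y /\<^sub>R s) \<bullet> t) * cis ((- t /\<^sub>R s) \<bullet> x) \<partial>gauss) \<partial>M)"
    unfolding echar_def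
    by (intro Bochner_Integration.integral_cong refl)
      (simp add: cis_mult inner_diff_left inner_commute algebra_simps)
  also have "\<dots> = (\<integral>t. (\<integral>x. cis ((y /\<^sub>R s) \<bullet> t) * cis ((- t /\<^sub>R s) \<bullet> x) \<partial>M) \<partial>gauss)"
    by (rule P.Fubini_integral [symmetric], rule P.P.integrable_const_bound[where B=1])
      (auto simp: norm_mult)
  also have "\<dots> = (\<integral>t. cis ((y /\<^sub>R s) \<bullet> t) * echar M (- t /\<^sub>R s) \<partial>gauss)"
    unfolding echar_def
    by simp
  finally show ?thesis .
qed

text \<open>The left side integrates g against the law of X + s Z, with X of law \<open>M\<close>
  and Z an independent standard Gaussian. The substitution y = x + s z gives this law a density,
  which by \<open>gauss_smoothing_kernel\<close> is determined by the characteristic function of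
  \<open>M\<close>.\<close>

lemma gauss_smoothing_density:
  fixes M :: "'a::euclidean_space measure"
  assumes M: "prob_space M" "sets M = sets borel" and s: "s > 0"
    and g[measurable]: "g \<in> borel_measurable borel"
  shows "(\<integral>\<^sup>+x. \<integral>\<^sup>+z. g (x + s *\<^sub>R z) \<partial>gauss \<partial>M) =
    (\<integral>\<^sup>+y. g y * (ennreal (1 / (s * sqrt (2 * pi)) ^ DIM('a)) *
       (\<integral>\<^sup>+x. ennreal (gauss_kernel ((y - x) /\<^sub>R s)) \<partial>M)) \<partial>lborel)"
proof -
  interpret M: prob_space M by fact
  interpret P: pair_sigma_finite M "lborel :: 'a measure" ..
  note M(2)[measurable_cong]
  define k where "k z = gauss_kernel z / sqrt (2 * pi) ^ DIM('a)" for z :: 'a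
  have [measurable]: "k \<in> borel_measurable borel" unfolding k_def by measurable
  have k0: "k z \<ge> 0" for z by (simp add: k_def)
  have "(\<integral>\<^sup>+z. g (x + s *\<^sub>R z) \<partial>gauss) =
      (\<integral>\<^sup>+y. g y * ennreal (k ((y - x) /\<^sub>R s) / s ^ DIM('a)) \<partial>lborel)" for x
  proof -
    have "(\<integral>\<^sup>+y. g y * ennreal (k ((y - x) /\<^sub>R s) / s ^ DIM('a)) \<partial>lborel) =
        (\<integral>\<^sup>+z. ennreal (s ^ DIM('a)) * (g (x + s *\<^sub>R z) * ennreal (k z / s ^ DIM('a))) \<partial>lborel)"
      by (subst lborel_affine[of s x]) (use s in \<open>simp_all add: nn_integral_density nn_integral_distr\<close>)
    also have "\<dots> = (\<integral>\<^sup>+z. ennreal (k z) * g (x + s *\<^sub>R z) \<partial>lborel)"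
    proof (intro nn_integral_cong)
      fix z
      have "ennreal (k z) = ennreal (s ^ DIM('a)) * ennreal (k z / s ^ DIM('a))"
        using s k0 by (subst ennreal_mult' [symmetric]) auto
      then show "ennreal (s ^ DIM('a)) * (g (x + s *\<^sub>R z) * ennreal (k z / s ^ DIM('a))) =
          ennreal (k z) * g (x + s *\<^sub>R z)"
        by (simp add: mult_ac)
    qed
    also have "\<dots> = (\<integral>\<^sup>+z. g (x + s *\<^sub>R z) \<partial>gauss)"
      by (simp add: gauss_def nn_integral_density prod_std_normal_density k_def)
    finally show ?thesis ..
  qed
  then have "(\<integral>\<^sup>+x. \<integral>\<^sup>+z. g (x + s *\<^sub>R z) \<partial>gauss \<partial>M) =
      (\<integral>\<^sup>+x. \<integral>\<^sup>+y. g y * ennreal (k ((y - x) /\<^sub>R s) / s ^ DIM('a)) \<partial>lborel \<partial>M)"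
    by simp
  also have "\<dots> = (\<integral>\<^sup>+y. \<integral>\<^sup>+x. g y * ennreal (k ((y - x) /\<^sub>R s) / s ^ DIM('a)) \<partial>M \<partial>lborel)"
    by (rule P.Fubini' [symmetric]) measurable
  also have "\<dots> = (\<integral>\<^sup>+y. g y * (ennreal (1 / (s * sqrt (2 * pi)) ^ DIM('a)) *
       (\<integral>\<^sup>+x. ennreal (gauss_kernel ((y - x) /\<^sub>R s)) \<partial>M)) \<partial>lborel)"
  proof (intro nn_integral_cong)
    fix y
    have "(\<integral>\<^sup>+x. g y * ennreal (k ((y - x) /\<^sub>R s) / s ^ DIM('a)) \<partial>M) =
        (\<integral>\<^sup>+x. (g y * ennreal (1 / (s * sqrt (2 * pi)) ^ DIM('a))) *
           ennreal (gauss_kernel ((y - x) /\<^sub>R s)) \<partial>M)"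
      using s by (intro nn_integral_cong)
        (simp add: k_def mult.assoc power_mult_distrib mult_ac flip: ennreal_mult')
    also have "\<dots> = g y * (ennreal (1 / (s * sqrt (2 * pi)) ^ DIM('a)) *
       (\<integral>\<^sup>+x. ennreal (gauss_kernel ((y - x) /\<^sub>R s)) \<partial>M))"
      by (subst nn_integral_cmult) (auto simp: mult.assoc)
    finally show "(\<integral>\<^sup>+x. g y * ennreal (k ((y - x) /\<^sub>R s) / s ^ DIM('a)) \<partial>M) = \<dots>" .
  qed
  finally show ?thesis .
qed

lemma gauss_smoothing_limit:
  fixes M :: "'a::euclidean_space measure" and g :: "'a \<Rightarrow> real"
  assumes M: "prob_space M" "sets M = sets borel"
    and g: "continuous_on UNIV g" "\<And>x. 0 \<le> g x" "\<And>x. g x \<le> B"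
  shows "(\<lambda>n. \<integral>\<^sup>+x. \<integral>\<^sup>+z. ennreal (g (x + (1 / real (Suc n)) *\<^sub>R z)) \<partial>gauss \<partial>M)
    \<longlonglongrightarrow> (\<integral>\<^sup>+x. ennreal (g x) \<partial>M)"
proof -
  interpret M: prob_space M by fact
  note M(2)[measurable_cong]
  have [measurable]: "g \<in> borel_measurable borel"
    using g(1) by (rule borel_measurable_continuous_onI)
  have B: "ennreal (g x) \<le> ennreal B" for x
    by (intro ennreal_leI g)
  have inner: "(\<lambda>n. \<integral>\<^sup>+z. ennreal (g (x + (1 / real (Suc n)) *\<^sub>R z)) \<partial>gauss) \<longlonglongrightarrow> ennreal (g x)" for x
  proof -
    have "(\<lambda>n. \<integral>\<^sup>+z. ennreal (g (x + (1 / real (Suc n)) *\<^sub>R z)) \<partial>gauss)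
        \<longlonglongrightarrow> (\<integral>\<^sup>+(z::'a). ennreal (g x) \<partial>gauss)"
    proof (rule nn_integral_dominated_convergence[where w="\<lambda>_. ennreal B"])
      show "AE z in gauss. (\<lambda>n. ennreal (g (x + (1 / real (Suc n)) *\<^sub>R z))) \<longlonglongrightarrow> ennreal (g x)"
      proof (intro AE_I2 tendsto_ennrealI)
        fix z :: 'a
        have "(\<lambda>n. x + (1 / real (Suc n)) *\<^sub>R z) \<longlonglongrightarrow> x + 0 *\<^sub>R z"
          by (intro tendsto_intros LIMSEQ_inverse_real_of_nat[unfolded inverse_eq_divide])
        then have "(\<lambda>n. x + (1 / real (Suc n)) *\<^sub>R z) \<longlonglongrightarrow> x" by simp
        then show "(\<lambda>n. g (x + (1 / real (Suc n)) *\<^sub>R z)) \<longlonglongrightarrow> g x"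
          using g(1) continuous_on_tendsto_compose[of UNIV g _ x sequentially] by auto
      qed
    qed (use B in \<open>auto simp: gauss.emeasure_space_1[unfolded space_gauss] ennreal_less_top\<close>)
    then show ?thesis by (simp add: gauss.emeasure_space_1[unfolded space_gauss])
  qed
  show ?thesis
  proof (rule nn_integral_dominated_convergence[where w="\<lambda>_. ennreal B"])
    show "AE x in M. (\<integral>\<^sup>+z. ennreal (g (x + (1 / real (Suc n)) *\<^sub>R z)) \<partial>gauss) \<le> ennreal B" for n
    proof (intro AE_I2)
      fix x
      have "(\<integral>\<^sup>+z. ennreal (g (x + (1 / real (Suc n)) *\<^sub>R z)) \<partial>gauss) \<le> (\<integral>\<^sup>+(z::'a). ennreal B \<partial>gauss)"
        by (intro nn_integral_mono B)
      then show "(\<integral>\<^sup>+z. ennreal (g (x + (1 / real (Suc n)) *\<^sub>R z)) \<partial>gauss) \<le> ennreal B"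
        by (simp add: gauss.emeasure_space_1[unfolded space_gauss])
    qed
  qed (use inner in \<open>auto simp: M.emeasure_space_1 ennreal_less_top\<close>)
qed

text \<open>The laws of X + Z / (n + 1), with Z an independent standard Gaussian, agree for
  \<open>M\<close> and \<open>N\<close> because their densities depend on the characteristic
  function only. Letting n grow gives equal integrals of bounded continuous functions, hence equal
  measures of closed sets, and these generate the Borel sets.\<close>

theorem echar_unique:
  fixes M N :: "'a::euclidean_space measure"
  assumes M: "prob_space M" "sets M = sets borel" and N: "prob_space N" "sets N = sets borel"
    and eq: "\<And>t. echar M t = echar N t"
  shows "M = N"
proof -
  interpret M: prob_space M by fact
  interpret N: prob_space N by fact
  note M(2)[measurable_cong] N(2)[measurable_cong]
  have kernel: "(\<integral>\<^sup>+x. ennreal (gauss_kernel ((y - x) /\<^sub>R s)) \<partial>M) =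
      (\<integral>\<^sup>+x. ennreal (gauss_kernel ((y - x) /\<^sub>R s)) \<partial>N)" for y s
  proof -
    have "complex_of_real (\<integral>x. gauss_kernel ((y - x) /\<^sub>R s) \<partial>M) =
        complex_of_real (\<integral>x. gauss_kernel ((y - x) /\<^sub>R s) \<partial>N)"
      by (simp only: gauss_smoothing_kernel[OF M] gauss_smoothing_kernel[OF N] eq)
    moreover have "integrable M (\<lambda>x. gauss_kernel ((y - x) /\<^sub>R s))"
      by (rule M.integrable_const_bound[where B=1]) auto
    moreover have "integrable N (\<lambda>x. gauss_kernel ((y - x) /\<^sub>R s))"
      by (rule N.integrable_const_bound[where B=1]) auto
    ultimately show ?thesis
      by (simp add: nn_integral_eq_integral)
  qed
  have cont: "(\<integral>\<^sup>+x. ennreal (g x) \<partial>M) = (\<integral>\<^sup>+x. ennreal (g x) \<partial>N)"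
    if g: "continuous_on UNIV g" "\<And>x. 0 \<le> g x" "\<And>x. g x \<le> B" for g :: "'a \<Rightarrow> real" and B
  proof -
    have [measurable]: "g \<in> borel_measurable borel"
      using g(1) by (rule borel_measurable_continuous_onI)
    have "(\<integral>\<^sup>+x. \<integral>\<^sup>+z. ennreal (g (x + (1 / real (Suc n)) *\<^sub>R z)) \<partial>gauss \<partial>M) =
        (\<integral>\<^sup>+x. \<integral>\<^sup>+z. ennreal (g (x + (1 / real (Suc n)) *\<^sub>R z)) \<partial>gauss \<partial>N)" for n
    proof -
      have s: "1 / real (Suc n) > 0" by simp
      have g': "(\<lambda>x. ennreal (g x)) \<in> borel_measurable borel" by measurable
      show ?thesis
        by (simp only: gauss_smoothing_density[OF M s g'] gauss_smoothing_density[OF N s g'] kernel)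
    qed
    then show ?thesis
      using LIMSEQ_unique gauss_smoothing_limit[OF M g] gauss_smoothing_limit[OF N g] by simp
  qed
  have closed: "emeasure M C = emeasure N C" if C: "closed C" for C
  proof (cases "C = {}")
    case False
    \<comment> \<open>Continuous cutoffs decreasing to the indicator of \<open>C\<close>; closedness
      makes the distance to \<open>C\<close> positive outside of it.\<close>
    define g where "g n x = max 0 (1 - real n * infdist x C)" for n x
    have g: "continuous_on UNIV (g n)" "0 \<le> g n x" "g n x \<le> 1" for n x
      unfolding g_def by (auto intro!: continuous_intros simp: infdist_nonneg)
    have [measurable]: "g n \<in> borel_measurable borel" for n
      using g(1) by (rule borel_measurable_continuous_onI)
    have lim: "(\<lambda>n. ennreal (g n x)) \<longlonglongrightarrow> indicator C x" for x
    proof (cases "x \<in> C")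
      case True
      then have "g n x = 1" for n by (simp add: g_def)
      with True show ?thesis by simp
    next
      case x: False
      then have pos: "infdist x C > 0"
        using C False in_closed_iff_infdist_zero infdist_nonneg[of x C] by (metis less_le)
      obtain n0 where n0: "1 / infdist x C < real n0" using reals_Archimedean2 by blast
      have "g n x = 0" if "n \<ge> n0" for n
      proof -
        have "1 / infdist x C \<le> real n" using n0 that by linarith
        then show ?thesis using pos by (simp add: g_def field_simps)
      qed
      then have "eventually (\<lambda>n. ennreal (g n x) = 0) sequentially"
        unfolding eventually_sequentially by (intro exI[of _ n0]) auto
      then have "(\<lambda>n. ennreal (g n x)) \<longlonglongrightarrow> 0" by (rule tendsto_eventually)
      then show ?thesis using x by simp
    qed
    have [measurable]: "C \<in> sets borel" using C by simp
    have "(\<lambda>n. \<integral>\<^sup>+x. ennreal (g n x) \<partial>P) \<longlonglongrightarrow> (\<integral>\<^sup>+x. indicator C x \<partial>P)"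
      if P: "prob_space P" "sets P = sets borel" for P
    proof -
      interpret prob_space P by fact
      note P(2)[measurable_cong]
      show ?thesis
        by (rule nn_integral_dominated_convergence[where w="\<lambda>_. 1"])
          (use g lim in \<open>auto simp: emeasure_space_1\<close>)
    qed
    from this[OF M] this[OF N] show ?thesis
      using cont[of "g _" 1] g LIMSEQ_unique by (simp add: M(2) N(2))
  qed simp
  show ?thesis
  proof (rule measure_eqI_generator_eq[where \<Omega>=UNIV and E="Collect closed" and A="\<lambda>_. UNIV"])
    show "Int_stable (Collect (closed :: 'a set \<Rightarrow> bool))"
      by (auto simp: Int_stable_def)
    show "sets M = sigma_sets UNIV (Collect closed)" "sets N = sigma_sets UNIV (Collect closed)"
      using M(2) N(2) by (simp_all add: borel_eq_closed)
  qed (use closed M.emeasure_space_1 in auto)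
qed

subsection \<open>The Gaussian laws\<close>

lemma std_gaussian_eq_gauss: "(std_gaussian :: (real^'n) measure) = gauss"
  by (simp add: std_gaussian_def gauss_def prod_std_normal_density)

text \<open>The density exp(-|z|^2) / pi^k gives each of the 2k real coordinates the variance 1/2,
  hence the factor 1 / sqrt 2. Its Jacobian 2^(-k) accounts for the different constants (2 pi)^k and
  pi^k.\<close>

lemma std_cgaussian_eq_distr:
  "(std_cgaussian :: (complex^'k) measure) = distr gauss borel (\<lambda>z. (1 / sqrt 2) *\<^sub>R z)"
proof (rule measure_eqI)
  fix A :: "(complex^'k) set" assume "A \<in> sets std_cgaussian"
  then have [measurable]: "A \<in> sets borel" by (simp add: std_cgaussian_def)
  define w where "w z = exp (- (norm z)\<^sup>2) / pi ^ CARD('k)" for z :: "complex^'k"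
  have [measurable]: "w \<in> borel_measurable borel" unfolding w_def by measurable
  have D: "DIM(complex^'k) = 2 * CARD('k)" by simp
  have kw: "exp (- (norm z)\<^sup>2 / 2) / sqrt (2 * pi) ^ (2 * CARD('k)) =
      \<bar>1 / sqrt 2\<bar> ^ (2 * CARD('k)) * w (0 + (1 / sqrt 2) *\<^sub>R z)" for z
    by (simp add: w_def power_mult power_divide power_mult_distrib)
  have w0: "w z \<ge> 0" for z by (simp add: w_def)
  have "emeasure std_cgaussian A = (\<integral>\<^sup>+z. ennreal (w z) * indicator A z \<partial>lborel)"
    unfolding std_cgaussian_def w_def by (subst emeasure_density) auto
  also have "\<dots> = (\<integral>\<^sup>+z. ennreal (\<bar>1 / sqrt 2\<bar> ^ (2 * CARD('k))) *
      (ennreal (w (0 + (1 / sqrt 2) *\<^sub>R z)) * indicator A (0 + (1 / sqrt 2) *\<^sub>R z)) \<partial>lborel)"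
    by (subst lborel_affine[of "1 / sqrt 2" 0]) (simp_all add: nn_integral_density nn_integral_distr D mult.commute)
  also have "\<dots> = (\<integral>\<^sup>+z. ennreal (exp (- (norm z)\<^sup>2 / 2) / sqrt (2 * pi) ^ (2 * CARD('k))) *
      indicator A ((1 / sqrt 2) *\<^sub>R z) \<partial>lborel)"
    unfolding kw by (subst ennreal_mult) (use w0 in \<open>auto simp: mult.assoc\<close>)
  also have "\<dots> = (\<integral>\<^sup>+z. indicator A ((1 / sqrt 2) *\<^sub>R z) \<partial>gauss)"
    by (simp add: gauss_def nn_integral_density prod_std_normal_density D mult.commute[of 2])
  also have "\<dots> = (\<integral>\<^sup>+z. indicator A z \<partial>distr gauss borel (\<lambda>z. (1 / sqrt 2) *\<^sub>R z))"
    by (subst nn_integral_distr) auto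
  also have "\<dots> = emeasure (distr gauss borel (\<lambda>z. (1 / sqrt 2) *\<^sub>R z)) A"
    by simp
  finally show "emeasure std_cgaussian A = emeasure (distr gauss borel (\<lambda>z. (1 / sqrt 2) *\<^sub>R z)) A" .
qed (simp add: std_cgaussian_def)

lemma sets_std_cgaussian [simp, measurable_cong]: "sets std_cgaussian = sets borel"
  and space_std_cgaussian [simp]: "space std_cgaussian = UNIV"
  by (simp_all add: std_cgaussian_def)

lemma prob_space_std_cgaussian: "prob_space (std_cgaussian :: (complex^'k) measure)"
  unfolding std_cgaussian_eq_distr by (rule gauss.prob_space_distr) measurable

interpretation std_cgaussian: prob_space "std_cgaussian :: (complex^'k) measure"
  by (rule prob_space_std_cgaussian)

lemma echar_distr:
  assumes [measurable]: "f \<in> measurable M borel"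
  shows "echar (distr M borel f) t = (\<integral>x. cis (t \<bullet> f x) \<partial>M)"
  unfolding echar_def by (subst integral_distr) auto

lemma echar_std_cgaussian: "echar std_cgaussian t = complex_of_real (exp (- (norm t)\<^sup>2 / 4))"
proof -
  have "echar std_cgaussian t = echar gauss ((1 / sqrt 2) *\<^sub>R t)"
    unfolding std_cgaussian_eq_distr by (subst echar_distr) (auto simp: echar_def)
  then show ?thesis
    by (simp add: echar_gauss power_divide)
qed

lemma AE_std_cgaussian:
  assumes "AE z in lborel. P z"
  shows "AE z in (std_cgaussian :: (complex^'k) measure). P z"
  unfolding std_cgaussian_def by (subst AE_density) (use assms in auto)

text \<open>The Gaussian density vanishes nowhere, so both measures have the same null sets.
  Essential suprema and the condition that b is nonzero refer to Lebesgue measure, while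
  \<open>gauss_norm\<close> refers to the Gaussian one.\<close>

lemma AE_lborel_of_std_cgaussian:
  assumes "AE z in (std_cgaussian :: (complex^'k) measure). P z"
  shows "AE z in lborel. P z"
proof -
  have "AE z in lborel. 0 < ennreal (exp (- (norm (z :: complex^'k))\<^sup>2) / pi ^ CARD('k)) \<longrightarrow> P z"
    using assms unfolding std_cgaussian_def by (subst (asm) AE_density) auto
  then show ?thesis by (simp add: ennreal_zero_less_divide)
qed

lemma measurable_matrix_vector_mult [measurable]: "(*v) A \<in> borel_measurable borel"
  for A :: "real^'n^'m"
  by (intro borel_measurable_continuous_onI linear_continuous_on matrix_vector_mul_bounded_linear)

lemma prob_space_gaussian_law: "prob_space (gaussian_law \<Sigma>)"
  and sets_gaussian_law [simp, measurable_cong]: "sets (gaussian_law \<Sigma>) = sets borel"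
  and space_gaussian_law [simp]: "space (gaussian_law \<Sigma>) = UNIV"
  unfolding gaussian_law_def std_gaussian_eq_gauss
  by (auto intro!: gauss.prob_space_distr)

text \<open>Any square root \<open>A\<close> of \<Sigma> guarantees that the choice made inside
  \<open>gaussian_law\<close> is a square root too, and |B^T s|^2 = s . \<Sigma> s depends on
  \<Sigma> alone. The vector \<open>s\<close> is the image of \<open>t\<close> under the adjoint of
  \<open>L\<close>.\<close>

lemma echar_gaussian_law:
  fixes A \<Sigma> :: "real^'n^'n" and L :: "real^'n \<Rightarrow> 'a::euclidean_space"
  assumes A: "A ** transpose A = (\<Sigma> :: real^'n^'n)" and L: "L \<in> borel_measurable borel"
    and s: "\<And>x. t \<bullet> L x = s \<bullet> x"
  shows "echar (distr (gaussian_law \<Sigma>) borel L) t = complex_of_real (exp (- (s \<bullet> (\<Sigma> *v s)) / 2))"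
proof -
  note L[measurable]
  define B where "B = (SOME A :: real^'n^'n. A ** transpose A = \<Sigma>)"
  have B: "B ** transpose B = \<Sigma>"
    unfolding B_def by (rule someI[where P="\<lambda>A. A ** transpose A = \<Sigma>", OF A])
  have "echar (distr (gaussian_law \<Sigma>) borel L) t = (\<integral>x. cis (s \<bullet> x) \<partial>gaussian_law \<Sigma>)"
    by (subst echar_distr) (auto simp: s)
  also have "\<dots> = (\<integral>x. cis (s \<bullet> (B *v x)) \<partial>gauss)"
    unfolding gaussian_law_def std_gaussian_eq_gauss B_def [symmetric]
    by (subst integral_distr) auto
  also have "\<dots> = echar gauss (transpose B *v s)"
    by (simp add: echar_def dot_lmul_matrix)
  also have "\<dots> = complex_of_real (exp (- ((norm (transpose B *v s))\<^sup>2) / 2))"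
    by (simp add: echar_gauss)
  also have "(norm (transpose B *v s))\<^sup>2 = s \<bullet> (\<Sigma> *v s)"
    unfolding power2_norm_eq_inner B [symmetric]
    by (simp add: dot_lmul_matrix matrix_vector_mul_assoc [symmetric])
  finally show ?thesis .
qed

section \<open>Vectors in two halves and the quadratic forms of the correlation matrices\<close>

definition pair_vec :: "'a^'n \<Rightarrow> 'a^'n \<Rightarrow> 'a^('n::finite + 'n)" where
  "pair_vec x y = (\<chi> i. case i of Inl a \<Rightarrow> x $ a | Inr a \<Rightarrow> y $ a)"

lemma pair_vec_nth [simp]: "pair_vec x y $ Inl a = x $ a" "pair_vec x y $ Inr a = y $ a"
  by (simp_all add: pair_vec_def)

lemma vec_sum_eqI: "(\<And>a. x $ Inl a = y $ Inl a) \<Longrightarrow> (\<And>b. x $ Inr b = y $ Inr b) \<Longrightarrow> x = y"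
  for x y :: "'a^('m::finite + 'n::finite)"
  by (subst vec_eq_iff, rule allI, rename_tac i, case_tac i) simp_all

lemma block_matrix_nth [simp]:
  "block_matrix P Q R S $ Inl a $ Inl b = P $ a $ b"
  "block_matrix P Q R S $ Inl a $ Inr b = Q $ a $ b"
  "block_matrix P Q R S $ Inr a $ Inl b = R $ a $ b"
  "block_matrix P Q R S $ Inr a $ Inr b = S $ a $ b"
  by (simp_all add: block_matrix_def)

lemma map_matrix_nth [simp]: "map_matrix f A $ i $ j = f (A $ i $ j)"
  by (simp add: map_matrix_def)

lemma half_nth [simp]: "left_half x $ a = x $ Inl a" "right_half x $ a = x $ Inr a"
  by (simp_all add: left_half_def right_half_def)

lemma half_pair_vec [simp]: "left_half (pair_vec x y) = x" "right_half (pair_vec x y) = y"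
  by (simp_all add: vec_eq_iff left_half_def right_half_def)

lemma pair_vec_halves [simp]: "pair_vec (left_half x) (right_half x) = x"
  by (rule vec_sum_eqI) simp_all

lemma inner_pair_vec: "t \<bullet> pair_vec x y = left_half t \<bullet> x + right_half t \<bullet> y"
  for x y :: "'a::real_inner^'n"
  by (simp add: inner_vec_def sum_UNIV_Plus)

lemma measurable_halves [measurable]:
  "left_half \<in> borel_measurable (borel :: ('a::euclidean_space^('n::finite + 'n)) measure)"
  "right_half \<in> borel_measurable (borel :: ('a::euclidean_space^('n::finite + 'n)) measure)"
  unfolding left_half_def [abs_def] right_half_def [abs_def]
  by (auto intro!: borel_measurable_continuous_onI continuous_intros)

lemma pair_vec_eq_sum: "pair_vec x y = pair_vec x 0 + pair_vec 0 y" for x y :: "'a::monoid_add^'n"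
  by (rule vec_sum_eqI) simp_all

lemma measurable_pair_vec [measurable (raw)]:
  fixes f g :: "'x \<Rightarrow> 'a::euclidean_space^'n"
  assumes [measurable]: "f \<in> borel_measurable M" "g \<in> borel_measurable M"
  shows "(\<lambda>x. pair_vec (f x) (g x)) \<in> borel_measurable M"
proof -
  have "linear (\<lambda>x :: 'a^'n. pair_vec x 0)" "linear (\<lambda>x :: 'a^'n. pair_vec 0 x)"
    by (auto intro!: linearI vec_sum_eqI)
  then have "(\<lambda>x :: 'a^'n. pair_vec x 0) \<in> borel_measurable borel"
      "(\<lambda>x :: 'a^'n. pair_vec 0 x) \<in> borel_measurable borel"
    by (auto intro!: borel_measurable_continuous_onI linear_continuous_on simp: linear_conv_bounded_linear)
  from measurable_compose[OF assms(1) this(1)] measurable_compose[OF assms(2) this(2)]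
  have "(\<lambda>x. pair_vec (f x) 0 + pair_vec 0 (g x)) \<in> borel_measurable M"
    by (rule borel_measurable_add)
  then show ?thesis by (simp flip: pair_vec_eq_sum)
qed

lemma measurable_to_complex [measurable]: "to_complex \<in> borel_measurable borel"
proof -
  have "linear (to_complex :: real^('n + 'n) \<Rightarrow> complex^'n)"
    by (rule linearI) (simp_all add: vec_eq_iff to_complex_def complex_eq_iff Re_divide_of_real
        Im_divide_of_real add_divide_distrib)
  then show ?thesis
    by (auto intro!: borel_measurable_continuous_onI linear_continuous_on simp: linear_conv_bounded_linear)
qed

lemma inner_vector_scalar_mult: "t \<bullet> (a *s z) = (cnj a *s t) \<bullet> z" for t z :: "complex^'k"
  unfolding inner_vec_def
  by (intro sum.cong refl) (simp add: inner_complex_def algebra_simps)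

definition corr_matrix :: "complex \<Rightarrow> complex^('k::finite + 'k)^('k::finite + 'k)" where
  "corr_matrix \<zeta> = block_matrix (mat 1) (mat \<zeta>)
     (mat (cnj \<zeta>)) (mat 1)"

definition corr_form :: "complex \<Rightarrow> complex^('k::finite + 'k) \<Rightarrow> real" where
  "corr_form \<zeta> t = (norm (left_half t))\<^sup>2 + (norm (right_half t))\<^sup>2 +
     2 * (left_half t \<bullet> (\<zeta> *s right_half t))"

lemma mat_vector_mult_nth: "(\<Sum>j\<in>UNIV. mat c $ i $ j * x j) = c * x i"
  for c :: "'a::semiring_1"
  by (simp add: mat_def if_distrib if_distribR sum.delta cong: if_cong)

lemma mat_mult_vec: "mat c *v x = c *s x"
  by (simp add: vec_eq_iff matrix_vector_mult_def mat_vector_mult_nth)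

lemma block_matrix_mult_pair_vec:
  "block_matrix P Q R S *v pair_vec x y = pair_vec (P *v x + Q *v y) (R *v x + S *v y)"
  by (rule vec_sum_eqI) (simp_all add: matrix_vector_mult_def sum_UNIV_Plus)

lemma corr_matrix_form: "t \<bullet> (corr_matrix \<zeta> *v t) = corr_form \<zeta> t" for t :: "complex^('k::finite + 'k)"
proof -
  have "corr_matrix \<zeta> *v t = pair_vec (left_half t + \<zeta> *s right_half t) (cnj \<zeta> *s left_half t + right_half t)"
    by (subst pair_vec_halves [symmetric])
      (simp only: corr_matrix_def block_matrix_mult_pair_vec mat_mult_vec vector_smult_lid)
  then show ?thesis
    by (simp add: inner_pair_vec corr_form_def inner_add_right power2_norm_eq_inner
        inner_vector_scalar_mult[of "right_half t"] inner_commute)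
qed

abbreviation realify :: "complex^'n^'n \<Rightarrow> real^('n::finite + 'n)^('n + 'n)" where
  "realify \<Gamma> \<equiv> block_matrix (map_matrix Re \<Gamma>) (- map_matrix Im \<Gamma>) (map_matrix Im \<Gamma>) (map_matrix Re \<Gamma>)"

text \<open>The factor 1 / sqrt 2 in \<open>s\<close> is the adjoint of the one in
  \<open>to_complex\<close>. Together with the 1/2 in the exponent of the real Gaussian
  characteristic function, the resulting 1/2 produces the exponent -(t . \<Gamma> t) / 4 of the
  complex law.\<close>

lemma realify_form:
  fixes \<Gamma> :: "complex^'n^'n" and t :: "complex^'n"
  defines "s \<equiv> (\<chi> i. case i of Inl a \<Rightarrow> Re (t $ a) / sqrt 2 | Inr a \<Rightarrow> Im (t $ a) / sqrt 2)"
  shows "s \<bullet> (realify \<Gamma> *v s)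
      = (t \<bullet> (\<Gamma> *v t)) / 2"
proof -
  have "realify \<Gamma> *v s =
      (\<chi> i. case i of Inl a \<Rightarrow> Re ((\<Gamma> *v t) $ a) / sqrt 2 | Inr a \<Rightarrow> Im ((\<Gamma> *v t) $ a) / sqrt 2)"
    by (rule vec_sum_eqI)
      (simp_all add: matrix_vector_mult_def sum_UNIV_Plus s_def sum_divide_distrib sum_subtractf
        sum.distrib sum_negf diff_divide_distrib add_divide_distrib)
  then show ?thesis
    by (simp add: s_def inner_vec_def sum_UNIV_Plus inner_complex_def sum_divide_distrib sum.distrib add_divide_distrib)
qed

lemma to_complex_inner:
  "t \<bullet> to_complex w = (\<chi> i. case i of Inl a \<Rightarrow> Re (t $ a) / sqrt 2 | Inr a \<Rightarrow> Im (t $ a) / sqrt 2) \<bullet> w"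
  by (simp add: inner_vec_def sum_UNIV_Plus to_complex_def inner_complex_def Re_divide_of_real
      Im_divide_of_real sum.distrib)

abbreviation corr_matrix_real :: "real \<Rightarrow> real^('n::finite + 'n)^('n + 'n)" where
  "corr_matrix_real \<rho> \<equiv> block_matrix (mat 1) (mat \<rho>) (mat \<rho>) (mat 1)"

text \<open>The witness is the Cholesky factor, with block rows (1, 0) and (\<rho>, sqrt (1 -
  \<rho>^2)); it also covers the degenerate cases |\<rho>| = 1.\<close>

lemma ex_sqrt_corr_real:
  fixes \<rho> :: real
  assumes "\<bar>\<rho>\<bar> \<le> 1"
  shows "\<exists>A :: real^('n::finite + 'n)^('n::finite + 'n). A ** transpose A = corr_matrix_real \<rho>"
proof -
  have "1 - \<rho>\<^sup>2 \<ge> 0" using assms by (simp add: abs_square_le_1)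
  then have s: "sqrt (1 - \<rho>\<^sup>2) * sqrt (1 - \<rho>\<^sup>2) = 1 - \<rho>\<^sup>2" by simp
  show ?thesis
    by (rule exI[of _ "block_matrix (mat 1) (mat 0)
        (mat \<rho>) (mat (sqrt (1 - \<rho>\<^sup>2)))"])
      (intro vec_sum_eqI; use s in \<open>simp add: matrix_matrix_mult_def transpose_def sum_UNIV_Plus
        mat_vector_mult_nth\<close>; simp add: mat_def power2_eq_square)
qed

text \<open>\<open>M\<close> is the complex Cholesky factor, with block rows (1, 0) and (cnj
  \<zeta>, sqrt (1 - |\<zeta>|^2)). Passing to real blocks turns products into products and adjoints
  into transposes, so \<open>realify M\<close> is a square root of the realified matrix.\<close>

lemma ex_sqrt_corr_complex:
  assumes "cmod \<zeta> \<le> 1"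
  shows "\<exists>A :: real^(('k::finite + 'k) + ('k + 'k))^(('k::finite + 'k) + ('k + 'k)). A ** transpose A = realify (corr_matrix \<zeta>)"
proof -
  define M :: "complex^('k::finite + 'k)^('k::finite + 'k)" where
    "M = block_matrix (mat 1) (mat 0)
       (mat (cnj \<zeta>)) (mat (of_real (sqrt (1 - (cmod \<zeta>)\<^sup>2))))"
  have "1 - (cmod \<zeta>)\<^sup>2 \<ge> 0" using assms by (simp add: abs_square_le_1)
  then have s: "sqrt (1 - (cmod \<zeta>)\<^sup>2) * sqrt (1 - (cmod \<zeta>)\<^sup>2) = 1 - (cmod \<zeta>)\<^sup>2" by simp
  have c: "cmod \<zeta> * cmod \<zeta> = Re \<zeta> * Re \<zeta> + Im \<zeta> * Im \<zeta>"
    using cmod_power2[of \<zeta>] by (simp add: power2_eq_square)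
  have R: "Re (mat c $ i $ j) = mat (Re c) $ i $ j"
    "Im (mat c $ i $ j) = mat (Im c) $ i $ j"
    for c and i j :: 'k
    by (simp_all add: mat_def)
  show ?thesis
    by (rule exI[of _ "realify M"])
      (intro vec_sum_eqI; rename_tac a b; case_tac a; case_tac b;
        use s in \<open>simp add: matrix_matrix_mult_def transpose_def sum_UNIV_Plus
        M_def corr_matrix_def R sum_negf mat_vector_mult_nth\<close>;
        simp add: mat_def power2_eq_square c)
qed

lemma prob_space_cgaussian_law: "prob_space (cgaussian_law \<Gamma>)"
  and sets_cgaussian_law [simp, measurable_cong]: "sets (cgaussian_law \<Gamma>) = sets borel"
  and space_cgaussian_law [simp]: "space (cgaussian_law \<Gamma>) = UNIV"
  unfolding cgaussian_law_def
  by (auto intro!: prob_space.prob_space_distr prob_space_gaussian_law)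

lemma echar_cgaussian_law:
  fixes t :: "complex^('k::finite + 'k)"
  assumes "cmod \<zeta> \<le> 1"
  shows "echar (cgaussian_law (corr_matrix \<zeta>)) t = complex_of_real (exp (- corr_form \<zeta> t / 4))"
proof -
  obtain A :: "real^(('k::finite + 'k) + ('k + 'k))^(('k::finite + 'k) + ('k + 'k))" where "A ** transpose A = realify (corr_matrix \<zeta>)"
    using ex_sqrt_corr_complex[OF assms] by blast
  from echar_gaussian_law[OF this measurable_to_complex to_complex_inner, of t]
  show ?thesis
    unfolding cgaussian_law_def realify_form corr_matrix_form by simp
qed

lemma cgaussian_law_eqI:
  fixes M :: "(complex^('k::finite + 'k)) measure"
  assumes "prob_space M" "sets M = sets borel" "cmod \<zeta> \<le> 1"
    and "\<And>t. echar M t = complex_of_real (exp (- corr_form \<zeta> t / 4))"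
  shows "M = cgaussian_law (corr_matrix \<zeta>)"
  using assms by (intro echar_unique) (auto simp: prob_space_cgaussian_law echar_cgaussian_law)

text \<open>This connects the two definitions: the left law defines \<open>h_complex\<close> at a
  real argument, the right one \<open>h_real\<close> for functions on R^(2k). The two order the 4k
  real coordinates differently, so they are compared through characteristic functions.\<close>

lemma cgaussian_law_of_real:
  assumes "\<bar>\<rho>\<bar> \<le> 1"
  shows "cgaussian_law (corr_matrix (of_real \<rho>)) =
    distr (gaussian_law (corr_matrix_real \<rho>))
      borel (\<lambda>x. pair_vec (to_complex (left_half x)) (to_complex (right_half x)) :: complex^('k::finite + 'k))"
    (is "_ = distr ?G borel ?L")
proof (rule cgaussian_law_eqI [symmetric])
  show "prob_space (distr ?G borel ?L)"
    by (intro prob_space.prob_space_distr prob_space_gaussian_law) measurable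
  show "cmod (of_real \<rho>) \<le> 1" using assms by simp
  fix t :: "complex^('k::finite + 'k)"
  define r where "r t = (\<chi> i. case i of Inl a \<Rightarrow> Re (t $ a) / sqrt 2 | Inr a \<Rightarrow> Im (t $ a) / sqrt 2)"
    for t :: "complex^'k"
  define s where "s = pair_vec (r (left_half t)) (r (right_half t))"
  obtain A :: "real^(('k::finite + 'k) + ('k + 'k))^(('k::finite + 'k) + ('k + 'k))" where A: "A ** transpose A = corr_matrix_real \<rho>"
    using ex_sqrt_corr_real[OF assms] by blast
  have inner: "t \<bullet> ?L x = s \<bullet> x" for x
  proof -
    have "t \<bullet> ?L x = r (left_half t) \<bullet> left_half x + r (right_half t) \<bullet> right_half x"
      by (simp add: inner_pair_vec to_complex_inner r_def)
    also have "\<dots> = x \<bullet> s"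
      by (simp add: s_def inner_pair_vec inner_commute)
    finally show ?thesis by (simp add: inner_commute)
  qed
  have rr: "r a \<bullet> r b = (a \<bullet> b) / 2" for a b
    by (simp add: r_def inner_vec_def sum_UNIV_Plus inner_complex_def sum.distrib sum_divide_distrib add_divide_distrib)
  have "corr_matrix_real \<rho> *v s =
      pair_vec (r (left_half t) + \<rho> *s r (right_half t)) (\<rho> *s r (left_half t) + r (right_half t))"
    by (simp add: s_def block_matrix_mult_pair_vec mat_mult_vec)
  moreover have "complex_of_real \<rho> *s a = \<rho> *\<^sub>R a" for a :: "complex^'k"
    by (simp add: vec_eq_iff) (simp add: scaleR_conv_of_real)
  moreover have "\<rho> *s a = \<rho> *\<^sub>R a" for a :: "real^('k::finite + 'k)"
    by (simp add: vec_eq_iff)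
  ultimately have "s \<bullet> (corr_matrix_real \<rho> *v s) = corr_form (of_real \<rho>) t / 2"
    by (simp add: inner_pair_vec corr_form_def) (simp add: s_def inner_add_right rr power2_norm_eq_inner inner_commute)
  with echar_gaussian_law[OF A _ inner]
  show "echar (distr ?G borel ?L) t = complex_of_real (exp (- corr_form (of_real \<rho>) t / 4))"
    by simp
qed simp

subsection \<open>Gaussian processes indexed by vectors\<close>

definition gproc :: "'i set \<Rightarrow> ('i \<Rightarrow> complex^'k) measure" where
  "gproc I = (\<Pi>\<^sub>M i\<in>I. std_cgaussian)"

text \<open>The vector Z_u of the overview. Since all of them live on one probability space,
  finitely many correlation values can be put under a single integral, which the separate laws in
  \<open>h_complex\<close> do not allow.\<close>

definition gcomb :: "'i set \<Rightarrow> ('i \<Rightarrow> complex) \<Rightarrow> ('i \<Rightarrow> complex^'k) \<Rightarrow> complex^'k" where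
  "gcomb I u \<omega> = (\<Sum>l\<in>I. u l *s \<omega> l)"

lemma prob_space_gproc: "prob_space (gproc I)"
  unfolding gproc_def by (intro prob_space_PiM prob_space_std_cgaussian)

lemma measurable_vector_scalar_mult [measurable]:
  "(*s) a \<in> borel_measurable (borel :: (complex^'k) measure)"
proof -
  have "linear ((*s) a :: complex^'k \<Rightarrow> complex^'k)"
    by (rule linearI) (simp_all add: vec_eq_iff algebra_simps)
  then show ?thesis
    by (auto intro!: borel_measurable_continuous_onI linear_continuous_on simp: linear_conv_bounded_linear)
qed

lemma measurable_gcomb [measurable]: "gcomb I u \<in> borel_measurable (gproc I)"
  unfolding gcomb_def [abs_def] gproc_def
proof (rule borel_measurable_sum)
  fix l assume l: "l \<in> I"
  have "(\<lambda>\<omega>. \<omega> l) \<in> measurable (\<Pi>\<^sub>M i\<in>I. std_cgaussian) (std_cgaussian :: (complex^'k) measure)"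
    using l by (rule measurable_component_singleton)
  then have "(\<lambda>\<omega>. \<omega> l) \<in> borel_measurable (\<Pi>\<^sub>M i\<in>I. std_cgaussian :: (complex^'k) measure)"
    by (simp cong: measurable_cong_sets)
  from measurable_compose[OF this measurable_vector_scalar_mult]
  show "(\<lambda>\<omega>. u l *s \<omega> l) \<in> borel_measurable (\<Pi>\<^sub>M i\<in>I. std_cgaussian :: (complex^'k) measure)" .
qed

lemma char_gproc:
  fixes s :: "'i \<Rightarrow> complex^'k"
  assumes "finite I"
  shows "(\<integral>\<omega>. cis (\<Sum>l\<in>I. s l \<bullet> \<omega> l) \<partial>gproc I) = complex_of_real (exp (- (\<Sum>l\<in>I. (norm (s l))\<^sup>2) / 4))"
proof -
  interpret product_sigma_finite "\<lambda>_::'i. std_cgaussian :: (complex^'k) measure"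
    by unfold_locales
  have "(\<integral>\<omega>. cis (\<Sum>l\<in>I. s l \<bullet> \<omega> l) \<partial>gproc I) = (\<integral>\<omega>. (\<Prod>l\<in>I. cis (s l \<bullet> \<omega> l)) \<partial>gproc I)"
    using assms by (simp add: cis_sum)
  also have "\<dots> = (\<Prod>l\<in>I. echar std_cgaussian (s l))"
    unfolding gproc_def echar_def using assms
    by (rule product_integral_prod) (auto intro!: integrable_cis_inner prob_space_std_cgaussian)
  also have "\<dots> = complex_of_real (exp (- (\<Sum>l\<in>I. (norm (s l))\<^sup>2) / 4))"
    using assms by (simp add: echar_std_cgaussian exp_sum [symmetric] sum_negf sum_divide_distrib flip: of_real_prod)
  finally show ?thesis .
qed

lemma sum_vector_scalar_mult: "(\<Sum>l\<in>I. f l) *s x = (\<Sum>l\<in>I. f l *s x)" for x :: "complex^'k"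
  by (simp add: vec_eq_iff sum_distrib_right)

lemma of_real_vector_scalar_mult: "complex_of_real c *s x = c *\<^sub>R x"
  by (simp add: vec_eq_iff) (simp add: scaleR_conv_of_real)

lemma inner_scaled_scaled:
  "((cnj a *s x) \<bullet> (cnj b *s y)) = x \<bullet> ((a * cnj b) *s y)" for x y :: "complex^'k"
  using inner_vector_scalar_mult[of x a "cnj b *s y"] by (simp add: vector_smult_assoc)

lemma norm_vector_scalar_mult: "(norm (a *s x))\<^sup>2 = (cmod a)\<^sup>2 * (norm x)\<^sup>2" for x :: "complex^'k"
proof -
  have "(norm (a *s x))\<^sup>2 = x \<bullet> ((cnj a * a) *s x)"
    using inner_scaled_scaled[of "cnj a" x "cnj a" x] by (simp add: power2_norm_eq_inner)
  also have "cnj a * a = complex_of_real ((cmod a)\<^sup>2)"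
    by (simp only: complex_norm_square mult.commute)
  finally show ?thesis
    by (simp add: of_real_vector_scalar_mult power2_norm_eq_inner)
qed

lemma cmod_sum_cnj_le:
  assumes "(\<Sum>l\<in>I. (cmod (u l))\<^sup>2) \<le> 1" "(\<Sum>l\<in>I. (cmod (v l))\<^sup>2) \<le> 1"
  shows "cmod (\<Sum>l\<in>I. u l * cnj (v l)) \<le> 1"
proof -
  have "cmod (\<Sum>l\<in>I. u l * cnj (v l)) \<le> (\<Sum>l\<in>I. \<bar>cmod (u l)\<bar> * \<bar>cmod (v l)\<bar>)"
    by (rule order.trans[OF norm_sum]) (simp add: norm_mult)
  also have "\<dots> \<le> L2_set (\<lambda>l. cmod (u l)) I * L2_set (\<lambda>l. cmod (v l)) I"
    by (rule L2_set_mult_ineq)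
  also have "\<dots> \<le> 1 * 1"
    by (intro mult_mono) (use assms in \<open>auto simp: L2_set_def intro!: sum_nonneg\<close>)
  finally show ?thesis by simp
qed

text \<open>The inner product with a test vector (t1, t2) is a sum over l of inner products with
  independent coordinates. Expanding |cnj (u l) t1 + cnj (v l) t2|^2 and summing leaves the unit
  lengths on the diagonal and <u, v> in the cross term.\<close>

lemma gcomb_pair_law:
  fixes I :: "'i set"
  assumes "finite I" and u: "(\<Sum>l\<in>I. (cmod (u l))\<^sup>2) = 1" and v: "(\<Sum>l\<in>I. (cmod (v l))\<^sup>2) = 1"
  shows "distr (gproc I) borel (\<lambda>\<omega>. pair_vec (gcomb I u \<omega>) (gcomb I v \<omega>) :: complex^('k::finite + 'k)) =
    cgaussian_law (corr_matrix (\<Sum>l\<in>I. u l * cnj (v l)))"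
proof (rule cgaussian_law_eqI)
  interpret prob_space "gproc I :: ('i \<Rightarrow> complex^'k) measure" by (rule prob_space_gproc)
  show "prob_space (distr (gproc I) borel (\<lambda>\<omega>. pair_vec (gcomb I u \<omega>) (gcomb I v \<omega>) :: complex^('k::finite + 'k)))"
    by (rule prob_space_distr) measurable
  show "cmod (\<Sum>l\<in>I. u l * cnj (v l)) \<le> 1"
    using u v by (intro cmod_sum_cnj_le) auto
  fix t :: "complex^('k::finite + 'k)"
  define s where "s l = cnj (u l) *s left_half t + cnj (v l) *s right_half t" for l
  have "t \<bullet> pair_vec (gcomb I u \<omega>) (gcomb I v \<omega>) = (\<Sum>l\<in>I. s l \<bullet> \<omega> l)" for \<omega>
    by (simp add: inner_pair_vec gcomb_def inner_sum_right inner_vector_scalar_mult s_def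
        inner_add_left sum.distrib)
  then have "echar (distr (gproc I) borel (\<lambda>\<omega>. pair_vec (gcomb I u \<omega>) (gcomb I v \<omega>))) t =
      complex_of_real (exp (- (\<Sum>l\<in>I. (norm (s l))\<^sup>2) / 4))"
    by (simp add: echar_distr char_gproc[OF \<open>finite I\<close>])
  also have "(\<Sum>l\<in>I. (norm (s l))\<^sup>2) = (\<Sum>l\<in>I. (cmod (u l))\<^sup>2 * (norm (left_half t))\<^sup>2 +
      (cmod (v l))\<^sup>2 * (norm (right_half t))\<^sup>2 + 2 * (left_half t \<bullet> ((u l * cnj (v l)) *s right_half t)))"
  proof (intro sum.cong refl)
    fix l
    show "(norm (s l))\<^sup>2 = (cmod (u l))\<^sup>2 * (norm (left_half t))\<^sup>2 +
      (cmod (v l))\<^sup>2 * (norm (right_half t))\<^sup>2 + 2 * (left_half t \<bullet> ((u l * cnj (v l)) *s right_half t))"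
      using dot_norm[of "cnj (u l) *s left_half t" "cnj (v l) *s right_half t"]
      by (simp add: s_def norm_vector_scalar_mult inner_scaled_scaled)
  qed
  also have "\<dots> = corr_form (\<Sum>l\<in>I. u l * cnj (v l)) t"
    by (simp add: corr_form_def sum.distrib sum_distrib_left [symmetric] sum_distrib_right [symmetric] u v
        sum_vector_scalar_mult inner_sum_right)
  finally show "echar (distr (gproc I) borel (\<lambda>\<omega>. pair_vec (gcomb I u \<omega>) (gcomb I v \<omega>))) t =
      complex_of_real (exp (- corr_form (\<Sum>l\<in>I. u l * cnj (v l)) t / 4))" .
qed simp

lemma gcomb_law:
  fixes I :: "'i set"
  assumes "finite I" and u: "(\<Sum>l\<in>I. (cmod (u l))\<^sup>2) = 1"
  shows "distr (gproc I) borel (gcomb I u) = (std_cgaussian :: (complex^'k) measure)"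
proof (rule echar_unique)
  interpret prob_space "gproc I :: ('i \<Rightarrow> complex^'k) measure" by (rule prob_space_gproc)
  show "prob_space (distr (gproc I) borel (gcomb I u :: _ \<Rightarrow> complex^'k))"
    by (rule prob_space_distr) measurable
  fix t :: "complex^'k"
  have "t \<bullet> gcomb I u \<omega> = (\<Sum>l\<in>I. (cnj (u l) *s t) \<bullet> \<omega> l)" for \<omega>
    by (simp add: gcomb_def inner_sum_right inner_vector_scalar_mult)
  then show "echar (distr (gproc I) borel (gcomb I u)) t = echar std_cgaussian t"
    by (simp add: echar_distr char_gproc[OF \<open>finite I\<close>] echar_std_cgaussian norm_vector_scalar_mult
        sum_distrib_right [symmetric] u)
qed (simp_all add: prob_space_std_cgaussian)

lemma AE_gcomb:
  assumes "finite I" "(\<Sum>l\<in>I. (cmod (u l))\<^sup>2) = 1" "AE z in lborel. P (z :: complex^'k)"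
  shows "AE \<omega> in gproc I. P (gcomb I u \<omega>)"
proof (rule AE_distrD[OF measurable_gcomb])
  show "AE z in distr (gproc I) borel (gcomb I u). P z"
    unfolding gcomb_law[OF assms(1,2)] by (rule AE_std_cgaussian[OF assms(3)])
qed

lemma (in prob_space) integrable_mult_bounded:
  fixes X Y :: "'a \<Rightarrow> 'b::{real_normed_field, banach, second_countable_topology}"
  assumes [measurable]: "X \<in> borel_measurable M" "Y \<in> borel_measurable M"
    and X: "AE \<omega> in M. norm (X \<omega>) \<le> B" and Y: "AE \<omega> in M. norm (Y \<omega>) \<le> C"
  shows "integrable M (\<lambda>\<omega>. X \<omega> * Y \<omega>)"
proof (rule integrable_const_bound[where B="B * C"])
  show "AE \<omega> in M. norm (X \<omega> * Y \<omega>) \<le> B * C"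
    using X Y by eventually_elim (auto simp: norm_mult intro!: mult_mono')
qed measurable

section \<open>Values and symmetries of the correlation function\<close>

lemma h_complex_gcomb:
  fixes b c :: "complex^'k \<Rightarrow> complex"
  assumes b: "b \<in> borel_measurable borel" and c: "c \<in> borel_measurable borel"
    and "finite I" "(\<Sum>l\<in>I. (cmod (u l))\<^sup>2) = 1" "(\<Sum>l\<in>I. (cmod (v l))\<^sup>2) = 1"
  shows "h_complex b c (\<Sum>l\<in>I. u l * cnj (v l)) =
    (\<integral>\<omega>. b (gcomb I u \<omega>) * cnj (c (gcomb I v \<omega>)) \<partial>gproc I)"
proof -
  note b[measurable] c[measurable]
  show ?thesis
    unfolding h_complex_def corr_matrix_def [symmetric] gcomb_pair_law[OF assms(3-5), symmetric]
    by (subst integral_distr) auto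
qed

text \<open>Realises every \<zeta> of the closed disc by two unit vectors of C^2, so that single
  values of \<open>h_complex\<close> can be computed on \<open>gproc {0, 1}\<close>. The first
  coordinate of \<open>v\<close> is cnj \<zeta> because the inner product is antilinear in
  \<open>v\<close>.\<close>

lemma corr_vectors:
  assumes "cmod \<zeta> \<le> 1"
  obtains u v :: "nat \<Rightarrow> complex" where
    "(\<Sum>l\<in>{0, 1}. (cmod (u l))\<^sup>2) = 1" "(\<Sum>l\<in>{0, 1}. (cmod (v l))\<^sup>2) = 1"
    "(\<Sum>l\<in>{0, 1}. u l * cnj (v l)) = \<zeta>"
proof -
  have "1 - (cmod \<zeta>)\<^sup>2 \<ge> 0" using assms by (simp add: abs_square_le_1)
  then show ?thesis
    by (intro that[of "\<lambda>l. if l = 0 then 1 else 0"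
        "\<lambda>l. if l = 0 then cnj \<zeta> else complex_of_real (sqrt (1 - (cmod \<zeta>)\<^sup>2))"]) simp_all
qed

text \<open>For |\<zeta>| = 1 the joint law is carried by a proper subspace, a Lebesgue null set,
  but each half is still a standard complex Gaussian. This is why bounds that hold almost everywhere
  for b survive.\<close>

lemma AE_cgaussian_law:
  assumes \<zeta>: "cmod \<zeta> \<le> 1" and P: "AE z in lborel. P (z :: complex^'k)"
    and [measurable]: "Measurable.pred borel P"
  shows "AE x in cgaussian_law (corr_matrix \<zeta>). P (left_half x) \<and> P (right_half x)"
proof -
  obtain u v where uv: "(\<Sum>l\<in>{0, 1 :: nat}. (cmod (u l))\<^sup>2) = 1" "(\<Sum>l\<in>{0, 1}. (cmod (v l))\<^sup>2) = 1"
    "(\<Sum>l\<in>{0, 1}. u l * cnj (v l)) = \<zeta>"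
    using corr_vectors[OF \<zeta>] by blast
  have fin: "finite {0, 1 :: nat}" by simp
  have "AE \<omega> in gproc {0, 1}. P (gcomb {0, 1} u \<omega>) \<and> P (gcomb {0, 1} v \<omega>)"
    using AE_gcomb[OF fin uv(1) P] AE_gcomb[OF fin uv(2) P] by simp
  then show ?thesis
    unfolding uv(3) [symmetric] gcomb_pair_law[OF fin uv(1,2), symmetric]
    by (subst AE_distr_iff) auto
qed

lemma h_complex_cnj:
  assumes [measurable]: "b \<in> borel_measurable borel" "c \<in> borel_measurable borel" and \<zeta>: "cmod \<zeta> \<le> 1"
  shows "cnj (h_complex b c \<zeta>) = h_complex c b (cnj \<zeta>)"
proof -
  obtain u v where uv: "(\<Sum>l\<in>{0, 1 :: nat}. (cmod (u l))\<^sup>2) = 1" "(\<Sum>l\<in>{0, 1}. (cmod (v l))\<^sup>2) = 1"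
    "(\<Sum>l\<in>{0, 1}. u l * cnj (v l)) = \<zeta>"
    using corr_vectors[OF \<zeta>] by blast
  have fin: "finite {0, 1 :: nat}" by simp
  have "cnj \<zeta> = (\<Sum>l\<in>{0, 1}. v l * cnj (u l))"
    unfolding uv(3) [symmetric] by (simp add: mult.commute)
  then have "h_complex c b (cnj \<zeta>) = (\<integral>\<omega>. cnj (b (gcomb {0, 1} u \<omega>) * cnj (c (gcomb {0, 1} v \<omega>))) \<partial>gproc {0, 1})"
    using h_complex_gcomb[OF assms(2,1) fin uv(2,1)] by (simp add: mult.commute)
  also have "\<dots> = cnj (\<integral>\<omega>. b (gcomb {0, 1} u \<omega>) * cnj (c (gcomb {0, 1} v \<omega>)) \<partial>gproc {0, 1})"
    by (rule Bochner_Integration.integral_cnj)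
  also have "\<dots> = cnj (h_complex b c \<zeta>)"
    using h_complex_gcomb[OF assms(1,2) fin uv(1,2)] uv(3) by simp
  finally show ?thesis ..
qed

text \<open>Rotating the first vector multiplies both <u, v> and Z_u by \<alpha>, and the symmetry
  of b then pulls \<alpha> out of the expectation.\<close>

lemma h_complex_rotate:
  assumes [measurable]: "b \<in> borel_measurable borel" "c \<in> borel_measurable borel" and \<zeta>: "cmod \<zeta> \<le> 1"
    and \<alpha>: "cmod \<alpha> = 1" and sym: "\<And>z. b (\<alpha> *s z) = \<alpha> * b z"
  shows "h_complex b c (\<alpha> * \<zeta>) = \<alpha> * h_complex b c \<zeta>"
proof -
  obtain u v where uv: "(\<Sum>l\<in>{0, 1 :: nat}. (cmod (u l))\<^sup>2) = 1" "(\<Sum>l\<in>{0, 1}. (cmod (v l))\<^sup>2) = 1"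
    "(\<Sum>l\<in>{0, 1}. u l * cnj (v l)) = \<zeta>"
    using corr_vectors[OF \<zeta>] by blast
  have fin: "finite {0, 1 :: nat}" by simp
  define u' where "u' l = \<alpha> * u l" for l
  have u': "(\<Sum>l\<in>{0, 1}. (cmod (u' l))\<^sup>2) = 1"
    using uv(1) \<alpha> by (simp add: u'_def norm_mult)
  have g: "gcomb {0, 1} u' \<omega> = \<alpha> *s gcomb {0, 1} u \<omega>" for \<omega> :: "nat \<Rightarrow> complex^'a"
    by (simp add: gcomb_def u'_def vec_eq_iff algebra_simps)
  have "(\<Sum>l\<in>{0, 1}. u' l * cnj (v l)) = \<alpha> * \<zeta>"
    unfolding uv(3) [symmetric] by (simp add: u'_def algebra_simps)
  then have "h_complex b c (\<alpha> * \<zeta>) =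
      (\<integral>\<omega>. \<alpha> * (b (gcomb {0, 1} u \<omega>) * cnj (c (gcomb {0, 1} v \<omega>))) \<partial>gproc {0, 1})"
    using h_complex_gcomb[OF assms(1,2) fin u' uv(2)] by (simp add: g sym mult.assoc del: One_nat_def)
  also have "\<dots> = \<alpha> * h_complex b c \<zeta>"
    using h_complex_gcomb[OF assms(1,2) fin uv(1,2)] uv(3) by simp
  finally show ?thesis .
qed

lemma h_complex_one:
  assumes [measurable]: "b \<in> borel_measurable borel"
  shows "h_complex b b 1 = complex_of_real ((gauss_norm b)\<^sup>2)"
proof -
  have fin: "finite {0 :: nat}" by simp
  have one: "(\<Sum>l\<in>{0 :: nat}. (cmod ((\<lambda>_. 1) l))\<^sup>2) = 1" by simp
  have "h_complex b b 1 = (\<integral>\<omega>. b (gcomb {0} (\<lambda>_. 1) \<omega>) * cnj (b (gcomb {0} (\<lambda>_. 1) \<omega>)) \<partial>gproc {0 :: nat})"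
    using h_complex_gcomb[OF assms assms fin one one] by simp
  also have "\<dots> = (\<integral>\<omega>. complex_of_real ((cmod (b (gcomb {0} (\<lambda>_. 1) \<omega>)))\<^sup>2) \<partial>gproc {0 :: nat})"
    by (simp only: complex_norm_square)
  also have "\<dots> = (\<integral>z. complex_of_real ((cmod (b z))\<^sup>2) \<partial>distr (gproc {0 :: nat}) borel (gcomb {0} (\<lambda>_. 1)))"
    by (subst integral_distr) auto
  also have "\<dots> = complex_of_real (\<integral>z. (cmod (b z))\<^sup>2 \<partial>std_cgaussian)"
    unfolding gcomb_law[OF fin one] by (rule integral_complex_of_real)
  also have "(\<integral>z. (cmod (b z))\<^sup>2 \<partial>std_cgaussian) = (gauss_norm b)\<^sup>2"
    by (simp add: gauss_norm_def)
  finally show ?thesis .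
qed

lemma L_infD:
  fixes b :: "complex^'k \<Rightarrow> complex"
  assumes "b \<in> L_inf"
  shows "b \<in> borel_measurable borel" "AE z in lborel. cmod (b z) \<le> real_of_ereal (Linf_norm b)"
    "0 \<le> real_of_ereal (Linf_norm b)"
proof -
  show m: "b \<in> borel_measurable borel" using assms by (simp add: L_inf_def)
  have AE: "AE z in lborel. ereal (cmod (b z)) \<le> Linf_norm b"
    unfolding Linf_norm_def by (rule esssup_AE)
  then have "AE z::complex^'k in lborel. 0 \<le> Linf_norm b"
    by (rule eventually_mono) (meson ereal_less_eq(5) norm_ge_zero order.trans)
  \<comment> \<open>A statement that does not mention z and holds almost everywhere in a probability
    space is true.\<close>
  from AE_std_cgaussian[OF this] have 0: "0 \<le> Linf_norm b"
    by simp
  then show "0 \<le> real_of_ereal (Linf_norm b)"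
    by (rule real_of_ereal_pos)
  have "Linf_norm b < \<infinity>" using assms by (simp add: L_inf_def)
  with 0 have "ereal (real_of_ereal (Linf_norm b)) = Linf_norm b"
    by (intro ereal_real') auto
  with AE show "AE z in lborel. cmod (b z) \<le> real_of_ereal (Linf_norm b)"
    by (metis (mono_tags, lifting) AE_mp AE_I2 ereal_less_eq(3))
qed

text \<open>Since Re (z cnj w) = Re z Re w + Im z Im w, the real part is the sum of the two real
  correlation functions. The imaginary part vanishes because conjugation exchanges the two
  functions, here both b, and fixes the real argument.\<close>

lemma H_fun_eq_h_complex:
  assumes [measurable]: "b \<in> borel_measurable borel" and B: "AE z in lborel. cmod (b z) \<le> B"
    and \<rho>: "\<bar>\<rho>\<bar> \<le> 1"
  shows "complex_of_real (H_fun (re_part b) (im_part b) \<rho>) = h_complex b b (of_real \<rho>)"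
proof -
  let ?G = "gaussian_law (corr_matrix_real \<rho>) :: (real^(('a + 'a) + ('a + 'a))) measure"
  let ?L = "\<lambda>x. pair_vec (to_complex (left_half x)) (to_complex (right_half x)) :: complex^('a + 'a)"
  interpret G: prob_space ?G by (rule prob_space_gaussian_law)
  define X where "X x = b (to_complex (left_half x))" for x :: "real^(('a + 'a) + ('a + 'a))"
  define Y where "Y x = b (to_complex (right_half x))" for x :: "real^(('a + 'a) + ('a + 'a))"
  have [measurable]: "X \<in> borel_measurable borel" "Y \<in> borel_measurable borel"
    unfolding X_def Y_def by measurable
  have "AE x in cgaussian_law (corr_matrix (of_real \<rho>)). cmod (b (left_half x)) \<le> B \<and> cmod (b (right_half x)) \<le> B"
    by (rule AE_cgaussian_law) (use B \<rho> in auto)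
  then have "AE x in ?G. cmod (b (left_half (?L x))) \<le> B \<and> cmod (b (right_half (?L x))) \<le> B"
    unfolding cgaussian_law_of_real[OF \<rho>] by (rule AE_distrD[rotated]) measurable
  then have bd: "AE x in ?G. cmod (X x) \<le> B \<and> cmod (Y x) \<le> B"
    by (simp add: X_def Y_def)
  have int: "integrable ?G (\<lambda>x. f (X x) * g (Y x))"
    if [measurable]: "f \<in> borel_measurable borel" "g \<in> borel_measurable borel"
      and fg: "\<And>z. norm (f z) \<le> cmod z" "\<And>z. norm (g z) \<le> cmod z"
    for f g :: "complex \<Rightarrow> 'x::{real_normed_field,second_countable_topology,banach}"
  proof (rule G.integrable_mult_bounded)
    show "AE x in ?G. norm (f (X x)) \<le> B" "AE x in ?G. norm (g (Y x)) \<le> B"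
      using bd by (eventually_elim, use fg in \<open>force intro: order.trans\<close>)+
  qed measurable
  have "h_complex b b (of_real \<rho>) = (\<integral>x. X x * cnj (Y x) \<partial>?G)"
    unfolding h_complex_def corr_matrix_def [symmetric] cgaussian_law_of_real[OF \<rho>] X_def Y_def
    by (subst integral_distr) auto
  moreover have "integrable ?G (\<lambda>x. X x * cnj (Y x))"
    by (rule int[of "\<lambda>z. z" cnj]) auto
  ultimately have "Re (h_complex b b (of_real \<rho>)) = (\<integral>x. Re (X x * cnj (Y x)) \<partial>?G)"
    by (simp only: integral_Re)
  also have "\<dots> = (\<integral>x. Re (X x) * Re (Y x) \<partial>?G) + (\<integral>x. Im (X x) * Im (Y x) \<partial>?G)"
    by (subst Bochner_Integration.integral_add [symmetric])
      (auto intro!: int simp: abs_Re_le_cmod abs_Im_le_cmod)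
  also have "\<dots> = H_fun (re_part b) (im_part b) \<rho>"
    by (simp add: H_fun_def h_real_def re_part_def im_part_def X_def Y_def)
  finally have "Re (h_complex b b (of_real \<rho>)) = H_fun (re_part b) (im_part b) \<rho>" .
  moreover have "Im (h_complex b b (of_real \<rho>)) = 0"
  proof -
    have "cnj (h_complex b b (of_real \<rho>)) = h_complex b b (of_real \<rho>)"
      using h_complex_cnj[of b b "of_real \<rho>"] \<rho> by simp
    then show ?thesis by (simp add: complex_eq_iff)
  qed
  ultimately show ?thesis
    by (simp add: complex_eq_iff)
qed

subsection \<open>Bilinear forms on the polydisc\<close>

text \<open>Stands for \<open>norm_inf_1 A <= N\<close>, as the next two lemmas show, but for
  coefficients given as a function of two indices. Entrywise changes of the coefficients then need
  neither matrices nor suprema.\<close>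

definition bil_bound :: "nat \<Rightarrow> nat \<Rightarrow> (nat \<Rightarrow> nat \<Rightarrow> complex) \<Rightarrow> real \<Rightarrow> bool" where
  "bil_bound m n a N \<longleftrightarrow> (\<forall>p q. (\<forall>i<m. cmod (p i) \<le> 1) \<longrightarrow> (\<forall>j<n. cmod (q j) \<le> 1) \<longrightarrow>
     cmod (\<Sum>i<m. \<Sum>j<n. a i j * p i * q j) \<le> N)"

lemma bil_bound_norm_inf_1:
  "bil_bound (dim_row A) (dim_col A) (\<lambda>i j. A $$ (i, j)) (norm_inf_1 A)"
  unfolding bil_bound_def norm_inf_1_def
proof (intro allI impI cSup_upper)
  show "bdd_above {cmod (\<Sum>i<dim_row A. \<Sum>j<dim_col A. A $$ (i, j) * p i * q j) | p q.
     (\<forall>i<dim_row A. cmod (p i) \<le> 1) \<and> (\<forall>j<dim_col A. cmod (q j) \<le> 1)}"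
  proof (rule bdd_aboveI, clarify)
    fix p q assume pq: "\<forall>i<dim_row A. cmod (p i) \<le> 1" "\<forall>j<dim_col A. cmod (q j) \<le> 1"
    have "cmod (\<Sum>i<dim_row A. \<Sum>j<dim_col A. A $$ (i, j) * p i * q j) \<le>
        (\<Sum>i<dim_row A. \<Sum>j<dim_col A. cmod (A $$ (i, j) * p i * q j))"
      by (intro order.trans[OF norm_sum] sum_mono order.refl)
    also have "\<dots> \<le> (\<Sum>i<dim_row A. \<Sum>j<dim_col A. cmod (A $$ (i, j)) * 1 * 1)"
      unfolding norm_mult by (intro sum_mono mult_mono) (use pq in auto)
    finally show "cmod (\<Sum>i<dim_row A. \<Sum>j<dim_col A. A $$ (i, j) * p i * q j) \<le>
        (\<Sum>i<dim_row A. \<Sum>j<dim_col A. cmod (A $$ (i, j)) * 1 * 1)" .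
  qed
qed blast

lemma norm_inf_1_le:
  assumes "bil_bound (dim_row A) (dim_col A) (\<lambda>i j. A $$ (i, j)) N"
  shows "norm_inf_1 A \<le> N"
  unfolding norm_inf_1_def
proof (rule cSup_least)
  show "{cmod (\<Sum>i<dim_row A. \<Sum>j<dim_col A. A $$ (i, j) * p i * q j) | p q.
     (\<forall>i<dim_row A. cmod (p i) \<le> 1) \<and> (\<forall>j<dim_col A. cmod (q j) \<le> 1)} \<noteq> {}"
    by (auto intro!: exI[of _ "\<lambda>_. 0"])
qed (use assms in \<open>auto simp: bil_bound_def\<close>)

lemma bil_bound_nonneg: "bil_bound m n a N \<Longrightarrow> 0 \<le> N"
  unfolding bil_bound_def by (drule spec[of _ "\<lambda>_. 0"], drule spec[of _ "\<lambda>_. 0"]) simp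

lemma bil_bound_scaled:
  assumes N: "bil_bound m n a N" and p: "\<And>i. i < m \<Longrightarrow> cmod (p i) \<le> B" and q: "\<And>j. j < n \<Longrightarrow> cmod (q j) \<le> C"
    and BC: "0 \<le> B" "0 \<le> C"
  shows "cmod (\<Sum>i<m. \<Sum>j<n. a i j * p i * q j) \<le> B * C * N"
proof -
  define p' where "p' i = p i / of_real B" for i
  define q' where "q' i = q i / of_real C" for i
  have "cmod (\<Sum>i<m. \<Sum>j<n. a i j * p' i * q' j) \<le> N"
    using p q BC by (intro N [unfolded bil_bound_def, rule_format])
      (auto simp: p'_def q'_def norm_divide divide_le_eq_1)
  \<comment> \<open>For B = 0 the hypothesis forces p i = 0, in agreement with division by zero
    being zero.\<close>
  moreover have "p i = of_real B * p' i" if "i < m" for i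
    using p[OF that] BC by (cases "B = 0") (auto simp: p'_def)
  moreover have "q i = of_real C * q' i" if "i < n" for i
    using q[OF that] BC by (cases "C = 0") (auto simp: q'_def)
  ultimately have "(\<Sum>i<m. \<Sum>j<n. a i j * p i * q j) = of_real (B * C) * (\<Sum>i<m. \<Sum>j<n. a i j * p' i * q' j)"
    by (simp add: sum_distrib_left mult_ac)
  then have "cmod (\<Sum>i<m. \<Sum>j<n. a i j * p i * q j) = (B * C) * cmod (\<Sum>i<m. \<Sum>j<n. a i j * p' i * q' j)"
    using BC by (simp add: norm_mult)
  also have "\<dots> \<le> B * C * N"
    using \<open>cmod (\<Sum>i<m. \<Sum>j<n. a i j * p' i * q' j) \<le> N\<close> BC by (intro mult_left_mono) auto
  finally show ?thesis .
qed

lemma bil_bound_h_complex: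
  fixes b c :: "complex^'k \<Rightarrow> complex" and u v :: "nat \<Rightarrow> 'i \<Rightarrow> complex"
  assumes N: "bil_bound m n a N"
    and [measurable]: "b \<in> borel_measurable borel" "c \<in> borel_measurable borel"
    and B: "AE z in lborel. cmod (b z) \<le> B" "0 \<le> B" and C: "AE z in lborel. cmod (c z) \<le> C" "0 \<le> C"
    and I: "finite I" and u: "\<And>i. i < m \<Longrightarrow> (\<Sum>l\<in>I. (cmod (u i l))\<^sup>2) = 1"
    and v: "\<And>j. j < n \<Longrightarrow> (\<Sum>l\<in>I. (cmod (v j l))\<^sup>2) = 1"
  shows "cmod (\<Sum>i<m. \<Sum>j<n. a i j * h_complex b c (\<Sum>l\<in>I. u i l * cnj (v j l))) \<le> B * C * N"
proof -
  interpret prob_space "gproc I :: ('i \<Rightarrow> complex^'k) measure" by (rule prob_space_gproc)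
  define X where "X i \<omega> = b (gcomb I (u i) \<omega>)" for i and \<omega> :: "'i \<Rightarrow> complex^'k"
  define Y where "Y j \<omega> = cnj (c (gcomb I (v j) \<omega>))" for j and \<omega> :: "'i \<Rightarrow> complex^'k"
  have [measurable]: "X i \<in> borel_measurable (gproc I)" "Y j \<in> borel_measurable (gproc I)" for i j
    unfolding X_def Y_def by measurable
  have X: "AE \<omega> in gproc I. cmod (X i \<omega>) \<le> B" if "i < m" for i
    unfolding X_def by (rule AE_gcomb[OF I u[OF that] B(1)])
  have Y: "AE \<omega> in gproc I. cmod (Y j \<omega>) \<le> C" if "j < n" for j
    unfolding Y_def complex_mod_cnj by (rule AE_gcomb[OF I v[OF that] C(1)])
  have int: "integrable (gproc I) (\<lambda>\<omega>. X i \<omega> * Y j \<omega>)" if "i < m" "j < n" for i j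
    by (rule integrable_mult_bounded[OF _ _ X[OF that(1)] Y[OF that(2)]]) measurable
  have "(\<Sum>i<m. \<Sum>j<n. a i j * h_complex b c (\<Sum>l\<in>I. u i l * cnj (v j l))) =
      (\<Sum>i<m. \<Sum>j<n. \<integral>\<omega>. a i j * (X i \<omega> * Y j \<omega>) \<partial>gproc I)"
    using u v I by (intro sum.cong refl) (simp add: h_complex_gcomb X_def Y_def)
  also have "\<dots> = (\<integral>\<omega>. (\<Sum>i<m. \<Sum>j<n. a i j * X i \<omega> * Y j \<omega>) \<partial>gproc I)"
  proof -
    have int': "integrable (gproc I) (\<lambda>\<omega>. a i j * X i \<omega> * Y j \<omega>)" if "i < m" "j < n" for i j
      using int[OF that] by (simp add: mult.assoc)
    have "(\<integral>\<omega>. (\<Sum>i<m. \<Sum>j<n. a i j * X i \<omega> * Y j \<omega>) \<partial>gproc I) =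
        (\<Sum>i<m. \<integral>\<omega>. (\<Sum>j<n. a i j * X i \<omega> * Y j \<omega>) \<partial>gproc I)"
      by (intro Bochner_Integration.integral_sum Bochner_Integration.integrable_sum int') auto
    also have "\<dots> = (\<Sum>i<m. \<Sum>j<n. \<integral>\<omega>. a i j * X i \<omega> * Y j \<omega> \<partial>gproc I)"
      by (intro sum.cong refl Bochner_Integration.integral_sum int') auto
    finally show ?thesis by (simp add: mult.assoc)
  qed
  finally have "cmod (\<Sum>i<m. \<Sum>j<n. a i j * h_complex b c (\<Sum>l\<in>I. u i l * cnj (v j l))) \<le>
      (\<integral>\<omega>. cmod (\<Sum>i<m. \<Sum>j<n. a i j * X i \<omega> * Y j \<omega>) \<partial>gproc I)"
    by simp
  also have "\<dots> \<le> B * C * N"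
  proof (rule integral_le_const)
    show "integrable (gproc I) (\<lambda>\<omega>. cmod (\<Sum>i<m. \<Sum>j<n. a i j * X i \<omega> * Y j \<omega>))"
      by (intro integrable_norm Bochner_Integration.integrable_sum)
        (auto simp: mult.assoc intro!: int)
    have "AE \<omega> in gproc I. (\<forall>i\<in>{..<m}. cmod (X i \<omega>) \<le> B) \<and> (\<forall>j\<in>{..<n}. cmod (Y j \<omega>) \<le> C)"
      using X Y by (intro AE_conjI AE_finite_allI) auto
    then show "AE \<omega> in gproc I. cmod (\<Sum>i<m. \<Sum>j<n. a i j * X i \<omega> * Y j \<omega>) \<le> B * C * N"
      by eventually_elim (rule bil_bound_scaled[OF N], use B C in auto)
  qed
  finally show ?thesis .
qed

lemma trace_adjoint_h_complex:
  assumes b: "b \<in> L_inf" and c: "c \<in> L_inf" and A: "A \<in> carrier_mat m n" and S: "S \<in> Q_mat m n"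
  shows "cmod (mat_trace (mat_adjoint A * map_mat (h_complex b c) S)) \<le>
    real_of_ereal (Linf_norm b) * real_of_ereal (Linf_norm c) * norm_inf_1 A"
proof -
  obtain H :: "(nat \<Rightarrow> complex) hilbert" and u v where H: "complex_hilbert_space H"
    and S: "S = Matrix.mat m n (\<lambda>(i, j). sp H (v j) (u i))"
    and u: "\<forall>i<m. u i \<in> carrier H \<and> hnorm H (u i) = 1" and v: "\<forall>j<n. v j \<in> carrier H \<and> hnorm H (v j) = 1"
    using S unfolding Q_mat_def by blast
  obtain u' v' N where uv: "\<And>i. i < m \<Longrightarrow> hnorm (cspace N) (u' i) = hnorm H (u i)"
    "\<And>j. j < n \<Longrightarrow> hnorm (cspace N) (v' j) = hnorm H (v j)"
    "\<And>i j. i < m \<Longrightarrow> j < n \<Longrightarrow> sp (cspace N) (v' j) (u' i) = sp H (v j) (u i)"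
    by (rule complex_hilbert_space.gram_matrix_in_cspace[OF H, of m u n v]) (use u v in auto)
  have u1: "(\<Sum>l<N. (cmod (u' i l))\<^sup>2) = 1" if "i < m" for i
    using uv(1)[OF that] u that by (simp add: hnorm_cspace L2_set_def)
  have v1: "(\<Sum>l<N. (cmod (v' i l))\<^sup>2) = 1" if "i < n" for i
    using uv(2)[OF that] v that by (simp add: hnorm_cspace L2_set_def)
  have dim: "dim_row A = m" "dim_col A = n" using A by auto
  \<comment> \<open>The trace has coefficients cnj (A i j), and the entries <v_j, u_i> of S have
    \<open>v\<close> in the first place. Hence the bound is needed for the conjugate transpose of A,
    whose norm is the same.\<close>
  have N: "bil_bound n m (\<lambda>j i. cnj (A $$ (i, j))) (norm_inf_1 A)"
    unfolding bil_bound_def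
  proof (intro allI impI)
    fix p q assume pq: "\<forall>i<n. cmod (p i) \<le> 1" "\<forall>j<m. cmod (q j) \<le> 1"
    have "cmod (\<Sum>i<n. \<Sum>j<m. cnj (A $$ (j, i)) * p i * q j) =
        cmod (cnj (\<Sum>j<m. \<Sum>i<n. A $$ (j, i) * cnj (q j) * cnj (p i)))"
      by (subst sum.swap) (simp add: mult_ac)
    also have "\<dots> \<le> norm_inf_1 A"
      using bil_bound_norm_inf_1[of A] pq by (simp only: complex_mod_cnj) (simp add: bil_bound_def dim)
    finally show "cmod (\<Sum>i<n. \<Sum>j<m. cnj (A $$ (j, i)) * p i * q j) \<le> norm_inf_1 A" .
  qed
  have "mat_trace (mat_adjoint A * map_mat (h_complex b c) S) =
      (\<Sum>j<n. \<Sum>i<m. cnj (A $$ (i, j)) * h_complex b c (S $$ (i, j)))"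
    using A S by (simp add: mat_trace_def mat_adjoint_def scalar_prod_def atLeast0LessThan)
  also have "\<dots> = (\<Sum>j<n. \<Sum>i<m. cnj (A $$ (i, j)) * h_complex b c (\<Sum>l<N. v' j l * cnj (u' i l)))"
    using uv(3) by (simp add: S)
  also have "cmod \<dots> \<le> real_of_ereal (Linf_norm b) * real_of_ereal (Linf_norm c) * norm_inf_1 A"
    by (rule bil_bound_h_complex[OF N]) (use L_infD[OF b] L_infD[OF c] u1 v1 in auto)
  finally show ?thesis .
qed

subsection \<open>Continuity of the correlation function\<close>

text \<open>A measurable function is almost everywhere a limit of continuous functions. Composing
  these with the closest-point map of the disc of radius B makes them bounded, keeps them
  continuous, and leaves the limit unchanged because almost all values of b lie in the disc.\<close>

lemma ess_bounded_limit_of_continuous: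
  fixes b :: "complex^'k \<Rightarrow> complex"
  assumes b: "b \<in> borel_measurable borel" and B: "AE z in lborel. cmod (b z) \<le> B" "0 \<le> B"
  obtains g where "\<And>n. continuous_on UNIV (g n)" "\<And>n z. cmod (g n z) \<le> B"
    "AE z in lborel. (\<lambda>n. g n z) \<longlonglongrightarrow> b z"
proof -
  have "b \<in> borel_measurable (lebesgue_on UNIV)"
    using b by (intro measurable_restrict_space1 measurable_completion) simp
  then have "b measurable_on UNIV"
    by (intro lebesgue_measurable_imp_measurable_on) auto
  then obtain N g where N: "negligible N" and g: "\<And>n. continuous_on UNIV (g n)"
    and lim: "\<And>z. z \<notin> N \<Longrightarrow> (\<lambda>n. g n z) \<longlonglongrightarrow> b z"
    unfolding measurable_on_def by auto
  define P where "P = closest_point (cball (0::complex) B)"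
  have ne: "cball (0::complex) B \<noteq> {}" using B(2) by simp
  have P: "continuous_on UNIV P"
    unfolding P_def by (rule continuous_on_closest_point) (use ne in auto)
  have Pin: "P z \<in> cball 0 B" for z
    unfolding P_def by (rule closest_point_in_set) (use ne in auto)
  have Pid: "P z = z" if "cmod z \<le> B" for z
    unfolding P_def by (rule closest_point_self) (use that in auto)
  have "AE z in lborel. z \<notin> N"
  proof -
    have "N \<in> null_sets lebesgue" using N by (simp add: negligible_iff_null_sets)
    then have "AE z in lebesgue. z \<notin> N" by (rule AE_not_in)
    then show ?thesis by (simp add: AE_completion_iff)
  qed
  then have "AE z in lborel. (\<lambda>n. P (g n z)) \<longlonglongrightarrow> b z"
    using B(1)
  proof eventually_elim
    case (elim z)
    have "(\<lambda>n. P (g n z)) \<longlonglongrightarrow> P (b z)"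
      using continuous_on_tendsto_compose[OF P lim[OF elim(1)]] by simp
    then show ?case using Pid[OF elim(2)] by simp
  qed
  moreover have "continuous_on UNIV (\<lambda>z. P (g n z))" for n
    by (rule continuous_on_compose2[OF P g]) auto
  moreover have "cmod (P (g n z)) \<le> B" for n z
    using Pin[of "g n z"] by simp
  ultimately show ?thesis using that[of "\<lambda>n z. P (g n z)"] by blast
qed

text \<open>As b is merely measurable, dominated convergence cannot be applied to b(Z_v) while v
  varies with \<rho>. The second b is replaced by continuous approximants \<open>g n\<close>. The
  error is at most B * e n for every \<rho>, since Z_v has the same law for all unit vectors v, and
  so the continuous functions converge uniformly.\<close>

lemma continuous_on_h_complex_of_real:
  fixes b :: "complex^'k \<Rightarrow> complex"
  assumes b[measurable]: "b \<in> borel_measurable borel" and B: "AE z in lborel. cmod (b z) \<le> B" "0 \<le> B"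
  shows "continuous_on {-1..1} (\<lambda>\<rho>. h_complex b b (complex_of_real \<rho>))"
proof -
  let ?\<Omega> = "gproc {0, 1 :: nat} :: (nat \<Rightarrow> complex^'k) measure"
  interpret prob_space ?\<Omega> by (rule prob_space_gproc)
  obtain g where g: "\<And>n. continuous_on UNIV (g n)" "\<And>n z. cmod (g n z) \<le> B"
    "AE z in lborel. (\<lambda>n. g n z) \<longlonglongrightarrow> b z"
    using ess_bounded_limit_of_continuous[OF b B] by blast
  have [measurable]: "g n \<in> borel_measurable borel" for n
    using g(1) by (rule borel_measurable_continuous_onI)
  define u :: "nat \<Rightarrow> complex" where "u l = (if l = 0 then 1 else 0)" for l
  define v :: "real \<Rightarrow> nat \<Rightarrow> complex" where "v \<rho> l = (if l = 0 then of_real \<rho> else of_real (sqrt (1 - \<rho>\<^sup>2)))" for \<rho> l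
  have fin: "finite {0, 1 :: nat}" by simp
  have u1: "(\<Sum>l\<in>{0, 1}. (cmod (u l))\<^sup>2) = 1" by (simp add: u_def)
  have v1: "(\<Sum>l\<in>{0, 1}. (cmod (v \<rho> l))\<^sup>2) = 1" if "\<rho> \<in> {-1..1}" for \<rho>
  proof -
    have "1 - \<rho>\<^sup>2 \<ge> 0" using that by (auto simp: abs_square_le_1 abs_le_iff)
    then show ?thesis by (simp add: v_def)
  qed
  have uv: "(\<Sum>l\<in>{0, 1}. u l * cnj (v \<rho> l)) = of_real \<rho>" for \<rho>
    by (simp add: u_def v_def)
  have h: "h_complex b c (of_real \<rho>) = (\<integral>\<omega>. b (gcomb {0, 1} u \<omega>) * cnj (c (gcomb {0, 1} (v \<rho>) \<omega>)) \<partial>?\<Omega>)"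
    if "\<rho> \<in> {-1..1}" "c \<in> borel_measurable borel" for \<rho> c
    using h_complex_gcomb[OF b that(2) fin u1 v1[OF that(1)]] unfolding uv .
  have bu: "AE \<omega> in ?\<Omega>. cmod (b (gcomb {0, 1} u \<omega>)) \<le> B"
    by (rule AE_gcomb[OF fin u1 B(1)])
  have bg: "AE z in std_cgaussian. norm (cmod (b z - g n z)) \<le> 2 * B" for n
    using AE_std_cgaussian[OF B(1)]
  proof eventually_elim
    case (elim z)
    then show ?case using norm_triangle_ineq4[of "b z" "g n z"] g(2)[of n z] by simp
  qed
  define e where "e n = (\<integral>z. cmod (b z - g n z) \<partial>std_cgaussian)" for n
  have "e \<longlonglongrightarrow> (\<integral>z. 0 \<partial>(std_cgaussian :: (complex^'k) measure))"
    unfolding e_def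
  proof (rule integral_dominated_convergence[where w="\<lambda>_. 2 * B"])
    show "AE z in std_cgaussian. (\<lambda>n. cmod (b z - g n z)) \<longlonglongrightarrow> 0"
      using AE_std_cgaussian[OF g(3)]
    proof eventually_elim
      case (elim z)
      then have "(\<lambda>n. cmod (b z - g n z)) \<longlonglongrightarrow> cmod (b z - b z)"
        by (intro tendsto_intros)
      then show ?case by simp
    qed
    show "AE z in std_cgaussian. norm (cmod (b z - g n z)) \<le> 2 * B" for n by (rule bg)
  qed auto
  then have e: "e \<longlonglongrightarrow> 0" by simp
  have int_bg: "integrable std_cgaussian (\<lambda>z. cmod (b z - g n z))" for n
    by (rule std_cgaussian.integrable_const_bound[OF bg]) measurable
  have close: "cmod (h_complex b (g n) (of_real \<rho>) - h_complex b b (of_real \<rho>)) \<le> B * e n"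
    if \<rho>: "\<rho> \<in> {-1..1}" for \<rho> n
  proof -
    define X where "X \<omega> = b (gcomb {0, 1} u \<omega>)" for \<omega> :: "nat \<Rightarrow> complex^'k"
    define Y where "Y \<omega> = cnj (b (gcomb {0, 1} (v \<rho>) \<omega>))" for \<omega> :: "nat \<Rightarrow> complex^'k"
    define G where "G \<omega> = cnj (g n (gcomb {0, 1} (v \<rho>) \<omega>))" for \<omega> :: "nat \<Rightarrow> complex^'k"
    have [measurable]: "X \<in> borel_measurable ?\<Omega>" "Y \<in> borel_measurable ?\<Omega>" "G \<in> borel_measurable ?\<Omega>"
      unfolding X_def Y_def G_def by measurable
    have X: "AE \<omega> in ?\<Omega>. cmod (X \<omega>) \<le> B" unfolding X_def by (rule bu)
    have Y: "AE \<omega> in ?\<Omega>. cmod (Y \<omega>) \<le> B"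
      unfolding Y_def complex_mod_cnj by (rule AE_gcomb[OF fin v1[OF \<rho>] B(1)])
    have G: "cmod (G \<omega>) \<le> B" for \<omega> by (simp add: G_def g)
    have iXY: "integrable ?\<Omega> (\<lambda>\<omega>. X \<omega> * Y \<omega>)"
      by (rule integrable_mult_bounded[OF _ _ X Y]) measurable
    have iXG: "integrable ?\<Omega> (\<lambda>\<omega>. X \<omega> * G \<omega>)"
      by (rule integrable_mult_bounded[OF _ _ X AE_I2[OF G]]) measurable
    have law: "distr ?\<Omega> borel (gcomb {0, 1} (v \<rho>)) = std_cgaussian"
      by (rule gcomb_law[OF fin v1[OF \<rho>]])
    have diff: "cmod (G \<omega> - Y \<omega>) = cmod (b (gcomb {0, 1} (v \<rho>) \<omega>) - g n (gcomb {0, 1} (v \<rho>) \<omega>))" for \<omega>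
      unfolding G_def Y_def complex_cnj_diff [symmetric] complex_mod_cnj by (rule norm_minus_commute)
    have iGY: "integrable ?\<Omega> (\<lambda>\<omega>. cmod (G \<omega> - Y \<omega>))"
      unfolding diff using int_bg[of n] unfolding law [symmetric]
      by (subst (asm) integrable_distr_eq) auto
    have "h_complex b (g n) (of_real \<rho>) - h_complex b b (of_real \<rho>) = (\<integral>\<omega>. X \<omega> * G \<omega> - X \<omega> * Y \<omega> \<partial>?\<Omega>)"
      using iXY iXG \<rho> by (simp add: h X_def Y_def G_def)
    also have "cmod \<dots> \<le> (\<integral>\<omega>. cmod (X \<omega> * G \<omega> - X \<omega> * Y \<omega>) \<partial>?\<Omega>)"
      by simp
    also have "\<dots> \<le> (\<integral>\<omega>. B * cmod (G \<omega> - Y \<omega>) \<partial>?\<Omega>)"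
    proof (rule integral_mono_AE)
      show "AE \<omega> in ?\<Omega>. cmod (X \<omega> * G \<omega> - X \<omega> * Y \<omega>) \<le> B * cmod (G \<omega> - Y \<omega>)"
        using X by eventually_elim (auto simp: norm_mult right_diff_distrib [symmetric] intro!: mult_right_mono)
    qed (use iXY iXG iGY in auto)
    also have "\<dots> = B * e n"
    proof -
      have "e n = (\<integral>\<omega>. cmod (G \<omega> - Y \<omega>) \<partial>?\<Omega>)"
        unfolding e_def diff law [symmetric] by (subst integral_distr) auto
      then show ?thesis by simp
    qed
    finally show ?thesis .
  qed
  have unif: "uniform_limit {-1..1} (\<lambda>n \<rho>. h_complex b (g n) (of_real \<rho>)) (\<lambda>\<rho>. h_complex b b (of_real \<rho>)) sequentially"
  proof (rule uniform_limitI)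
    fix \<epsilon> :: real assume "\<epsilon> > 0"
    have "(\<lambda>n. B * e n) \<longlonglongrightarrow> 0" using tendsto_mult_right_zero[OF e] by simp
    then have "eventually (\<lambda>n. B * e n < \<epsilon>) sequentially" using \<open>\<epsilon> > 0\<close> by (rule order_tendstoD)
    then show "\<forall>\<^sub>F n in sequentially. \<forall>\<rho>\<in>{-1..1}. dist (h_complex b (g n) (of_real \<rho>)) (h_complex b b (of_real \<rho>)) < \<epsilon>"
      by eventually_elim (auto simp: dist_norm intro!: order.strict_trans1[OF close])
  qed
  have cont: "continuous_on {-1..1} (\<lambda>\<rho>. h_complex b (g n) (of_real \<rho>))" for n
  proof (rule continuous_on_sequentiallyI)
    fix x a assume x: "\<forall>n. x n \<in> {-1..1::real}" and a: "a \<in> {-1..1}" and lim: "x \<longlonglongrightarrow> a"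
    have "(\<lambda>k. \<integral>\<omega>. b (gcomb {0, 1} u \<omega>) * cnj (g n (gcomb {0, 1} (v (x k)) \<omega>)) \<partial>?\<Omega>) \<longlonglongrightarrow>
        (\<integral>\<omega>. b (gcomb {0, 1} u \<omega>) * cnj (g n (gcomb {0, 1} (v a) \<omega>)) \<partial>?\<Omega>)"
    proof (rule integral_dominated_convergence[where w="\<lambda>_. B * B"])
      show "AE \<omega> in ?\<Omega>. (\<lambda>k. b (gcomb {0, 1} u \<omega>) * cnj (g n (gcomb {0, 1} (v (x k)) \<omega>))) \<longlonglongrightarrow>
          b (gcomb {0, 1} u \<omega>) * cnj (g n (gcomb {0, 1} (v a) \<omega>))"
      proof (intro AE_I2 tendsto_intros)
        fix \<omega> :: "nat \<Rightarrow> complex^'k"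
        have "(\<lambda>k. gcomb {0, 1} (v (x k)) \<omega>) \<longlonglongrightarrow> gcomb {0, 1} (v a) \<omega>"
        proof (rule vec_tendstoI)
          fix i
          have "(\<lambda>k. complex_of_real (x k) * \<omega> 0 $ i + complex_of_real (sqrt (1 - (x k)\<^sup>2)) * \<omega> 1 $ i) \<longlonglongrightarrow>
              complex_of_real a * \<omega> 0 $ i + complex_of_real (sqrt (1 - a\<^sup>2)) * \<omega> 1 $ i"
            by (intro tendsto_intros lim)
          then show "(\<lambda>k. gcomb {0, 1} (v (x k)) \<omega> $ i) \<longlonglongrightarrow> gcomb {0, 1} (v a) \<omega> $ i"
            by (simp add: gcomb_def v_def)
        qed
        then show "(\<lambda>k. g n (gcomb {0, 1} (v (x k)) \<omega>)) \<longlonglongrightarrow> g n (gcomb {0, 1} (v a) \<omega>)"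
          using continuous_on_tendsto_compose[OF g(1)] by auto
      qed
      show "AE \<omega> in ?\<Omega>. norm (b (gcomb {0, 1} u \<omega>) * cnj (g n (gcomb {0, 1} (v (x k)) \<omega>))) \<le> B * B" for k
        using bu by eventually_elim (use B g in \<open>auto simp: norm_mult intro!: mult_mono\<close>)
    qed (auto simp del: One_nat_def)
    then show "(\<lambda>k. h_complex b (g n) (of_real (x k))) \<longlonglongrightarrow> h_complex b (g n) (of_real a)"
      using x a by (simp add: h)
  qed
  show ?thesis
    by (rule uniform_limit_theorem[OF _ unif]) (use cont in auto)
qed

subsection \<open>Matrices of inner products of vectors of bounded length\<close>

definition gram_vectors :: "'l set \<Rightarrow> (nat \<Rightarrow> 'l \<Rightarrow> complex) \<Rightarrow> (nat \<Rightarrow> 'l \<Rightarrow> complex) \<Rightarrow> real \<Rightarrow>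
    (nat \<Rightarrow> nat \<Rightarrow> complex) \<Rightarrow> bool" where
  "gram_vectors I u v s M \<longleftrightarrow> finite I \<and> (\<forall>i. (\<Sum>l\<in>I. (cmod (u i l))\<^sup>2) \<le> s) \<and>
     (\<forall>j. (\<Sum>l\<in>I. (cmod (v j l))\<^sup>2) \<le> s) \<and> (\<forall>i j. M i j = (\<Sum>l\<in>I. u i l * cnj (v j l)))"

lemma gram_vectorsD:
  assumes "gram_vectors I u v s M"
  shows "finite I" "(\<Sum>l\<in>I. (cmod (u i l))\<^sup>2) \<le> s" "(\<Sum>l\<in>I. (cmod (v j l))\<^sup>2) \<le> s"
    "M i j = (\<Sum>l\<in>I. u i l * cnj (v j l))"
  using assms by (auto simp: gram_vectors_def)

text \<open>The entries are inner products of two families of vectors with squared lengths at most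
  \<open>s\<close>. Bounding squares makes the parameter multiplicative under tensor products and
  additive under direct sums. Both families are indexed by all natural numbers, so no dimensions
  have to be carried along.\<close>

definition cgram :: "real \<Rightarrow> (nat \<Rightarrow> nat \<Rightarrow> complex) \<Rightarrow> bool" where
  "cgram s M \<longleftrightarrow> (\<exists>(I :: nat set) u v. gram_vectors I u v s M)"

lemma cgramI:
  fixes I :: "'a::countable set"
  assumes "finite I" "\<And>i. (\<Sum>l\<in>I. (cmod (u i l))\<^sup>2) \<le> s" "\<And>j. (\<Sum>l\<in>I. (cmod (v j l))\<^sup>2) \<le> s"
    "\<And>i j. M i j = (\<Sum>l\<in>I. u i l * cnj (v j l))"
  shows "cgram s M"
  unfolding cgram_def gram_vectors_def using assms
  by (intro exI[of _ "to_nat ` I"] exI[of _ "\<lambda>i l. u i (from_nat l)"] exI[of _ "\<lambda>i l. v i (from_nat l)"])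
    (simp add: sum.reindex)

lemma cgramE:
  assumes "cgram s M"
  obtains I :: "nat set" and u v where "gram_vectors I u v s M"
  using assms unfolding cgram_def by blast

lemma cgram_one: "cgram 1 (\<lambda>i j. 1)"
  by (rule cgramI[of "{0::nat}" "\<lambda>i l. 1" _ "\<lambda>i l. 1"]) auto

lemma cgram_zero: "cgram 0 (\<lambda>i j. 0)"
  by (rule cgramI[of "{} :: nat set" "\<lambda>i l. 1" _ "\<lambda>i l. 1"]) auto

lemma cgram_mono: "cgram s M \<Longrightarrow> s \<le> t \<Longrightarrow> cgram t M"
  unfolding cgram_def gram_vectors_def by (meson order.trans)

lemma cgram_cnj: "cgram s M \<Longrightarrow> cgram s (\<lambda>i j. cnj (M i j))"
proof (erule cgramE)
  fix I :: "nat set" and u v assume "gram_vectors I u v s M"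
  note 1 = gram_vectorsD[OF this]
  show ?thesis
    by (rule cgramI[of I "\<lambda>i l. cnj (u i l)" _ "\<lambda>i l. cnj (v i l)"]) (use 1 in auto)
qed

text \<open>Tensor products of the vectors: inner products and squared lengths both
  multiply.\<close>

lemma cgram_mult:
  assumes "cgram s M" "cgram t N"
  shows "cgram (s * t) (\<lambda>i j. M i j * N i j)"
proof -
  obtain I :: "nat set" and u v where "gram_vectors I u v s M" by (rule cgramE[OF assms(1)])
  note 1 = gram_vectorsD[OF this]
  obtain J :: "nat set" and p q where "gram_vectors J p q t N" by (rule cgramE[OF assms(2)])
  note 2 = gram_vectorsD[OF this]
  have s: "0 \<le> s" using 1(2)[of 0] sum_nonneg[of I "\<lambda>l. (cmod (u 0 l))\<^sup>2"] by simp
  have sq: "(\<Sum>x\<in>I \<times> J. (cmod (f (fst x) * g (snd x)))\<^sup>2) = (\<Sum>l\<in>I. (cmod (f l))\<^sup>2) * (\<Sum>l\<in>J. (cmod (g l))\<^sup>2)"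
    for f g :: "nat \<Rightarrow> complex"
    by (simp add: sum_product norm_mult power_mult_distrib sum.cartesian_product')
  show ?thesis
  proof (rule cgramI[of "I \<times> J" "\<lambda>i x. u i (fst x) * p i (snd x)" _ "\<lambda>i x. v i (fst x) * q i (snd x)"])
    show "M i j * N i j = (\<Sum>l\<in>I \<times> J. u i (fst l) * p i (snd l) * cnj (v j (fst l) * q j (snd l)))" for i j
      unfolding 1(4) 2(4) sum_product
      by (simp add: mult_ac sum.cartesian_product')
  qed (use 1 2 s in \<open>auto simp: sq intro!: mult_mono sum_nonneg\<close>)
qed

text \<open>Direct sums of the vectors: inner products and squared lengths both add.\<close>

lemma cgram_add:
  assumes "cgram s M" "cgram t N"
  shows "cgram (s + t) (\<lambda>i j. M i j + N i j)"
proof -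
  obtain I :: "nat set" and u v where "gram_vectors I u v s M" by (rule cgramE[OF assms(1)])
  note 1 = gram_vectorsD[OF this]
  obtain J :: "nat set" and p q where "gram_vectors J p q t N" by (rule cgramE[OF assms(2)])
  note 2 = gram_vectorsD[OF this]
  show ?thesis
    by (rule cgramI[of "I <+> J" "\<lambda>i. case_sum (u i) (p i)" _ "\<lambda>i. case_sum (v i) (q i)"])
      (use 1 2 in \<open>auto simp: sum.Plus intro: add_mono\<close>)
qed

text \<open>Both families are stretched by sqrt |c|, and the sign of c is put on the first one only.
  As the families are independent of each other, a negative coefficient costs no more than
  |c|.\<close>

lemma cgram_scale:
  assumes "cgram s M"
  shows "cgram (\<bar>c\<bar> * s) (\<lambda>i j. of_real c * M i j)"
proof -
  obtain I :: "nat set" and u v where "gram_vectors I u v s M" by (rule cgramE[OF assms(1)])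
  note 1 = gram_vectorsD[OF this]
  define a where "a = sgn c * sqrt \<bar>c\<bar>"
  have a: "a\<^sup>2 = \<bar>c\<bar>" "a * sqrt \<bar>c\<bar> = c"
    by (auto simp: a_def power_mult_distrib sgn_if mult.assoc)
  show ?thesis
  proof (rule cgramI[of I "\<lambda>i l. of_real a * u i l" _ "\<lambda>i l. of_real (sqrt \<bar>c\<bar>) * v i l"])
    show "complex_of_real c * M i j =
        (\<Sum>l\<in>I. complex_of_real a * u i l * cnj (complex_of_real (sqrt \<bar>c\<bar>) * v j l))" for i j
    proof -
      have "complex_of_real c = complex_of_real a * complex_of_real (sqrt \<bar>c\<bar>)"
        unfolding of_real_mult [symmetric] a(2) ..
      then show ?thesis by (simp add: 1(4) sum_distrib_left mult_ac)
    qed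
  qed (use 1 a in \<open>auto simp: norm_mult power_mult_distrib sum_distrib_left [symmetric] intro!: mult_left_mono\<close>)
qed

lemma cgram_sum:
  assumes "\<And>k. cgram 1 (M k)"
  shows "cgram (\<Sum>k<n::nat. \<bar>a k\<bar>) (\<lambda>i j. \<Sum>k<n. of_real (a k) * M k i j)"
proof (induction n)
  case (Suc n)
  from cgram_add[OF this cgram_scale[OF assms[of n], of "a n"]] show ?case by simp
qed (simp add: cgram_zero)

text \<open>For odd \<open>n\<close> this is \<open>\<alpha> x\<^sup>n\<close> at \<open>z = \<alpha> x\<close>, \<open>|\<alpha>| = 1\<close>; for even \<open>n\<close> the value is irrelevant, since
  the series below have no even terms.\<close>

definition twisted_power :: "nat \<Rightarrow> complex \<Rightarrow> complex" where
  "twisted_power n z = z ^ (n - n div 2) * cnj z ^ (n div 2)"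

lemma cgram_power: "cgram 1 M \<Longrightarrow> cgram 1 (\<lambda>i j. M i j ^ n)"
proof (induction n)
  case (Suc n)
  from cgram_mult[OF Suc.prems Suc.IH[OF Suc.prems]] show ?case by simp
qed (simp add: cgram_one)

lemma cgram_twisted_power: "cgram 1 M \<Longrightarrow> cgram 1 (\<lambda>i j. twisted_power n (M i j))"
  unfolding twisted_power_def
  using cgram_mult[OF cgram_power cgram_power[OF cgram_cnj], of M M] by simp

lemma cgram_cmod_le: "cgram 1 M \<Longrightarrow> cmod (M i j) \<le> 1"
  by (erule cgramE) (simp add: gram_vectors_def cmod_sum_cnj_le)

text \<open>The two families are padded in different new coordinates, which leaves the mixed inner products unchanged.\<close>

lemma cgram_unit_vectors:
  assumes "cgram 1 M"
  obtains I :: "(nat + bool) set" and u v where "finite I" "\<And>i. (\<Sum>l\<in>I. (cmod (u i l))\<^sup>2) = 1"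
    "\<And>j. (\<Sum>l\<in>I. (cmod (v j l))\<^sup>2) = 1" "\<And>i j. M i j = (\<Sum>l\<in>I. u i l * cnj (v j l))"
proof -
  obtain I :: "nat set" and u v where "gram_vectors I u v 1 M" by (rule cgramE[OF assms(1)])
  note 1 = gram_vectorsD[OF this]
  define pad :: "bool \<Rightarrow> (nat \<Rightarrow> complex) \<Rightarrow> nat + bool \<Rightarrow> complex" where
    "pad e w = case_sum w (\<lambda>d. if d = e then of_real (sqrt (1 - (\<Sum>l\<in>I. (cmod (w l))\<^sup>2))) else 0)" for e w
  show ?thesis
  proof (rule that[of "I <+> UNIV" "\<lambda>i. pad True (u i)" "\<lambda>j. pad False (v j)"])
    show "(\<Sum>l\<in>I <+> UNIV. (cmod (pad True (u i) l))\<^sup>2) = 1" for i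
      using 1(1) 1(2)[of i] by (simp add: sum.Plus pad_def UNIV_bool)
    show "(\<Sum>l\<in>I <+> UNIV. (cmod (pad False (v j) l))\<^sup>2) = 1" for j
      using 1(1) 1(3)[of j] by (simp add: sum.Plus pad_def UNIV_bool)
    show "M i j = (\<Sum>l\<in>I <+> UNIV. pad True (u i) l * cnj (pad False (v j) l))" for i j
      using 1(1) by (simp add: sum.Plus pad_def UNIV_bool 1(4))
  qed (use 1 in auto)
qed

lemma bil_bound_h_complex_cgram:
  assumes "bil_bound m n a N"
    and "b \<in> borel_measurable borel" "c \<in> borel_measurable borel"
    and "AE z in lborel. cmod (b z) \<le> B" "0 \<le> B" and "AE z in lborel. cmod (c z) \<le> C" "0 \<le> C"
    and "cgram 1 M"
  shows "cmod (\<Sum>i<m. \<Sum>j<n. a i j * h_complex b c (M i j)) \<le> B * C * N"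
proof -
  obtain I :: "(nat + bool) set" and u v where M: "finite I" "\<And>i. (\<Sum>l\<in>I. (cmod (u i l))\<^sup>2) = 1"
    "\<And>j. (\<Sum>l\<in>I. (cmod (v j l))\<^sup>2) = 1" "\<And>i j. M i j = (\<Sum>l\<in>I. u i l * cnj (v j l))"
    by (rule cgram_unit_vectors[OF assms(8)]) blast
  show ?thesis
    unfolding M(4) by (rule bil_bound_h_complex[OF assms(1-7) M(1)]) (rule M)+
qed

subsection \<open>Absolutely monotone functions are power series with nonnegative coefficients\<close>

text \<open>Adjoin an element a and sort x and y by whether they contain it. The four signs leave g
  (insert a (x \<inter> y)) - g (x \<inter> y), one more difference. A quadratic form with weights
  (-1)^|x| is thus an iterated difference of order |S|.\<close>

lemma sum_Pow_inter:
  fixes g :: "'a set \<Rightarrow> real"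
  assumes "finite S"
  shows "(\<Sum>x\<in>Pow S. \<Sum>y\<in>Pow S. (-1) ^ card x * (-1) ^ card y * g (x \<inter> y)) =
    (\<Sum>z\<in>Pow S. (-1) ^ (card S + card z) * g z)"
  using assms
proof (induction S arbitrary: g rule: finite_induct)
  case (insert a S)
  have disj: "Pow S \<inter> insert a ` Pow S = {}" using insert.hyps by auto
  have inj: "inj_on (insert a) (Pow S)"
    using insert.hyps by (intro inj_onI) (metis Diff_insert_absorb PowD subsetD)
  have split: "(\<Sum>x\<in>Pow (insert a S). f x) = (\<Sum>x\<in>Pow S. f x + f (insert a x))" for f :: "'a set \<Rightarrow> real"
    unfolding Pow_insert
    using insert.hyps by (subst sum.union_disjoint) (auto simp: disj sum.reindex[OF inj] sum.distrib)
  have card: "card (insert a x) = Suc (card x)" if "x \<in> Pow S" for x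
    using that insert.hyps by (subst card_insert_disjoint) (auto intro: finite_subset)
  have int: "insert a x \<inter> y = x \<inter> y" "x \<inter> insert a y = x \<inter> y" "insert a x \<inter> insert a y = insert a (x \<inter> y)"
    if "x \<in> Pow S" "y \<in> Pow S" for x y
    using that insert.hyps by auto
  have "(\<Sum>x\<in>Pow (insert a S). \<Sum>y\<in>Pow (insert a S). (-1) ^ card x * (-1) ^ card y * g (x \<inter> y)) =
      (\<Sum>x\<in>Pow S. \<Sum>y\<in>Pow S. (-1) ^ card x * (-1) ^ card y * (g (insert a (x \<inter> y)) - g (x \<inter> y)))"
    unfolding split sum.distrib [symmetric]
    by (intro sum.cong refl) (simp add: card int algebra_simps)
  also have "\<dots> = (\<Sum>z\<in>Pow S. (-1) ^ (card S + card z) * (g (insert a z) - g z))"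
    by (rule insert.IH)
  also have "\<dots> = (\<Sum>z\<in>Pow (insert a S). (-1) ^ (card (insert a S) + card z) * g z)"
    unfolding split by (intro sum.cong refl) (use insert.hyps in \<open>simp add: card algebra_simps\<close>)
  finally show ?case .
qed simp

lemma sum_Pow_card:
  fixes f :: "nat \<Rightarrow> real"
  assumes "finite S"
  shows "(\<Sum>z\<in>Pow S. f (card z)) = (\<Sum>j\<le>card S. real (card S choose j) * f j)"
proof -
  have "(\<Sum>z\<in>Pow S. f (card z)) = (\<Sum>j\<le>card S. \<Sum>z\<in>{z \<in> Pow S. card z = j}. f (card z))"
    using assms by (intro sum.group [symmetric]) (auto intro: card_mono)
  also have "\<dots> = (\<Sum>j\<le>card S. real (card S choose j) * f j)"
  proof (intro sum.cong refl)
    fix j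
    have "(\<Sum>z\<in>{z \<in> Pow S. card z = j}. f (card z)) = (\<Sum>z\<in>{z. z \<subseteq> S \<and> card z = j}. f j)"
      by (intro sum.cong) auto
    then show "(\<Sum>z\<in>{z \<in> Pow S. card z = j}. f (card z)) = real (card S choose j) * f j"
      by (simp add: n_subsets[OF assms])
  qed
  finally show ?thesis .
qed

text \<open>The k-th forward difference of f at 0; the sign (-1)^(k + j) equals (-1)^(k - j) and
  avoids truncated subtraction.\<close>

definition fdiff :: "nat \<Rightarrow> (nat \<Rightarrow> real) \<Rightarrow> real" where
  "fdiff k f = (\<Sum>j\<le>k. real (k choose j) * ((-1) ^ (k + j) * f j))"

text \<open>Expanding (1 - x)^(n - j) and collecting powers of x shows that the coefficients of a
  Bernstein polynomial are binomials times forward differences, hence nonnegative when these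
  are.\<close>

lemma Bernstein_sum_eq:
  "(\<Sum>j\<le>n. f j * Bernstein n j x) = (\<Sum>k\<le>n. real (n choose k) * fdiff k f * x ^ k)"
proof -
  have B: "f j * Bernstein n j x =
      (\<Sum>i\<le>n - j. real (n choose j) * real ((n - j) choose i) * ((-1) ^ i * f j) * x ^ (i + j))"
    if "j \<le> n" for j
  proof -
    have "(1 - x) ^ (n - j) = (\<Sum>i\<le>n - j. real ((n - j) choose i) * (- x) ^ i * 1 ^ (n - j - i))"
      using binomial_ring[of "- x" 1 "n - j"] by simp
    then show ?thesis
      by (simp add: Bernstein_def sum_distrib_left sum_distrib_right power_add power_minus[of x] mult_ac)
  qed
  have "(\<Sum>j\<le>n. f j * Bernstein n j x) =
      (\<Sum>j\<le>n. \<Sum>i\<le>n - j. real (n choose j) * real ((n - j) choose i) * ((-1) ^ i * f j) * x ^ (i + j))"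
    by (intro sum.cong refl B) simp
  also have "\<dots> = (\<Sum>(j, i)\<in>{(j, i). j + i \<le> n}.
      real (n choose j) * real ((n - j) choose i) * ((-1) ^ i * f j) * x ^ (i + j))"
    by (subst sum.Sigma) (auto intro!: sum.cong)
  also have "\<dots> = (\<Sum>k\<le>n. \<Sum>j\<le>k. real (n choose j) * real ((n - j) choose (k - j)) * ((-1) ^ (k - j) * f j) * x ^ (k - j + j))"
    by (rule sum.triangle_reindex_eq)
  also have "\<dots> = (\<Sum>k\<le>n. real (n choose k) * fdiff k f * x ^ k)"
  proof (intro sum.cong refl)
    fix k assume k: "k \<in> {..n}"
    have eq: "real (n choose j) * real ((n - j) choose (k - j)) * ((-1) ^ (k - j) * f j) * x ^ (k - j + j) =
        real (n choose k) * (real (k choose j) * ((-1) ^ (k + j) * f j)) * x ^ k" if "j \<le> k" for j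
    proof -
      have "real (n choose j) * real ((n - j) choose (k - j)) = real (n choose k) * real (k choose j)"
        using choose_mult[of j k n] k that by (metis atMost_iff of_nat_mult)
      moreover have "(-1 :: real) ^ (k - j) = (-1) ^ (k + j)"
        using that by (intro minus_one_power_iff[THEN trans] minus_one_power_iff[THEN trans, symmetric]) simp
      ultimately show ?thesis using that by simp
    qed
    show "(\<Sum>j\<le>k. real (n choose j) * real ((n - j) choose (k - j)) * ((-1) ^ (k - j) * f j) * x ^ (k - j + j)) =
        real (n choose k) * fdiff k f * x ^ k"
      unfolding fdiff_def sum_distrib_left sum_distrib_right by (intro sum.cong refl eq) simp
  qed
  finally show ?thesis .
qed

lemma continuous_on_power_series_cball:
  fixes a :: "nat \<Rightarrow> 'a::{real_normed_field,banach}"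
  assumes "summable (\<lambda>n. norm (a n))"
  shows "continuous_on (cball 0 1) (\<lambda>z. \<Sum>n. a n * z ^ n)"
proof (rule uniform_limit_theorem)
  show "uniform_limit (cball 0 1) (\<lambda>n z. \<Sum>i<n. a i * z ^ i) (\<lambda>z. \<Sum>n. a n * z ^ n) sequentially"
    by (rule Weierstrass_m_test[OF _ assms])
      (auto simp: norm_mult norm_power intro!: mult_left_le power_le_one)
qed (auto intro!: always_eventually continuous_intros)

lemma summable_power_series_cball:
  fixes a :: "nat \<Rightarrow> 'a::{real_normed_field,banach}"
  assumes "summable (\<lambda>n. norm (a n))" "norm z \<le> 1"
  shows "summable (\<lambda>n. norm (a n * z ^ n))" "summable (\<lambda>n. a n * z ^ n)"
proof -
  show "summable (\<lambda>n. norm (a n * z ^ n))"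
    using assms by (intro summable_comparison_test'[OF assms(1)])
      (auto simp: norm_mult norm_power intro!: mult_left_le power_le_one)
  then show "summable (\<lambda>n. a n * z ^ n)" by (rule summable_norm_cancel)
qed

text \<open>A form of Bernstein's theorem. The Bernstein polynomials of h have nonnegative
  coefficients with sum h(1), so a diagonal subsequence converges coefficientwise. For x < 1 the
  majorant h(1) x^k permits passing to the limit inside the sum; since the limiting coefficients are
  summable, continuity of both sides settles x = 1.\<close>

theorem absolutely_monotone_power_series:
  fixes h :: "real \<Rightarrow> real"
  assumes cont: "continuous_on {0..1} h"
    and mono: "\<And>n k. 0 < n \<Longrightarrow> k \<le> n \<Longrightarrow> 0 \<le> fdiff k (\<lambda>j. h (real j / real n))"
  obtains c where "\<And>k. 0 \<le> c k" "summable c" "\<And>x. x \<in> {0..1} \<Longrightarrow> (\<lambda>k. c k * x ^ k) sums h x"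
proof -
  define p where "p n k = (if k \<le> n then real (n choose k) * fdiff k (\<lambda>j. h (real j / real n)) else 0)" for n k
  have p0: "0 \<le> p n k" if "0 < n" for n k
    using mono[OF that, of k] by (simp add: p_def)
  have P: "(\<Sum>j\<le>n. h (real j / real n) * Bernstein n j x) = (\<Sum>k\<le>n. p n k * x ^ k)" for n x
    unfolding Bernstein_sum_eq by (intro sum.cong) (auto simp: p_def)
  have P1: "(\<Sum>k\<le>n. p n k) = h 1" if "0 < n" for n
  proof -
    have "(\<Sum>k\<le>n. p n k) = (\<Sum>j\<le>n. h (real j / real n) * Bernstein n j 1)"
      using P[of n 1] by simp
    also have "\<dots> = (\<Sum>j\<in>{n}. h (real j / real n) * Bernstein n j 1)"
      by (rule sum.mono_neutral_right) (auto simp: Bernstein_def)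
    finally show ?thesis using that by (simp add: Bernstein_def)
  qed
  have pK: "(\<Sum>k<K. p n k) \<le> h 1" if "0 < n" for n K
  proof -
    have "(\<Sum>k<K. p n k) \<le> (\<Sum>k\<in>{..<K} \<union> {..n}. p n k)"
      by (rule sum_mono2) (use p0 that in auto)
    also have "\<dots> = (\<Sum>k\<le>n. p n k)"
      by (rule sum.mono_neutral_right) (auto simp: p_def)
    finally show ?thesis using P1[OF that] by simp
  qed
  have p1: "p n k \<le> h 1" if "0 < n" for n k
    using pK[OF that, of "Suc k"] sum_nonneg[of "{..<k}" "p n"] p0[OF that] by simp
  \<comment> \<open>\<open>Suc\<close> skips the index 0, about which \<open>mono\<close> says
    nothing.\<close>
  obtain s :: "nat \<Rightarrow> nat" where s: "strict_mono s" and "\<And>k. k \<in> UNIV \<Longrightarrow> \<exists>l. (\<lambda>n. p (Suc (s n)) k) \<longlonglongrightarrow> l"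
    by (rule function_convergent_subsequence[of "UNIV :: nat set" "\<lambda>n. p (Suc n)" "h 1"])
      (use p0 p1 in auto)
  then obtain c where c: "\<And>k. (\<lambda>n. p (Suc (s n)) k) \<longlonglongrightarrow> c k" by (metis UNIV_I)
  have c0: "0 \<le> c k" for k
    by (rule LIMSEQ_le_const[OF c]) (use p0 in auto)
  have "(\<Sum>k<K. c k) \<le> h 1" for K
  proof (rule LIMSEQ_le_const2)
    show "(\<lambda>n. \<Sum>k<K. p (Suc (s n)) k) \<longlonglongrightarrow> (\<Sum>k<K. c k)" by (intro tendsto_sum c)
  qed (use pK in auto)
  then have sum: "summable c"
    using c0 by (intro summableI_nonneg_bounded)
  have h_lt: "(\<Sum>k. c k * x ^ k) = h x" if x: "x \<in> {0..<1}" for x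
  proof -
    have "(\<lambda>n. \<Sum>k. p (Suc (s n)) k * x ^ k) \<longlonglongrightarrow> (\<Sum>k. c k * x ^ k)"
    proof (rule tannerys_theorem[of "\<lambda>k n. p (Suc (s n)) k * x ^ k" _ _ "\<lambda>k. h 1 * x ^ k",
          THEN conjunct2, THEN conjunct2])
      show "(\<lambda>n. p (Suc (s n)) k * x ^ k) \<longlonglongrightarrow> c k * x ^ k" for k
        by (intro tendsto_intros c)
      show "\<forall>\<^sub>F (k, n) in at_top \<times>\<^sub>F sequentially. norm (p (Suc (s n)) k * x ^ k) \<le> h 1 * x ^ k"
        using x p0 p1 by (intro always_eventually) (auto simp: abs_mult intro!: mult_right_mono)
      show "summable (\<lambda>k. h 1 * x ^ k)"
        using x by (intro summable_mult summable_geometric) auto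
    qed simp
    moreover have "(\<Sum>k. p (Suc (s n)) k * x ^ k) = (\<Sum>j\<le>Suc (s n). h (real j / real (Suc (s n))) * Bernstein (Suc (s n)) j x)" for n
      unfolding P by (rule suminf_finite) (auto simp: p_def)
    ultimately have 1: "(\<lambda>n. \<Sum>j\<le>Suc (s n). h (real j / real (Suc (s n))) * Bernstein (Suc (s n)) j x) \<longlonglongrightarrow> (\<Sum>k. c k * x ^ k)"
      by simp
    have "(\<lambda>n. \<Sum>j\<le>n. h (real j / real n) * Bernstein n j x) \<longlonglongrightarrow> h x"
    proof (rule LIMSEQ_I)
      fix e :: real assume "e > 0"
      from Bernstein_Weierstrass[OF cont this]
      show "\<exists>N. \<forall>n\<ge>N. norm ((\<Sum>j\<le>n. h (real j / real n) * Bernstein n j x) - h x) < e"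
        using x by (fastforce simp: abs_minus_commute)
    qed
    moreover have "strict_mono (\<lambda>n. Suc (s n))"
      using s by (simp add: strict_mono_def)
    ultimately have "(\<lambda>n. \<Sum>j\<le>Suc (s n). h (real j / real (Suc (s n))) * Bernstein (Suc (s n)) j x) \<longlonglongrightarrow> h x"
      by (rule LIMSEQ_subseq_LIMSEQ[unfolded o_def])
    with 1 show ?thesis by (rule LIMSEQ_unique)
  qed
  have nsum: "summable (\<lambda>k. norm (c k))" using sum c0 by simp
  have h_eq: "(\<Sum>k. c k * x ^ k) = h x" if x: "x \<in> {0..1}" for x
  proof (cases "x = 1")
    case True
    have "continuous_on {0..1} (\<lambda>x. (\<Sum>k. c k * x ^ k) - h x)"
      using continuous_on_power_series_cball[OF nsum]
      by (intro continuous_intros cont) (auto elim!: continuous_on_subset)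
    then have "((\<lambda>x. (\<Sum>k. c k * x ^ k) - h x) \<longlongrightarrow> (\<Sum>k. c k * 1 ^ k) - h 1) (at 1 within {0..1})"
      unfolding continuous_on_def by (rule bspec) simp
    then have "((\<lambda>x. (\<Sum>k. c k * x ^ k) - h x) \<longlongrightarrow> (\<Sum>k. c k * 1 ^ k) - h 1) (at 1 within {0..<1})"
      by (rule tendsto_within_subset) auto
    moreover have "eventually (\<lambda>x. (\<Sum>k. c k * x ^ k) - h x = 0) (at 1 within {0..<1})"
      unfolding eventually_at_filter
    proof (intro always_eventually allI impI)
      fix x :: real assume "x \<in> {0..<1}"
      from h_lt[OF this] show "(\<Sum>k. c k * x ^ k) - h x = 0" by simp
    qed
    ultimately have "((\<lambda>x::real. 0) \<longlongrightarrow> (\<Sum>k. c k * 1 ^ k) - h 1) (at 1 within {0..<1})"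
      by (rule Lim_transform_eventually)
    moreover have "at 1 within {0..<1} \<noteq> (bot :: real filter)"
      by (simp add: at_within_eq_bot_iff)
    ultimately have "(\<Sum>k. c k * 1 ^ k) - h 1 = 0"
      by (intro tendsto_unique[OF _ _ tendsto_const])
    then show ?thesis using True by simp
  qed (use h_lt x in auto)
  show ?thesis
    by (rule that[OF c0 sum]) (use h_eq summable_power_series_cball(2)[OF nsum] in \<open>auto simp: sums_iff\<close>)
qed

subsection \<open>The correlation function is absolutely monotone\<close>

text \<open>The form is the second moment of a linear combination of the b(Z_u). Its sign gives
  positive semidefiniteness; its explicit shape is used where the form vanishes, since then the
  combination is zero almost surely.\<close>

lemma h_complex_quadratic:
  fixes b :: "complex^'k \<Rightarrow> complex" and u :: "'t \<Rightarrow> 'i \<Rightarrow> complex" and w :: "'t \<Rightarrow> real"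
  assumes b[measurable]: "b \<in> borel_measurable borel" and B: "AE z in lborel. cmod (b z) \<le> B" "0 \<le> B"
    and I: "finite I" and T: "finite T" and u: "\<And>t. t \<in> T \<Longrightarrow> (\<Sum>l\<in>I. (cmod (u t l))\<^sup>2) = 1"
  shows "(\<Sum>s\<in>T. \<Sum>t\<in>T. of_real (w s) * of_real (w t) * h_complex b b (\<Sum>l\<in>I. u s l * cnj (u t l))) =
      complex_of_real (\<integral>\<omega>. (cmod (\<Sum>t\<in>T. of_real (w t) * b (gcomb I (u t) \<omega>)))\<^sup>2 \<partial>gproc I)"
    "integrable (gproc I) (\<lambda>\<omega>. (cmod (\<Sum>t\<in>T. of_real (w t) * b (gcomb I (u t) \<omega>)))\<^sup>2)"
proof -
  interpret prob_space "gproc I :: ('i \<Rightarrow> complex^'k) measure" by (rule prob_space_gproc)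
  define X where "X t \<omega> = of_real (w t) * b (gcomb I (u t) \<omega>)" for t and \<omega> :: "'i \<Rightarrow> complex^'k"
  have [measurable]: "X t \<in> borel_measurable (gproc I)" for t
    unfolding X_def by measurable
  have X: "AE \<omega> in gproc I. cmod (X t \<omega>) \<le> \<bar>w t\<bar> * B" if "t \<in> T" for t
    using AE_gcomb[OF I u[OF that] B(1)]
    by eventually_elim (auto simp: X_def norm_mult intro!: mult_left_mono)
  have int: "integrable (gproc I) (\<lambda>\<omega>. X s \<omega> * cnj (X t \<omega>))" if "s \<in> T" "t \<in> T" for s t
    by (rule integrable_mult_bounded[OF _ _ X[OF that(1)] X[OF that(2), folded complex_mod_cnj[of "X t _"]]])
      measurable
  have "(\<Sum>s\<in>T. \<Sum>t\<in>T. of_real (w s) * of_real (w t) * h_complex b b (\<Sum>l\<in>I. u s l * cnj (u t l))) =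
      (\<Sum>s\<in>T. \<Sum>t\<in>T. \<integral>\<omega>. X s \<omega> * cnj (X t \<omega>) \<partial>gproc I)"
  proof (intro sum.cong refl)
    fix s t assume st: "s \<in> T" "t \<in> T"
    have "(\<integral>\<omega>. X s \<omega> * cnj (X t \<omega>) \<partial>gproc I) =
        (\<integral>\<omega>. (of_real (w s) * of_real (w t)) * (b (gcomb I (u s) \<omega>) * cnj (b (gcomb I (u t) \<omega>))) \<partial>gproc I)"
      by (simp add: X_def mult_ac)
    then show "of_real (w s) * of_real (w t) * h_complex b b (\<Sum>l\<in>I. u s l * cnj (u t l)) =
        (\<integral>\<omega>. X s \<omega> * cnj (X t \<omega>) \<partial>gproc I)"
      using h_complex_gcomb[OF b b I u[OF st(1)] u[OF st(2)]] by simp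
  qed
  also have "\<dots> = (\<Sum>s\<in>T. \<integral>\<omega>. (\<Sum>t\<in>T. X s \<omega> * cnj (X t \<omega>)) \<partial>gproc I)"
    by (intro sum.cong refl Bochner_Integration.integral_sum [symmetric] int) auto
  also have "\<dots> = (\<integral>\<omega>. (\<Sum>s\<in>T. \<Sum>t\<in>T. X s \<omega> * cnj (X t \<omega>)) \<partial>gproc I)"
    by (intro Bochner_Integration.integral_sum [symmetric] Bochner_Integration.integrable_sum int) auto
  also have "\<dots> = (\<integral>\<omega>. complex_of_real ((cmod (\<Sum>s\<in>T. X s \<omega>))\<^sup>2) \<partial>gproc I)"
    by (simp only: complex_norm_square cnj_sum sum_product)
  also have "\<dots> = complex_of_real (\<integral>\<omega>. (cmod (\<Sum>s\<in>T. X s \<omega>))\<^sup>2 \<partial>gproc I)"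
    by (rule integral_complex_of_real)
  finally show "(\<Sum>s\<in>T. \<Sum>t\<in>T. of_real (w s) * of_real (w t) * h_complex b b (\<Sum>l\<in>I. u s l * cnj (u t l))) =
      complex_of_real (\<integral>\<omega>. (cmod (\<Sum>t\<in>T. of_real (w t) * b (gcomb I (u t) \<omega>)))\<^sup>2 \<partial>gproc I)"
    by (simp add: X_def)
  have "integrable (gproc I) (\<lambda>\<omega>. Re (\<Sum>s\<in>T. \<Sum>t\<in>T. X s \<omega> * cnj (X t \<omega>)))"
    by (intro integrable_Re Bochner_Integration.integrable_sum int)
  moreover have "Re (\<Sum>s\<in>T. \<Sum>t\<in>T. X s \<omega> * cnj (X t \<omega>)) = (cmod (\<Sum>t\<in>T. X t \<omega>))\<^sup>2" for \<omega>
  proof -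
    have "(\<Sum>s\<in>T. \<Sum>t\<in>T. X s \<omega> * cnj (X t \<omega>)) = complex_of_real ((cmod (\<Sum>t\<in>T. X t \<omega>))\<^sup>2)"
      by (simp only: complex_norm_square cnj_sum sum_product)
    then show ?thesis by simp
  qed
  ultimately show "integrable (gproc I) (\<lambda>\<omega>. (cmod (\<Sum>t\<in>T. of_real (w t) * b (gcomb I (u t) \<omega>)))\<^sup>2)"
    by (simp add: X_def)
qed

corollary h_complex_psd:
  fixes b :: "complex^'k \<Rightarrow> complex" and u :: "'t \<Rightarrow> 'i \<Rightarrow> complex" and w :: "'t \<Rightarrow> real"
  assumes "b \<in> borel_measurable borel" and "AE z in lborel. cmod (b z) \<le> B" "0 \<le> B"
    and "finite I" and "finite T" and "\<And>t. t \<in> T \<Longrightarrow> (\<Sum>l\<in>I. (cmod (u t l))\<^sup>2) = 1"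
  shows "0 \<le> Re (\<Sum>s\<in>T. \<Sum>t\<in>T. of_real (w s) * of_real (w t) * h_complex b b (\<Sum>l\<in>I. u s l * cnj (u t l)))"
  using h_complex_quadratic(1)[OF assms, where w=w] by simp


text \<open>The vectors are indicator functions of subsets of \<open>{..<k}\<close>, scaled by \<open>1 / sqrt n\<close> and completed to
  unit vectors.  Every vector occurs in \<open>R\<close> copies with orthogonal completions, so that the wrong diagonal
  terms are negligible as \<open>R\<close> grows.\<close>

lemma fdiff_h_complex_nonneg:
  fixes b :: "complex^'k \<Rightarrow> complex"
  assumes b: "b \<in> borel_measurable borel" and B: "AE z in lborel. cmod (b z) \<le> B" "0 \<le> B"
    and n: "0 < n" "k \<le> n"
  shows "0 \<le> fdiff k (\<lambda>j. Re (h_complex b b (of_real (real j / real n))))"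
proof -
  define g where "g x = Re (h_complex b b (of_real x))" for x :: real
  define S where "S = {..<k}"
  define w :: "nat set \<Rightarrow> real" where "w x = (-1) ^ card x" for x
  define d where "d x = sqrt (1 - real (card x) / real n)" for x :: "nat set"
  \<comment> \<open>\<open>S0\<close> is the form wanted, because scaled indicator vectors have
    inner product |x \<inter> y| / n. \<open>D\<close> is the form with the inner products of the
    completions added, as they occur between copies with the same number: R pairs of copies
    contribute \<open>D\<close> and the other R^2 - R contribute \<open>S0\<close>.\<close>
  define S0 where "S0 = (\<Sum>x\<in>Pow S. \<Sum>y\<in>Pow S. w x * w y * g (real (card (x \<inter> y)) / real n))"
  define D where "D = (\<Sum>x\<in>Pow S. \<Sum>y\<in>Pow S. w x * w y * g (real (card (x \<inter> y)) / real n + d x * d y))"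
  have card_le: "real (card x) \<le> real n" if "x \<in> Pow S" for x
    using that n card_mono[of S x] by (auto simp: S_def)
  have ineq: "0 \<le> real R * D + (real R * real R - real R) * S0" for R :: nat
  proof -
    let ?T = "Pow S \<times> {..<R}" and ?I = "S <+> {..<R}"
    let ?q = "\<lambda>x y i j. real (card (x \<inter> y)) / real n + (if i = j then d x * d y else 0)"
    let ?e = "complex_of_real (1 / sqrt (real n))"
    define u :: "nat set \<times> nat \<Rightarrow> nat + nat \<Rightarrow> complex" where
      "u t = case_sum (\<lambda>l. if l \<in> fst t then ?e else 0)
        (\<lambda>j. if j = snd t then of_real (d (fst t)) else 0)" for t
    have u: "u (x, i) = case_sum (\<lambda>l. if l \<in> x then ?e else 0)
        (\<lambda>j. if j = i then of_real (d x) else 0)" for x i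
      unfolding u_def fst_conv snd_conv ..
    have fin: "finite (?I)" by (simp add: S_def)
    have inner: "(\<Sum>l\<in>?I. u (x, i) l * cnj (u (y, j) l)) =
        of_real (?q x y i j)"
      if "x \<in> Pow S" "y \<in> Pow S" "i < R" "j < R" for x y i j
    proof -
      have "(\<Sum>l\<in>S. (if l \<in> x then ?e else 0) *
          cnj (if l \<in> y then ?e else 0)) =
          (\<Sum>l\<in>S. if l \<in> x \<inter> y then complex_of_real (1 / real n) else 0)"
        using n by (intro sum.cong refl) (simp flip: of_real_mult)
      also have "\<dots> = (\<Sum>l\<in>x \<inter> y. complex_of_real (1 / real n))"
        using that by (intro sum.mono_neutral_cong_right) (auto simp: S_def)
      finally have 1: "(\<Sum>l\<in>S. (if l \<in> x then ?e else 0) *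
          cnj (if l \<in> y then ?e else 0)) = of_real (real (card (x \<inter> y)) / real n)"
        by simp
      have 2: "(\<Sum>l<R. (if l = i then complex_of_real (d x) else 0) * cnj (if l = j then complex_of_real (d y) else 0)) =
          of_real (if i = j then d x * d y else 0)"
        using that by (auto simp: if_distrib[of cnj] if_distrib[of "\<lambda>a. a * _"] if_distrib[of "\<lambda>a. _ * a"] cong: if_cong)
      show ?thesis
        using fin by (simp add: u sum.Plus S_def 1[unfolded S_def] 2)
    qed
    have unit: "(\<Sum>l\<in>?I. (cmod (u t l))\<^sup>2) = 1" if tT: "t \<in> ?T" for t
    proof -
      obtain x i where t: "t = (x, i)" "x \<in> Pow S" "i < R" using tT by (cases t) auto
      have "complex_of_real (\<Sum>l\<in>?I. (cmod (u t l))\<^sup>2) = (\<Sum>l\<in>?I. u (x, i) l * cnj (u (x, i) l))"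
        unfolding t(1) of_real_sum by (simp only: complex_norm_square)
      also have "\<dots> = of_real (real (card x) / real n + d x * d x)"
        using inner[OF t(2,2,3,3)] by simp
      also have "real (card x) / real n + d x * d x = 1"
        using card_le[OF t(2)] n by (simp add: d_def divide_le_eq)
      finally show ?thesis by (simp only: of_real_eq_iff)
    qed
    have finT: "finite (?T)" by (simp add: S_def)
    have "0 \<le> Re (\<Sum>s\<in>?T. \<Sum>t\<in>?T. of_real (w (fst s)) * of_real (w (fst t)) *
        h_complex b b (\<Sum>l\<in>?I. u s l * cnj (u t l)))"
      by (rule h_complex_psd[OF b B fin finT unit])
    also have "\<dots> = (\<Sum>s\<in>?T. \<Sum>t\<in>?T. w (fst s) * w (fst t) *
        g (?q (fst s) (fst t) (snd s) (snd t)))"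
      unfolding Re_sum
    proof (intro sum.cong refl)
      fix s t assume "s \<in> ?T" "t \<in> ?T"
      then have i: "(\<Sum>l\<in>?I. u s l * cnj (u t l)) =
        of_real (?q (fst s) (fst t) (snd s) (snd t))"
        using inner[of "fst s" "fst t" "snd s" "snd t"] by auto
      show "Re (of_real (w (fst s)) * of_real (w (fst t)) * h_complex b b (\<Sum>l\<in>?I. u s l * cnj (u t l))) =
          w (fst s) * w (fst t) *
        g (?q (fst s) (fst t) (snd s) (snd t))"
        unfolding i g_def by (simp flip: of_real_mult)
    qed
    also have "\<dots> = (\<Sum>x\<in>Pow S. \<Sum>i<R. \<Sum>y\<in>Pow S. \<Sum>j<R. w x * w y *
        g (?q x y i j))"
      by (simp only: sum.cartesian_product' fst_conv snd_conv)
    also have "\<dots> = (\<Sum>x\<in>Pow S. \<Sum>y\<in>Pow S. \<Sum>i<R. \<Sum>j<R. w x * w y *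
        g (?q x y i j))"
      by (intro sum.cong refl sum.swap)
    also have "\<dots> = (\<Sum>x\<in>Pow S. \<Sum>y\<in>Pow S. real R * (w x * w y * g (real (card (x \<inter> y)) / real n + d x * d y)) +
        (real R * real R - real R) * (w x * w y * g (real (card (x \<inter> y)) / real n)))"
    proof (intro sum.cong refl)
      fix x y
      define P where "P = w x * w y * g (real (card (x \<inter> y)) / real n + d x * d y)"
      define Q where "Q = w x * w y * g (real (card (x \<inter> y)) / real n)"
      have "(\<Sum>i<R. \<Sum>j<R. w x * w y * g (?q x y i j)) =
          (\<Sum>i<R. \<Sum>j<R. Q + (if i = j then P - Q else 0))"
        by (intro sum.cong refl) (auto simp: P_def Q_def)
      also have "\<dots> = real R * P + (real R * real R - real R) * Q"
        by (simp add: sum.distrib algebra_simps)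
      finally show "(\<Sum>i<R. \<Sum>j<R. w x * w y * g (?q x y i j)) =
        real R * P + (real R * real R - real R) * Q" .
    qed
    also have "\<dots> = real R * D + (real R * real R - real R) * S0"
      by (simp add: D_def S0_def sum.distrib sum_distrib_left)
    finally show ?thesis .
  qed
  have "0 \<le> S0"
  proof (rule ccontr)
    assume "\<not> 0 \<le> S0"
    then have neg: "S0 < 0" by simp
    \<comment> \<open>With R' = R + 1 copies the total R' (D + (R' - 1) S0) is negative, against
      \<open>ineq\<close>.\<close>
    obtain R :: nat where R: "(D / - S0) + 1 < real R" using reals_Archimedean2 by blast
    define R' where "R' = Suc R"
    have "D / - S0 < real R' - 1" "0 < real R'" using R by (auto simp: R'_def)
    then have "D + (real R' - 1) * S0 < 0"
      using neg by (simp add: divide_less_eq field_simps)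
    then have "real R' * (D + (real R' - 1) * S0) < 0"
      using \<open>0 < real R'\<close> by (rule mult_pos_neg[rotated])
    with ineq[of R'] show False by (simp add: algebra_simps)
  qed
  also have "S0 = (\<Sum>z\<in>Pow S. (-1) ^ (card S + card z) * g (real (card z) / real n))"
    unfolding S0_def w_def by (rule sum_Pow_inter) (simp add: S_def)
  also have "\<dots> = fdiff k (\<lambda>j. g (real j / real n))"
    unfolding fdiff_def using sum_Pow_card[of S "\<lambda>j. (-1) ^ (k + j) * g (real j / real n)"]
    by (simp add: S_def)
  finally show ?thesis by (simp add: g_def)
qed

subsection \<open>Power series near the origin\<close>

lemma deriv_power_series_at_0:
  fixes f :: "real \<Rightarrow> real"
  assumes "e > 0" "\<And>y. \<bar>y\<bar> < e \<Longrightarrow> (\<lambda>n. a n * y ^ n) sums f y"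
  shows "(deriv ^^ n) f 0 = fact n * a n"
  using assms(2)
proof (induction n arbitrary: f a)
  case 0
  from sums_unique2[OF powser_sums_zero 0[of 0]] assms(1) show ?case by simp
next
  case (Suc n)
  have sm: "summable (\<lambda>n. a n * y ^ n)" if "norm y < e" for y
    using Suc.prems[of y] that by (auto intro: sums_summable)
  have "(\<lambda>n. diffs a n * y ^ n) sums deriv f y" if y: "\<bar>y\<bar> < e" for y
  proof -
    have "((\<lambda>z. \<Sum>n. a n * z ^ n) has_field_derivative (\<Sum>n. diffs a n * y ^ n)) (at y)"
      by (rule termdiffs_strong'[OF sm]) (use y in auto)
    then have "(f has_field_derivative (\<Sum>n. diffs a n * y ^ n)) (at y)"
      by (rule has_field_derivative_transform_within_open[where S="ball 0 e"])
        (use y Suc.prems in \<open>auto simp: sums_iff\<close>)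
    then have "deriv f y = (\<Sum>n. diffs a n * y ^ n)" by (rule DERIV_imp_deriv)
    moreover have "summable (\<lambda>n. diffs a n * y ^ n)"
      by (rule termdiff_converges[OF _ sm]) (use y in auto)
    ultimately show ?thesis by (simp add: summable_sums)
  qed
  from Suc.IH[OF this] show ?case
    by (simp add: funpow_Suc_right diffs_def mult_ac del: funpow.simps)
qed

lemma real_analytic_at_0:
  assumes "\<psi> real_analytic_on {-r<..<r}" "r > 0"
  shows "\<exists>e>0. \<exists>\<alpha>. \<forall>y. \<bar>y\<bar> < e \<longrightarrow> (\<lambda>n. \<alpha> n * y ^ n) sums \<psi> y"
  using bspec[OF assms(1)[unfolded real_analytic_on_def], of 0] assms(2) by simp

text \<open>f(y) = -f(-y) has two expansions at 0, and the derivatives determine the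
  coefficients.\<close>

lemma odd_power_series_even_coeff:
  fixes f :: "real \<Rightarrow> real"
  assumes e: "e > 0" "\<And>y. \<bar>y\<bar> < e \<Longrightarrow> (\<lambda>n. a n * y ^ n) sums f y"
    and odd: "\<And>y. \<bar>y\<bar> < e \<Longrightarrow> f (- y) = - f y" and n: "even n"
  shows "a n = 0"
proof -
  have "(\<lambda>n. (- ((-1) ^ n * a n)) * y ^ n) sums f y" if "\<bar>y\<bar> < e" for y
    using sums_minus[OF e(2)[of "- y"]] odd[OF that] that
    by (simp add: power_minus[of y] mult_ac)
  from deriv_power_series_at_0[OF e(1) this, of n] deriv_power_series_at_0[OF e, of n] n
  show ?thesis by simp
qed

lemma power_series_strict_mono:
  fixes c :: "nat \<Rightarrow> real"
  assumes c: "\<And>k. 0 \<le> c k" "summable c" "0 < c i" "0 < i" and xy: "0 \<le> x" "x < y" "y \<le> 1"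
  shows "(\<Sum>k. c k * x ^ k) < (\<Sum>k. c k * y ^ k)"
proof -
  have n: "summable (\<lambda>k. norm (c k))" using c(1,2) by simp
  have sm: "summable (\<lambda>k. c k * x ^ k)" "summable (\<lambda>k. c k * y ^ k)"
    using summable_power_series_cball(2)[OF n] xy by auto
  have "0 < (\<Sum>k. c k * y ^ k - c k * x ^ k)"
  proof (rule suminf_pos2[where i=i])
    show "summable (\<lambda>k. c k * y ^ k - c k * x ^ k)" using sm by (intro summable_diff)
    show "0 \<le> c k * y ^ k - c k * x ^ k" for k
      using c(1)[of k] power_mono[of x y k] xy by (simp add: mult_left_mono)
    show "0 < c i * y ^ i - c i * x ^ i"
      using c(3,4) power_strict_mono[of x y i] xy by simp
  qed
  then show ?thesis using sm by (simp add: suminf_diff [symmetric])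
qed

lemma odd_strict_mono:
  fixes f :: "real \<Rightarrow> real"
  assumes mono: "\<And>x y. 0 \<le> x \<Longrightarrow> x < y \<Longrightarrow> y \<le> 1 \<Longrightarrow> f x < f y"
    and odd: "\<And>x. x \<in> {-1..1} \<Longrightarrow> f (- x) = - f x" and xy: "-1 \<le> x" "x < y" "y \<le> 1"
  shows "f x < f y"
proof -
  have f0: "f 0 = 0" using odd[of 0] by simp
  consider "0 \<le> x" | "y \<le> 0" | "x < 0" "0 < y" by linarith
  then show ?thesis
  proof cases
    case 1 then show ?thesis using mono xy by simp
  next
    case 2
    then have "f (- y) < f (- x)" using mono xy by simp
    then show ?thesis using odd[of x] odd[of y] xy 2 by simp
  next
    case 3
    then have "f 0 < f (- x)" "f 0 < f y" using mono xy by simp_all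
    then show ?thesis using odd[of x] xy 3 f0 by simp
  qed
qed

lemma inj_on_strict_mono:
  fixes f :: "real \<Rightarrow> real"
  assumes "\<And>x y. -1 \<le> x \<Longrightarrow> x < y \<Longrightarrow> y \<le> 1 \<Longrightarrow> f x < f y"
  shows "inj_on f {-1..1}"
proof (rule inj_onI)
  fix x y assume "x \<in> {-1..1}" "y \<in> {-1..1}" "f x = f y"
  then show "x = y" using assms[of x y] assms[of y x] by (cases x y rule: linorder_cases) auto
qed

lemma continuous_on_eq_at_endpoint:
  fixes f :: "real \<Rightarrow> 'a::t1_space"
  assumes "continuous_on {0..s} f" "\<And>x. x \<in> {0..<s} \<Longrightarrow> f x = a" "0 < s"
  shows "f s = a"
  using continuous_constant_on_closure[of "{0..<s}" f a s] assms by simp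

lemma holomorphic_eq_on_ball_of_real:
  assumes f: "f holomorphic_on ball 0 s" and g: "g holomorphic_on ball 0 s" and d: "0 < d" "d \<le> s"
    and eq: "\<And>x. 0 < x \<Longrightarrow> x < d \<Longrightarrow> f (complex_of_real x) = g (complex_of_real x)" and w: "cmod w < s"
  shows "f w = g w"
proof -
  have "f w - g w = 0"
  proof (rule analytic_continuation[where f="\<lambda>z. f z - g z" and S="ball 0 s" and U="complex_of_real ` {0<..<d}" and \<xi>=0])
    show "(0::complex) islimpt complex_of_real ` {0<..<d}"
      unfolding islimpt_approachable
    proof (intro allI impI)
      fix e :: real assume "e > 0"
      then have x: "min e d / 2 \<in> {0<..<d}" "min e d / 2 < e" using d by auto
      show "\<exists>x'\<in>complex_of_real ` {0<..<d}. x' \<noteq> 0 \<and> dist x' 0 < e"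
        by (rule bexI[OF _ imageI[OF x(1)]]) (use x in \<open>auto simp del: of_real_divide\<close>)
    qed
    show "complex_of_real ` {0<..<d} \<subseteq> ball 0 s" using d by auto
  qed (use f g d eq w in \<open>auto intro!: holomorphic_intros\<close>)
  then show ?thesis by simp
qed

subsection \<open>Odd functions with nonnegative Taylor coefficients and their inverses\<close>

text \<open>The analytic half of the argument, free of probability. \<open>c_sums\<close> encodes h
  1 = 1; the expansion is assumed on [0,1] only, because nonnegative differences at 0 say nothing
  about negative arguments.\<close>

locale odd_corr =
  fixes h :: "real \<Rightarrow> real" and c :: "nat \<Rightarrow> real"
  assumes c_nonneg: "0 \<le> c k" and c_sums: "c sums 1"
    and h_sums: "x \<in> {0..1} \<Longrightarrow> (\<lambda>k. c k * x ^ k) sums h x"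
    and h_odd: "x \<in> {-1..1} \<Longrightarrow> h (- x) = - h x"
    and W: "the_inv_into {-1..1} h \<in> W_plus 1"
begin

definition "\<phi> = the_inv_into {-1..1} h"
definition "a n = (deriv ^^ n) \<phi> 0 / fact n"
abbreviation "F \<equiv> abs_series \<phi>"
definition "hyp = the_inv_into {-1..1} F"
text \<open>\<open>T\<close> and \<open>C\<close> continue \<phi> and \<open>h\<close> to the
  complex unit disc, where the identity theorem can compare \<open>T (C z)\<close> and
  \<open>C (T z)\<close> with z.\<close>

definition "T z = (\<Sum>n. complex_of_real (a n) * z ^ n)"
definition "C z = (\<Sum>n. complex_of_real (c n) * z ^ n)"

lemma summable_c: "summable c" "summable (\<lambda>n. norm (c n))"
  using c_sums c_nonneg by (auto intro: sums_summable)

lemma summable_cc: "summable (\<lambda>n. norm (complex_of_real (c n)))"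
  using summable_c(2) by simp

lemma h0: "h 0 = 0"
  using h_odd[of 0] by simp

lemma h1: "h 1 = 1"
  using h_sums[of 1] c_sums by (simp add: sums_iff)

lemma c0: "c 0 = 0"
  using sums_unique2[OF powser_sums_zero h_sums[of 0]] h0 by simp

lemma h_eq: "x \<in> {0..1} \<Longrightarrow> h x = (\<Sum>k. c k * x ^ k)"
  using h_sums by (simp add: sums_iff)

lemma h_strict_mono_nonneg: "0 \<le> x \<Longrightarrow> x < y \<Longrightarrow> y \<le> 1 \<Longrightarrow> h x < h y"
proof -
  assume xy: "0 \<le> x" "x < y" "y \<le> 1"
  have "\<exists>i. c i \<noteq> 0"
  proof (rule ccontr)
    assume "\<nexists>i. c i \<noteq> 0"
    then have c: "c = (\<lambda>_. 0)" by auto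
    from sums_unique2[OF c_sums[unfolded c] sums_zero] show False by simp
  qed
  then obtain i where i: "c i \<noteq> 0" by blast
  have "0 < c i" using c_nonneg[of i] i by linarith
  moreover have "0 < i" using i c0 by (cases i) auto
  ultimately have "0 < c i" "0 < i" by auto
  from power_series_strict_mono[OF c_nonneg summable_c(1) this xy]
  show "h x < h y" using xy by (simp add: h_eq)
qed

lemma h_strict_mono: "-1 \<le> x \<Longrightarrow> x < y \<Longrightarrow> y \<le> 1 \<Longrightarrow> h x < h y"
  by (rule odd_strict_mono[where f=h, OF h_strict_mono_nonneg h_odd])

lemma h_inj: "inj_on h {-1..1}"
  by (rule inj_on_strict_mono) (rule h_strict_mono)

lemma h_cont: "continuous_on {0..1} h"
proof -
  have "continuous_on {0..1} (\<lambda>x. \<Sum>k. c k * x ^ k)"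
    by (rule continuous_on_subset[OF continuous_on_power_series_cball[OF summable_c(2)]]) auto
  then show ?thesis by (rule continuous_on_eq) (simp add: h_eq)
qed

lemma h_mono: "-1 \<le> x \<Longrightarrow> x \<le> y \<Longrightarrow> y \<le> 1 \<Longrightarrow> h x \<le> h y"
  using h_strict_mono[of x y] by (cases "x = y") auto

lemma h_nonneg: "x \<in> {0..1} \<Longrightarrow> h x \<in> {0..1}"
  using h_mono[of 0 x] h_mono[of x 1] by (simp add: h0 h1)

lemma h_surj_nonneg: "y \<in> {0..1} \<Longrightarrow> \<exists>x\<in>{0..1}. h x = y"
  using IVT'[of h 0 y 1] h_cont by (auto simp: h0 h1)

lemma h_image: "h ` {-1..1} = {-1..1}"
proof (intro equalityI subsetI)
  fix y assume "y \<in> h ` {-1..1}"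
  then show "y \<in> {-1..1}"
    using h_mono[of "-1"] h_mono[of _ 1] h_odd[of 1] by (auto simp: h1)
next
  fix y :: real assume y: "y \<in> {-1..1}"
  show "y \<in> h ` {-1..1}"
  proof (cases "0 \<le> y")
    case True
    then show ?thesis using h_surj_nonneg[of y] y by force
  next
    case False
    then obtain x where "x \<in> {0..1}" "h x = - y" using h_surj_nonneg[of "- y"] y by auto
    then show ?thesis using h_odd[of x] by (intro image_eqI[of _ _ "- x"]) auto
  qed
qed

lemma phi_h: "x \<in> {-1..1} \<Longrightarrow> \<phi> (h x) = x"
  unfolding \<phi>_def by (rule the_inv_into_f_f[OF h_inj])

lemma h_phi: "y \<in> {-1..1} \<Longrightarrow> h (\<phi> y) = y"
  unfolding \<phi>_def by (rule f_the_inv_into_f[OF h_inj]) (simp add: h_image)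

lemma phi_range: "y \<in> {-1..1} \<Longrightarrow> \<phi> y \<in> {-1..1}"
  unfolding \<phi>_def by (rule the_inv_into_into[OF h_inj]) (simp_all add: h_image)

lemma phi_nonneg: "y \<in> {0..1} \<Longrightarrow> \<phi> y \<in> {0..1}"
  using h_surj_nonneg[of y] phi_h by force

lemma phi_odd: "y \<in> {-1..1} \<Longrightarrow> \<phi> (- y) = - \<phi> y"
  using phi_h[of "- \<phi> y"] h_odd[of "\<phi> y"] phi_range[of y] h_phi[of y] by auto

lemma summable_a: "summable (\<lambda>n. norm (a n))"
  using W by (simp add: W_plus_def \<phi>_def [symmetric] a_def)

lemma summable_ca: "summable (\<lambda>n. norm (complex_of_real (a n)))"
  using summable_a by simp

lemma phi_sums_near_0: "\<exists>e>0. \<forall>y. \<bar>y\<bar> < e \<longrightarrow> (\<lambda>n. a n * y ^ n) sums \<phi> y"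
proof -
  from W have "\<phi> real_analytic_on {-1<..<1}" by (simp add: W_plus_def \<phi>_def)
  from real_analytic_at_0[OF this] obtain e \<alpha> where
    e: "e > 0" "\<And>y. \<bar>y\<bar> < e \<Longrightarrow> (\<lambda>n. \<alpha> n * y ^ n) sums \<phi> y"
    by auto
  then have "a n = \<alpha> n" for n
    using deriv_power_series_at_0[OF e] by (simp add: a_def)
  with e show ?thesis by auto
qed

lemma a_even: "even n \<Longrightarrow> a n = 0"
proof -
  assume n: "even n"
  obtain e where e: "e > 0" "\<And>y. \<bar>y\<bar> < e \<Longrightarrow> (\<lambda>n. a n * y ^ n) sums \<phi> y"
    using phi_sums_near_0 by blast
  have "\<phi> (- y) = - \<phi> y" if "\<bar>y\<bar> < min e 1" for y
    using that by (intro phi_odd) auto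
  then show "a n = 0"
    by (intro odd_power_series_even_coeff[of "min e 1" a \<phi>]) (use e n in auto)
qed

lemma holomorphic_T: "T holomorphic_on ball 0 1"
  unfolding T_def using summable_power_series_cball(2)[OF summable_ca]
  by (intro power_series_holomorphic[where a="\<lambda>n. complex_of_real (a n)"]) (auto simp: summable_sums)

lemma holomorphic_C: "C holomorphic_on ball 0 1"
  unfolding C_def using summable_power_series_cball(2)[OF summable_cc]
  by (intro power_series_holomorphic[where a="\<lambda>n. complex_of_real (c n)"]) (auto simp: summable_sums)

lemma continuous_C: "continuous_on (cball 0 1) C"
  unfolding C_def by (rule continuous_on_power_series_cball[OF summable_cc])

lemma C_of_real: "\<bar>x\<bar> \<le> 1 \<Longrightarrow> C (of_real x) = of_real (\<Sum>n. c n * x ^ n)"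
  unfolding C_def using summable_power_series_cball(2)[OF summable_c(2), of x]
  by (simp add: suminf_of_real [symmetric] flip: of_real_power of_real_mult)

lemma T_of_real: "\<bar>x\<bar> \<le> 1 \<Longrightarrow> T (of_real x) = of_real (\<Sum>n. a n * x ^ n)"
  unfolding T_def using summable_power_series_cball(2)[OF summable_a, of x]
  by (simp add: suminf_of_real [symmetric] flip: of_real_power of_real_mult)

lemma C_h: "x \<in> {0..1} \<Longrightarrow> C (of_real x) = of_real (h x)"
  by (simp add: C_of_real h_eq)

text \<open>Nonnegative coefficients make the modulus on a circle largest at the positive real
  point. Hence \<open>C\<close> maps the open disc into itself and \<open>T (C z)\<close> is
  holomorphic there.\<close>

lemma cmod_C_le: "cmod z \<le> 1 \<Longrightarrow> cmod (C z) \<le> h (cmod z)"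
proof -
  assume z: "cmod z \<le> 1"
  have "cmod (C z) \<le> (\<Sum>n. c n * cmod z ^ n)"
    unfolding C_def using summable_power_series_cball(2)[OF summable_c(2), of "cmod z"] z c_nonneg
    by (intro norm_suminf_le) (auto simp: norm_mult norm_power)
  then show ?thesis using z by (simp add: h_eq)
qed

lemma cmod_C_less: "cmod z < 1 \<Longrightarrow> cmod (C z) < 1"
  using cmod_C_le[of z] h_strict_mono_nonneg[of "cmod z" 1] by (simp add: h1)

lemma T_C: "cmod z < 1 \<Longrightarrow> T (C z) = z"
proof -
  assume z: "cmod z < 1"
  obtain e where e: "e > 0" "\<And>y. \<bar>y\<bar> < e \<Longrightarrow> (\<lambda>n. a n * y ^ n) sums \<phi> y"
    using phi_sums_near_0 by blast
  \<comment> \<open>Chosen so that \<open>h\<close> maps (0, d) into the interval around 0 on which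
    the Taylor series of \<phi> is known to represent \<phi>.\<close>
  define d where "d = \<phi> (min e 1 / 2)"
  have m: "min e 1 / 2 \<in> {0..1}" "0 < min e 1" using e by auto
  have hd: "h d = min e 1 / 2" unfolding d_def by (rule h_phi) (use m in auto)
  have d: "d \<in> {0..1}" unfolding d_def by (rule phi_nonneg[OF m(1)])
  have d0: "0 < d" using hd h0 d m by (cases "d = 0") auto
  show ?thesis
  proof (rule holomorphic_eq_on_ball_of_real[where f="\<lambda>z. T (C z)" and d=d and s=1])
    show "(\<lambda>z. T (C z)) holomorphic_on ball 0 1"
    proof -
      have "C ` ball 0 1 \<subseteq> ball 0 1" using cmod_C_less by auto
      from holomorphic_on_compose_gen[OF holomorphic_C holomorphic_T this]
      show ?thesis by (simp add: o_def)
    qed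
    fix x assume x: "0 < x" "x < d"
    have "h x < h d" "0 \<le> h x" using h_strict_mono[of x d] h_nonneg[of x] x d by auto
    then have "\<bar>h x\<bar> < e" "\<bar>h x\<bar> \<le> 1" using hd m by auto
    with x d show "T (C (complex_of_real x)) = complex_of_real x"
      using e(2)[of "h x"] phi_h[of x] by (simp add: C_h T_of_real sums_iff)
  qed (use d d0 z in \<open>auto intro: holomorphic_intros\<close>)
qed

text \<open>Taking z = x < 1 in \<open>T_C\<close> covers the values y = h x in [0,1). Continuity in
  x adds y = 1, and oddness of both sides the negative half. The expansion is thereby carried from a
  neighbourhood of 0 to the closed interval.\<close>

lemma phi_sums: "y \<in> {-1..1} \<Longrightarrow> (\<lambda>n. a n * y ^ n) sums \<phi> y"
proof -
  assume y: "y \<in> {-1..1}"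
  have lt: "(\<Sum>n. a n * h x ^ n) = x" if x: "x \<in> {0..<1}" for x
  proof -
    have "T (C (of_real x)) = of_real x" using x by (intro T_C) auto
    then have "complex_of_real (\<Sum>n. a n * h x ^ n) = of_real x"
      using x h_nonneg[of x] by (simp add: C_h T_of_real)
    then show ?thesis by (simp only: of_real_eq_iff)
  qed
  have "(\<Sum>n. a n * h 1 ^ n) - 1 = 0"
  proof (rule continuous_on_eq_at_endpoint[where f="\<lambda>x. (\<Sum>n. a n * h x ^ n) - x"])
    show "continuous_on {0..1} (\<lambda>x. (\<Sum>n. a n * h x ^ n) - x)"
      using continuous_on_compose2[OF continuous_on_power_series_cball[OF summable_a] h_cont] h_nonneg
      by (intro continuous_intros) force
  qed (use lt in auto)
  with lt have le: "(\<Sum>n. a n * h x ^ n) = x" if "x \<in> {0..1}" for x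
    using that by (cases "x = 1") auto
  have nonneg: "(\<Sum>n. a n * y ^ n) = \<phi> y" if "y \<in> {0..1}" for y
    using le[OF phi_nonneg[OF that]] h_phi[of y] that by simp
  have "(\<Sum>n. a n * y ^ n) = \<phi> y"
  proof (cases "0 \<le> y")
    case True then show ?thesis using nonneg y by simp
  next
    case False
    have "a n * (- y) ^ n = - (a n * y ^ n)" for n
      using a_even[of n] by (cases "even n") auto
    then have "(\<Sum>n. a n * (- y) ^ n) = - (\<Sum>n. a n * y ^ n)"
      using summable_power_series_cball(2)[OF summable_a, of y] y by (simp add: suminf_minus abs_le_iff)
    then show ?thesis using nonneg[of "- y"] phi_odd[OF y] y False by simp
  qed
  then show ?thesis
    using summable_power_series_cball(2)[OF summable_a, of y] y by (simp add: sums_iff abs_le_iff)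
qed

lemma h_sums_open: "\<bar>x\<bar> < 1 \<Longrightarrow> (\<lambda>k. c k * x ^ k) sums h x"
proof -
  assume x: "\<bar>x\<bar> < 1"
  define g where "g = (\<Sum>k. c k * x ^ k)"
  have C: "C (of_real x) = of_real g" using x by (simp add: C_of_real g_def)
  then have g: "\<bar>g\<bar> < 1" using cmod_C_less[of "of_real x"] x by simp
  then have g': "g \<in> {-1..1}" by auto
  have "T (of_real g) = of_real x" using T_C[of "of_real x"] x C by simp
  then have "complex_of_real (\<phi> g) = of_real x"
    using g phi_sums[OF g'] by (simp add: T_of_real sums_iff)
  then have "h x = g" using h_phi[OF g'] by simp
  then show ?thesis
    using summable_power_series_cball(2)[OF summable_c(2), of x] x by (simp add: sums_iff g_def)
qed

lemma F_eq: "F x = (\<Sum>n. \<bar>a n\<bar> * x ^ n)"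
  by (simp add: abs_series_def a_def)

lemma F_sums: "\<bar>x\<bar> \<le> 1 \<Longrightarrow> (\<lambda>n. \<bar>a n\<bar> * x ^ n) sums F x"
  unfolding F_eq using summable_power_series_cball(2)[of "\<lambda>n. \<bar>a n\<bar>" x] summable_a
  by (simp add: summable_sums)

lemma a_sums: "a sums 1"
  using phi_sums[of 1] phi_h[of 1] h1 by simp

lemma F1_ge: "1 \<le> F 1"
proof (rule sums_le)
  show "(\<lambda>n. \<bar>a n\<bar>) sums F 1" using F_sums[of 1] by simp
  show "a sums 1" by (rule a_sums)
qed (rule abs_ge_self)

lemma F_odd: "x \<in> {-1..1} \<Longrightarrow> F (- x) = - F x"
proof -
  assume x: "x \<in> {-1..1}"
  have "\<bar>a n\<bar> * (- x) ^ n = - (\<bar>a n\<bar> * x ^ n)" for n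
    using a_even[of n] by (cases "even n") auto
  then have "F (- x) = (\<Sum>n. - (\<bar>a n\<bar> * x ^ n))" unfolding F_eq by (rule suminf_cong)
  also have "\<dots> = - F x" using F_sums[of x] x by (simp add: suminf_minus sums_iff abs_le_iff)
  finally show ?thesis .
qed

lemma F0: "F 0 = 0"
  using F_odd[of 0] by simp

lemma F_strict_mono_nonneg: "0 \<le> x \<Longrightarrow> x < y \<Longrightarrow> y \<le> 1 \<Longrightarrow> F x < F y"
proof -
  assume xy: "0 \<le> x" "x < y" "y \<le> 1"
  have "\<exists>i. a i \<noteq> 0"
  proof (rule ccontr)
    assume "\<nexists>i. a i \<noteq> 0"
    then have a: "a = (\<lambda>_. 0)" by auto
    from sums_unique2[OF a_sums[unfolded a] sums_zero] show False by simp
  qed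
  then obtain i where i: "a i \<noteq> 0" by blast
  have "0 < i" using i a_even[of 0] by (cases i) auto
  with i have "0 < \<bar>a i\<bar>" "0 < i" by auto
  from power_series_strict_mono[of "\<lambda>i. \<bar>a i\<bar>", OF _ _ this xy] summable_a
  show "F x < F y" by (simp add: F_eq)
qed

lemma F_inj: "inj_on F {-1..1}"
  by (rule inj_on_strict_mono) (rule odd_strict_mono[where f=F, OF F_strict_mono_nonneg F_odd])

lemma F_cont: "continuous_on {0..1} F"
proof -
  have "continuous_on (cball 0 1) (\<lambda>x. \<Sum>n. \<bar>a n\<bar> * x ^ n)"
    by (rule continuous_on_power_series_cball) (use summable_a in simp)
  then show ?thesis unfolding F_eq [abs_def] by (rule continuous_on_subset) auto
qed

lemma ex_F: "y \<in> {0..F 1} \<Longrightarrow> \<exists>x\<in>{0..1}. F x = y"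
  using IVT'[of F 0 y 1] F_cont by (auto simp: F0)

lemma hyp_F: "x \<in> {-1..1} \<Longrightarrow> hyp (F x) = x"
  unfolding hyp_def by (rule the_inv_into_f_f[OF F_inj])

lemma hyp:
  assumes "y \<in> {0..F 1}"
  shows "hyp y \<in> {0..1}" "F (hyp y) = y"
  using ex_F[OF assms] hyp_F by force+

lemma hyp_bounds:
  assumes "0 < y" "y < F 1"
  shows "0 < hyp y" "hyp y < 1"
proof -
  have "hyp y \<noteq> 0" "hyp y \<noteq> 1" using hyp(2)[of y] assms F0 by auto
  then show "0 < hyp y" "hyp y < 1" using hyp(1)[of y] assms by auto
qed

text \<open>The coefficients of \<phi> sum to 1, so F 1 = 1 forces all of them to be nonnegative. A
  series with nonnegative coefficients of sum 1 and no constant term lies below the identity on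
  [0,1]. This applies to \<open>h\<close> and to its inverse, which gives x = \<phi> (h x) \<le> h x
  \<le> x.\<close>

lemma identity_if_F1_eq:
  assumes "F 1 = 1" "x \<in> {0..1}"
  shows "h x = x"
proof -
  have "(\<lambda>n. \<bar>a n\<bar> - a n) sums (F 1 - 1)"
    using F_sums[of 1] a_sums by (intro sums_diff) auto
  then have "(\<lambda>n. \<bar>a n\<bar> - a n) sums 0" using assms(1) by simp
  then have "\<bar>a n\<bar> - a n = 0" for n
    using suminf_eq_zero_iff[of "\<lambda>n. \<bar>a n\<bar> - a n"] by (simp add: sums_iff)
  then have a: "0 \<le> a n" for n by (metis abs_ge_zero eq_iff_diff_eq_0)
  have le: "y ^ n \<le> y" if "y \<in> {0..1}" "0 < n" for y :: real and n
    using that power_decreasing[of 1 n y] by simp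
  have "\<phi> y \<le> y" if y: "y \<in> {0..1}" for y
  proof (rule sums_le)
    show "(\<lambda>n. a n * y ^ n) sums \<phi> y" using y by (intro phi_sums) auto
    show "(\<lambda>n. a n * y) sums y" using sums_mult2[OF a_sums, of y] by simp
    show "a n * y ^ n \<le> a n * y" for n
      using a[of n] le[OF y, of n] a_even[of 0] by (cases "n = 0") (auto intro: mult_left_mono)
  qed
  from this[OF h_nonneg[OF assms(2)]] have "x \<le> h x" using phi_h[of x] assms(2) by simp
  moreover have "h x \<le> x"
  proof (rule sums_le)
    show "(\<lambda>n. c n * x ^ n) sums h x" using assms(2) by (rule h_sums)
    show "(\<lambda>n. c n * x) sums x" using sums_mult2[OF c_sums, of x] by simp
    show "c n * x ^ n \<le> c n * x" for n
      using c_nonneg[of n] le[OF assms(2), of n] c0 by (cases "n = 0") (auto intro: mult_left_mono)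
  qed
  ultimately show ?thesis by simp
qed

lemma complex_series_h: "complex_series h z = C z"
proof -
  have "(deriv ^^ n) h 0 = fact n * c n" for n
    by (rule deriv_power_series_at_0[of 1]) (use h_sums_open in auto)
  then show ?thesis by (simp add: complex_series_def C_def)
qed

lemma cmod_T_le: "cmod z \<le> 1 \<Longrightarrow> cmod (T z) \<le> F (cmod z)"
  unfolding T_def F_eq using F_sums[of "cmod z"]
  by (intro norm_suminf_le) (auto simp: norm_mult norm_power sums_iff)

text \<open>The sign condition says a_n i^n = i |a_n|, hence T (i x) = i F x. With s =
  \<open>hyp 1\<close>, |T w| \<le> F |w| < F s = 1 for |w| < s, so \<open>C\<close> inverts
  \<open>T\<close> on that disc and C (i F x) = i x for 0 \<le> x < s. The point i lies on the
  boundary circle; it corresponds to x = s and is reached by continuity.\<close>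

lemma complex_series_at_ii:
  assumes sgn: "\<And>j. sgn ((deriv ^^ (2 * j + 1)) \<phi> 0) = (- 1) ^ j"
  shows "complex_series h \<i> = \<i> * of_real (hyp 1)"
proof -
  define s where "s = hyp 1"
  have s: "s \<in> {0..1}" "F s = 1" unfolding s_def using hyp[of 1] F1_ge by auto
  have s0: "0 < s" using s F0 by (cases "s = 0") auto
  have F_lt: "F x < 1" if "0 \<le> x" "x < s" for x
    using F_strict_mono_nonneg[of x s] s that by simp
  have CT: "C (T w) = w" if w: "cmod w < s" for w
  proof (rule holomorphic_eq_on_ball_of_real[where f="\<lambda>z. C (T z)" and d=s and s=s])
    have sub: "T ` ball 0 s \<subseteq> ball 0 1"
    proof
      fix z assume "z \<in> T ` ball 0 s"
      then obtain y where "z = T y" "cmod y < s" by auto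
      then show "z \<in> ball 0 1" using cmod_T_le[of y] F_lt[of "cmod y"] s by simp
    qed
    have "T holomorphic_on ball 0 s"
      using holomorphic_T by (rule holomorphic_on_subset) (use s in auto)
    from holomorphic_on_compose_gen[OF this holomorphic_C sub]
    show "(\<lambda>z. C (T z)) holomorphic_on ball 0 s" by (simp add: o_def)
    fix x assume x: "0 < x" "x < s"
    then have x1: "x \<in> {0..1}" using s by auto
    have "T (of_real x) = of_real (\<phi> x)" using phi_sums[of x] x1 by (simp add: T_of_real sums_iff)
    then show "C (T (complex_of_real x)) = complex_of_real x"
      using phi_nonneg[OF x1] h_phi[of x] x1 by (simp add: C_h)
  qed (use s0 w in \<open>auto intro: holomorphic_intros\<close>)
  have coeff: "complex_of_real (a n) * \<i> ^ n = \<i> * of_real \<bar>a n\<bar>" for n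
  proof (cases "even n")
    case True then show ?thesis by (simp add: a_even)
  next
    case False
    then obtain j where n: "n = 2 * j + 1" by (auto elim: oddE)
    have "a n = sgn (a n) * \<bar>a n\<bar>" by (simp add: sgn_mult_abs)
    also have "sgn (a n) = (- 1) ^ j"
      using sgn[of j] unfolding a_def n by (simp add: sgn_divide del: funpow.simps)
    finally have "complex_of_real (a n) = (- 1) ^ j * of_real \<bar>a n\<bar>"
      by (metis of_real_1 of_real_minus of_real_mult of_real_power)
    moreover have "\<i> ^ n = \<i> * (- 1) ^ j" by (simp add: n power_mult)
    moreover have "(- 1) ^ j * (- 1) ^ j = (1::complex)" by (simp flip: power_mult_distrib)
    ultimately show ?thesis by (simp add: mult_ac)
  qed
  have Ti: "T (\<i> * of_real x) = \<i> * of_real (F x)" if "\<bar>x\<bar> \<le> 1" for x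
  proof -
    have "complex_of_real (a n) * (\<i> * of_real x) ^ n = \<i> * of_real (\<bar>a n\<bar> * x ^ n)" for n
      using coeff[of n] by (simp add: power_mult_distrib mult.assoc [symmetric])
    then have "T (\<i> * of_real x) = (\<Sum>n. \<i> * of_real (\<bar>a n\<bar> * x ^ n))" by (simp only: T_def)
    moreover have "(\<lambda>n. \<i> * complex_of_real (\<bar>a n\<bar> * x ^ n)) sums (\<i> * of_real (F x))"
      by (intro sums_mult sums_of_real F_sums that)
    ultimately show ?thesis by (simp add: sums_iff)
  qed
  have "C (\<i> * of_real (F s)) - \<i> * of_real s = 0"
  proof (rule continuous_on_eq_at_endpoint[where f="\<lambda>x. C (\<i> * of_real (F x)) - \<i> * of_real x"])
    have Fb: "\<bar>F x\<bar> \<le> 1" if "x \<in> {0..s}" for x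
      using F_lt[of x] F_strict_mono_nonneg[of 0 x] that s F0 by (cases "x = s"; cases "x = 0") auto
    have "continuous_on {0..s} (\<lambda>x. \<i> * complex_of_real (F x))"
      by (intro continuous_intros continuous_on_subset[OF F_cont]) (use s in auto)
    moreover have "(\<lambda>x. \<i> * complex_of_real (F x)) ` {0..s} \<subseteq> cball 0 1"
      using Fb by (auto simp: norm_mult)
    ultimately have "continuous_on {0..s} (\<lambda>x. C (\<i> * complex_of_real (F x)))"
      by (rule continuous_on_compose2[OF continuous_C])
    then show "continuous_on {0..s} (\<lambda>x. C (\<i> * of_real (F x)) - \<i> * of_real x)"
      by (intro continuous_intros)
    fix x assume "x \<in> {0..<s}"
    then have "C (T (\<i> * of_real x)) = \<i> * of_real x" "\<bar>x\<bar> \<le> 1" using s by (auto intro!: CT simp: norm_mult)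
    then show "C (\<i> * of_real (F x)) - \<i> * of_real x = 0" by (simp add: Ti)
  qed (rule s0)
  then show ?thesis using s by (simp add: complex_series_h s_def)
qed

end

text \<open>Stretching the argument by r multiplies the n-th Taylor coefficient by r^n, so
  summability at r becomes summability at 1. This carries the hypothesis on the inverse of H over to
  the inverse of the normalised h, and the values of the absolute series back.\<close>

lemma W_plus_rescale:
  fixes \<psi> :: "real \<Rightarrow> real"
  assumes r: "r > 0" and W: "\<psi> \<in> W_plus r"
  shows "(\<lambda>y. \<psi> (r * y)) \<in> W_plus 1" "abs_series \<psi> (r * x) = abs_series (\<lambda>y. \<psi> (r * y)) x"
proof -
  from W have an: "\<psi> real_analytic_on {-r<..<r}"
    and sm: "summable (\<lambda>n. \<bar>(deriv ^^ n) \<psi> 0\<bar> / fact n * r ^ n)"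
    by (simp_all add: W_plus_def)
  have rescaled: "(\<lambda>n. (\<alpha> n * r ^ n) * (y - x) ^ n) sums \<psi> (r * y)"
    if "\<And>y. \<bar>y - r * x\<bar> < e \<Longrightarrow> (\<lambda>n. \<alpha> n * (y - r * x) ^ n) sums \<psi> y" "\<bar>y - x\<bar> < e / r" for \<alpha> e x y
  proof -
    have "\<bar>r * y - r * x\<bar> < e"
      using that(2) r by (simp add: abs_mult pos_less_divide_eq mult.commute flip: right_diff_distrib)
    from that(1)[OF this] show ?thesis
      by (simp add: power_mult_distrib mult.assoc flip: right_diff_distrib)
  qed
  have "\<exists>e>0. \<exists>\<alpha>. \<forall>y. \<bar>y - x\<bar> < e \<longrightarrow> (\<lambda>n. \<alpha> n * (y - x) ^ n) sums \<psi> (r * y)" if x: "x \<in> {-1<..<1}" for x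
  proof -
    have "r * x \<in> {-r<..<r}" using x r mult_strict_left_mono[of x 1 r] mult_strict_left_mono[of "-1" x r] by auto
    from bspec[OF an[unfolded real_analytic_on_def] this] obtain e \<alpha> where
      e: "e > 0" "\<And>y. \<bar>y - r * x\<bar> < e \<Longrightarrow> (\<lambda>n. \<alpha> n * (y - r * x) ^ n) sums \<psi> y"
      by blast
    show ?thesis
      by (intro exI[of _ "e / r"] conjI exI[of _ "\<lambda>n. \<alpha> n * r ^ n"] allI impI rescaled[OF e(2)])
        (use e(1) r in auto)
  qed
  then have an': "(\<lambda>y. \<psi> (r * y)) real_analytic_on {-1<..<1}"
    unfolding real_analytic_on_def by blast
  from real_analytic_at_0[OF an r] obtain e \<alpha> where
    e: "e > 0" "\<And>y. \<bar>y\<bar> < e \<Longrightarrow> (\<lambda>n. \<alpha> n * y ^ n) sums \<psi> y"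
    by auto
  have D: "(deriv ^^ n) (\<lambda>y. \<psi> (r * y)) 0 = (deriv ^^ n) \<psi> 0 * r ^ n" for n
  proof -
    have "(deriv ^^ n) (\<lambda>y. \<psi> (r * y)) 0 = fact n * (\<alpha> n * r ^ n)"
      by (rule deriv_power_series_at_0[of "e / r"]) (use e r rescaled[of 0 e \<alpha>] in auto)
    then show ?thesis using deriv_power_series_at_0[OF e] by simp
  qed
  then have D': "\<bar>(deriv ^^ n) (\<lambda>y. \<psi> (r * y)) 0\<bar> / fact n = \<bar>(deriv ^^ n) \<psi> 0\<bar> / fact n * r ^ n" for n
    using r by (simp add: abs_mult)
  show "(\<lambda>y. \<psi> (r * y)) \<in> W_plus 1"
    unfolding W_plus_def using an' sm by (simp add: D')
  show "abs_series \<psi> (r * x) = abs_series (\<lambda>y. \<psi> (r * y)) x"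
    unfolding abs_series_def D' by (simp add: power_mult_distrib mult.assoc)
qed

subsection \<open>The Grothendieck constant\<close>

lemma grothendieck_boundI:
  assumes "\<And>m n A N M. bil_bound m n A N \<Longrightarrow> cgram 1 M \<Longrightarrow> cmod (\<Sum>i<m. \<Sum>j<n. A i j * M i j) \<le> K * N"
  shows "grothendieck_bound K"
  unfolding grothendieck_bound_def
proof (intro allI ballI impI)
  fix m n and A :: "complex mat" and H :: "(nat \<Rightarrow> complex) hilbert" and u v
  assume A: "A \<in> carrier_mat m n" and H: "complex_hilbert_space H"
    and u: "\<forall>i<m. u i \<in> carrier H \<and> hnorm H (u i) \<le> 1" and v: "\<forall>j<n. v j \<in> carrier H \<and> hnorm H (v j) \<le> 1"
  obtain u' v' N where uv: "\<And>i. i < m \<Longrightarrow> hnorm (cspace N) (u' i) = hnorm H (u i)"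
    "\<And>j. j < n \<Longrightarrow> hnorm (cspace N) (v' j) = hnorm H (v j)"
    "\<And>i j. i < m \<Longrightarrow> j < n \<Longrightarrow> sp (cspace N) (u' i) (v' j) = sp H (u i) (v j)"
    by (rule complex_hilbert_space.gram_matrix_in_cspace[OF H, of m u n v]) (use u v in auto)
  \<comment> \<open>\<open>cgram\<close> speaks about all indices, so the families are continued by
    zero vectors.\<close>
  define p where "p i = (if i < m then u' i else (\<lambda>_. 0))" for i
  define q where "q j = (if j < n then v' j else (\<lambda>_. 0))" for j
  have p: "(\<Sum>l<N. (cmod (p i l))\<^sup>2) \<le> 1" for i
  proof (cases "i < m")
    case True
    then have "hnorm (cspace N) (u' i) \<le> 1" using uv(1) u by simp
    with True show ?thesis by (simp add: p_def hnorm_cspace L2_set_def)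
  qed (simp add: p_def)
  have q: "(\<Sum>l<N. (cmod (q j l))\<^sup>2) \<le> 1" for j
  proof (cases "j < n")
    case True
    then have "hnorm (cspace N) (v' j) \<le> 1" using uv(2) v by simp
    with True show ?thesis by (simp add: q_def hnorm_cspace L2_set_def)
  qed (simp add: q_def)
  have "cgram 1 (\<lambda>i j. \<Sum>l<N. p i l * cnj (q j l))"
    by (rule cgramI[of "{..<N}" p _ q]) (use p q in auto)
  moreover have "bil_bound m n (\<lambda>i j. A $$ (i, j)) (norm_inf_1 A)"
    using bil_bound_norm_inf_1[of A] A by simp
  ultimately have "cmod (\<Sum>i<m. \<Sum>j<n. A $$ (i, j) * (\<Sum>l<N. p i l * cnj (q j l))) \<le> K * norm_inf_1 A"
    by (intro assms)
  also have "(\<Sum>i<m. \<Sum>j<n. A $$ (i, j) * (\<Sum>l<N. p i l * cnj (q j l))) =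
      (\<Sum>i<m. \<Sum>j<n. A $$ (i, j) * sp H (u i) (v j))"
    using uv(3) by (intro sum.cong refl) (simp add: p_def q_def)
  finally show "cmod (\<Sum>i<m. \<Sum>j<n. A $$ (i, j) * sp H (u i) (v j)) \<le> K * norm_inf_1 A" .
qed

lemma norm_inf_1_nonneg: "0 \<le> norm_inf_1 A"
  using bil_bound_nonneg[OF bil_bound_norm_inf_1] .

lemma grothendieck_bound_ge_1:
  assumes "grothendieck_bound K"
  shows "1 \<le> K"
proof -
  define A :: "complex mat" where "A = Matrix.mat 1 1 (\<lambda>_. 1)"
  define e :: "nat \<Rightarrow> complex" where "e l = (if l = 0 then 1 else 0)" for l
  have A: "A \<in> carrier_mat 1 1" "dim_row A = 1" "dim_col A = 1" "A $$ (0, 0) = 1"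
    by (simp_all add: A_def)
  have "bil_bound (dim_row A) (dim_col A) (\<lambda>i j. A $$ (i, j)) 1"
    unfolding bil_bound_def by (simp add: A norm_mult mult_le_one)
  then have N: "norm_inf_1 A \<le> 1" by (rule norm_inf_1_le)
  have "cmod (\<Sum>i<1. \<Sum>j<1. A $$ (i, j) * sp (cspace 1) e e) \<le> K * norm_inf_1 A"
    by (rule assms[unfolded grothendieck_bound_def, rule_format, OF A(1) complex_hilbert_space_cspace])
      (auto simp: e_def hnorm_cspace L2_set_def)
  then have "1 \<le> K * norm_inf_1 A" by (simp add: A e_def)
  moreover have "K * norm_inf_1 A < 1" if "K < 1"
  proof (cases "0 \<le> K")
    case True
    then have "K * norm_inf_1 A \<le> K * 1" using N by (intro mult_left_mono)
    with that show ?thesis by simp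
  next
    case False
    then have "K * norm_inf_1 A \<le> 0" using norm_inf_1_nonneg[of A] by (simp add: mult_le_0_iff)
    then show ?thesis by simp
  qed
  ultimately show ?thesis by (meson not_le order.strict_trans2 less_irrefl)
qed

text \<open>\<open>LEAST\<close> is meaningful only if the minimum is attained. Each single
  condition is a linear inequality in K with nonnegative coefficient \<open>norm_inf_1 A\<close>,
  hence passes to the infimum of the admissible K, and \<open>grothendieck_bound_ge_1\<close> makes
  that infimum positive.\<close>

lemma K_G_le:
  assumes "grothendieck_bound K"
  shows "K_G \<le> K"
proof -
  define S where "S = {K. grothendieck_bound K}"
  have S: "K \<in> S" "bdd_below S" using assms grothendieck_bound_ge_1 by (auto simp: S_def intro: bdd_belowI[of _ 1])
  have "grothendieck_bound (Inf S)"
    unfolding grothendieck_bound_def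
  proof (intro allI ballI impI)
    fix m n and A :: "complex mat" and H :: "(nat \<Rightarrow> complex) hilbert" and u v
    assume *: "A \<in> carrier_mat m n" "complex_hilbert_space H"
      "\<forall>i<m. u i \<in> carrier H \<and> hnorm H (u i) \<le> 1" "\<forall>j<n. v j \<in> carrier H \<and> hnorm H (v j) \<le> 1"
    define x where "x = cmod (\<Sum>i<m. \<Sum>j<n. A $$ (i, j) * sp H (u i) (v j))"
    have x: "x \<le> K * norm_inf_1 A" if "K \<in> S" for K
      using that * unfolding S_def grothendieck_bound_def x_def by blast
    show "x \<le> Inf S * norm_inf_1 A"
    proof (cases "norm_inf_1 A = 0")
      case True
      then show ?thesis using x[OF S(1)] by simp
    next
      case False
      then have pos: "0 < norm_inf_1 A" using norm_inf_1_nonneg[of A] by simp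
      have "x / norm_inf_1 A \<le> Inf S"
        using S(1) x pos by (intro cInf_greatest) (auto simp: pos_divide_le_eq)
      then show ?thesis using pos by (simp add: pos_divide_le_eq)
    qed
  qed
  moreover have "Inf S \<le> y" if "grothendieck_bound y" for y
    using S(2) that by (intro cInf_lower) (auto simp: S_def)
  ultimately have "K_G = Inf S"
    unfolding K_G_def using grothendieck_bound_ge_1[of "Inf S"] by (intro Least_equality) auto
  moreover have "Inf S \<le> K" by (rule cInf_lower[OF S])
  ultimately show ?thesis by simp
qed

subsection \<open>Matrices in the unit ball of the dual norm\<close>

definition dual_unit :: "(nat \<Rightarrow> nat \<Rightarrow> complex) \<Rightarrow> bool" where
  "dual_unit M \<longleftrightarrow> (\<forall>m n A N. bil_bound m n A N \<longrightarrow> cmod (\<Sum>i<m. \<Sum>j<n. A i j * M i j) \<le> N)"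

text \<open>Entrywise products of vectors of the polydisc stay in the polydisc, so the coefficients
  A i j * p i * q j obey the same bound N, and testing \<open>M\<close> against them gives the
  claim. Entrywise multiplication by \<open>M\<close> is a contraction of the bilinear norm; this
  makes the dual unit ball closed under entrywise products.\<close>

lemma bil_bound_times:
  assumes M: "dual_unit M" and N: "bil_bound m n A N"
  shows "bil_bound m n (\<lambda>i j. A i j * M i j) N"
  unfolding bil_bound_def
proof (intro allI impI)
  fix p q assume pq: "\<forall>i<m. cmod (p i) \<le> 1" "\<forall>j<n. cmod (q j) \<le> 1"
  have "bil_bound m n (\<lambda>i j. A i j * p i * q j) N"
    unfolding bil_bound_def
  proof (intro allI impI)
    fix p' q' assume pq': "\<forall>i<m. cmod (p' i) \<le> 1" "\<forall>j<n. cmod (q' j) \<le> 1"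
    have "cmod (\<Sum>i<m. \<Sum>j<n. A i j * (p i * p' i) * (q j * q' j)) \<le> N"
      using pq pq' by (intro N[unfolded bil_bound_def, rule_format]) (simp_all add: norm_mult mult_le_one)
    then show "cmod (\<Sum>i<m. \<Sum>j<n. A i j * p i * q j * p' i * q' j) \<le> N"
      by (simp add: mult_ac)
  qed
  then have "cmod (\<Sum>i<m. \<Sum>j<n. A i j * p i * q j * M i j) \<le> N"
    using M by (simp add: dual_unit_def)
  then show "cmod (\<Sum>i<m. \<Sum>j<n. A i j * M i j * p i * q j) \<le> N"
    by (simp add: mult_ac)
qed

lemma dual_unit_mult:
  assumes "dual_unit M" "dual_unit M'"
  shows "dual_unit (\<lambda>i j. M i j * M' i j)"
  unfolding dual_unit_def
proof (intro allI impI)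
  fix m n A N assume "bil_bound m n A N"
  from assms(2)[unfolded dual_unit_def, rule_format, OF bil_bound_times[OF assms(1) this]]
  show "cmod (\<Sum>i<m. \<Sum>j<n. A i j * (M i j * M' i j)) \<le> N"
    by (simp add: mult.assoc)
qed

lemma dual_unit_one: "dual_unit (\<lambda>i j. 1)"
  unfolding dual_unit_def
proof (intro allI impI)
  fix m n A N assume "bil_bound m n A N"
  from this[unfolded bil_bound_def, rule_format, of "\<lambda>_. 1" "\<lambda>_. 1"]
  show "cmod (\<Sum>i<m. \<Sum>j<n. A i j * 1) \<le> N" by simp
qed

lemma dual_unit_cnj:
  assumes M: "dual_unit M"
  shows "dual_unit (\<lambda>i j. cnj (M i j))"
  unfolding dual_unit_def
proof (intro allI impI)
  fix m n A N assume N: "bil_bound m n A N"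
  have "bil_bound m n (\<lambda>i j. cnj (A i j)) N"
    unfolding bil_bound_def
  proof (intro allI impI)
    fix p q assume pq: "\<forall>i<m. cmod (p i) \<le> 1" "\<forall>j<n. cmod (q j) \<le> 1"
    have "cmod (cnj (\<Sum>i<m. \<Sum>j<n. A i j * cnj (p i) * cnj (q j))) \<le> N"
      unfolding complex_mod_cnj using pq by (intro N[unfolded bil_bound_def, rule_format]) simp_all
    then show "cmod (\<Sum>i<m. \<Sum>j<n. cnj (A i j) * p i * q j) \<le> N" by simp
  qed
  then have "cmod (\<Sum>i<m. \<Sum>j<n. cnj (A i j) * M i j) \<le> N" using M by (simp add: dual_unit_def)
  also have "cmod (\<Sum>i<m. \<Sum>j<n. cnj (A i j) * M i j) = cmod (cnj (\<Sum>i<m. \<Sum>j<n. A i j * cnj (M i j)))"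
    by simp
  finally show "cmod (\<Sum>i<m. \<Sum>j<n. A i j * cnj (M i j)) \<le> N" unfolding complex_mod_cnj .
qed

lemma dual_unit_power: "dual_unit M \<Longrightarrow> dual_unit (\<lambda>i j. M i j ^ n)"
proof (induction n)
  case (Suc n)
  from dual_unit_mult[OF Suc.prems Suc.IH[OF Suc.prems]] show ?case by simp
qed (simp add: dual_unit_one)

lemma dual_unit_twisted_power: "dual_unit M \<Longrightarrow> dual_unit (\<lambda>i j. twisted_power n (M i j))"
  unfolding twisted_power_def
  by (intro dual_unit_mult dual_unit_power dual_unit_cnj)

lemma twisted_power_polar:
  assumes "odd n" "cmod \<alpha> = 1"
  shows "twisted_power n (\<alpha> * of_real x) = \<alpha> * of_real (x ^ n)"
proof -
  obtain j where n: "n = 2 * j + 1" using assms(1) by (auto elim: oddE)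
  have \<alpha>: "\<alpha> * cnj \<alpha> = 1" using assms(2) complex_norm_square[of \<alpha>] by simp
  have "n div 2 = j" "n - n div 2 = Suc j" using n by auto
  then have "twisted_power n (\<alpha> * of_real x) = \<alpha> * of_real x * (\<alpha> * of_real x * cnj (\<alpha> * of_real x)) ^ j"
    by (simp add: twisted_power_def power_mult_distrib mult_ac)
  also have "\<alpha> * of_real x * cnj (\<alpha> * of_real x) = (\<alpha> * cnj \<alpha>) * of_real (x\<^sup>2)"
    by (simp add: power2_eq_square mult_ac)
  moreover have "x ^ n = x * (x\<^sup>2) ^ j" by (simp add: n power_mult)
  ultimately show ?thesis by (simp add: \<alpha> mult.assoc)
qed

lemma complex_polarE:
  obtains \<alpha> where "cmod \<alpha> = 1" "z = \<alpha> * of_real (cmod z)"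
proof (rule that)
  show "cmod (cis (Arg z)) = 1" by simp
  show "z = cis (Arg z) * of_real (cmod z)"
    using rcis_cmod_Arg[of z] by (simp add: rcis_def mult.commute)
qed

subsection \<open>Circularly symmetric functions\<close>

lemma std_cgaussian_rotate:
  assumes "cmod \<alpha> = 1"
  shows "distr std_cgaussian borel ((*s) \<alpha>) = (std_cgaussian :: (complex^'k) measure)"
proof (rule echar_unique)
  show "prob_space (distr std_cgaussian borel ((*s) \<alpha>) :: (complex^'k) measure)"
    by (rule std_cgaussian.prob_space_distr) measurable
  fix t :: "complex^'k"
  have "echar (distr std_cgaussian borel ((*s) \<alpha>)) t = echar std_cgaussian (cnj \<alpha> *s t)"
    by (subst echar_distr) (simp_all add: inner_vector_scalar_mult echar_def)
  then show "echar (distr std_cgaussian borel ((*s) \<alpha>)) t = echar std_cgaussian t"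
    by (simp add: echar_std_cgaussian norm_vector_scalar_mult assms)
qed (simp_all add: prob_space_std_cgaussian)

lemma gauss_norm_bounds:
  fixes b :: "complex^'k \<Rightarrow> complex"
  assumes "b \<in> L_inf"
  shows "(\<integral>\<^sup>+ z. ennreal ((cmod (b z))\<^sup>2) \<partial>std_cgaussian) < \<infinity>"
    and "gauss_norm b \<le> real_of_ereal (Linf_norm b)"
    and "integrable std_cgaussian (\<lambda>z. (cmod (b z))\<^sup>2)"
proof -
  note b = L_infD[OF assms]
  note b(1)[measurable]
  have sq: "AE z in std_cgaussian. (cmod (b z))\<^sup>2 \<le> (real_of_ereal (Linf_norm b))\<^sup>2"
    using AE_std_cgaussian[OF b(2)] by eventually_elim (simp add: power_mono)
  show int: "integrable std_cgaussian (\<lambda>z. (cmod (b z))\<^sup>2)"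
    by (rule std_cgaussian.integrable_const_bound[where B="(real_of_ereal (Linf_norm b))\<^sup>2"]) (use sq in auto)
  then show "(\<integral>\<^sup>+ z. ennreal ((cmod (b z))\<^sup>2) \<partial>std_cgaussian) < \<infinity>"
    by (simp add: nn_integral_eq_integral)
  have "(\<integral>z. (cmod (b z))\<^sup>2 \<partial>std_cgaussian) \<le> (real_of_ereal (Linf_norm b))\<^sup>2"
    by (rule std_cgaussian.integral_le_const[OF int sq])
  then show "gauss_norm b \<le> real_of_ereal (Linf_norm b)"
    unfolding gauss_norm_def using b(3) by (intro real_le_lsqrt) auto
qed

lemma H_fun_scaled:
  fixes f g :: "real^'n \<Rightarrow> real"
  shows "H_fun (\<lambda>w. f w / s) (\<lambda>w. g w / s) = (\<lambda>\<rho>. H_fun f g \<rho> / (s * s))"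
proof -
  have "h_real (\<lambda>w. f w / s) (\<lambda>w. f w / s) \<rho> = h_real f f \<rho> / (s * s)" for f :: "real^'n \<Rightarrow> real" and \<rho>
    unfolding h_real_def by simp
  then show ?thesis by (simp add: fun_eq_iff H_fun_def add_divide_distrib)
qed

locale circular_function =
  fixes b :: "complex^'k \<Rightarrow> complex"
  assumes b_L_inf: "b \<in> L_inf" and nonzero: "\<not> (AE z in lborel. b z = 0)"
    and circular: "cmod \<alpha> = 1 \<Longrightarrow> b (\<alpha> *s z) = \<alpha> * b z"
begin

definition "B = real_of_ereal (Linf_norm b)"
definition "r = (gauss_norm b)\<^sup>2"
definition "h x = H_fun (re_part b) (im_part b) x / r"

lemma b_measurable [measurable]: "b \<in> borel_measurable borel"
  and b_le: "AE z in lborel. cmod (b z) \<le> B" and B_nonneg: "0 \<le> B"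
  using L_infD[OF b_L_inf] by (simp_all add: B_def)

lemma r_pos: "0 < r"
proof -
  have "gauss_norm b \<noteq> 0"
  proof
    assume "gauss_norm b = 0"
    then have "(\<integral>z. (cmod (b z))\<^sup>2 \<partial>std_cgaussian) = 0"
      by (simp add: gauss_norm_def)
    then have "AE z in std_cgaussian. (cmod (b z))\<^sup>2 = 0"
      using integral_nonneg_eq_0_iff_AE[OF gauss_norm_bounds(3)[OF b_L_inf]] by simp
    then have "AE z in std_cgaussian. b z = 0" by simp
    from AE_lborel_of_std_cgaussian[OF this] nonzero show False by simp
  qed
  then show ?thesis by (simp add: r_def)
qed

lemma h_complex_of_real: "\<bar>x\<bar> \<le> 1 \<Longrightarrow> h_complex b b (of_real x) = of_real (r * h x)"
  using H_fun_eq_h_complex[OF b_measurable b_le] r_pos by (simp add: h_def)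

lemma h_complex_polar:
  assumes "cmod \<alpha> = 1" "\<bar>x\<bar> \<le> 1"
  shows "h_complex b b (\<alpha> * of_real x) = \<alpha> * of_real (r * h x)"
  using h_complex_rotate[OF b_measurable b_measurable _ assms(1) circular[OF assms(1)], of "of_real x"] assms(2)
  by (simp add: h_complex_of_real)

text \<open>The case \<alpha> = -1 of the symmetry. It makes the Taylor series of the inverse odd,
  so that only odd powers ever have to carry a phase.\<close>

lemma h_odd: "x \<in> {-1..1} \<Longrightarrow> h (- x) = - h x"
proof -
  assume x: "x \<in> {-1..1}"
  have "complex_of_real (r * h (- x)) = complex_of_real (- (r * h x))"
    using h_complex_polar[of "-1" x] h_complex_of_real[of "- x"] x by (simp add: abs_le_iff)
  then have "r * h (- x) = - (r * h x)" by (simp only: of_real_eq_iff)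
  then have "r * h (- x) = r * (- h x)" by (simp only: mult_minus_right)
  then show ?thesis unfolding mult_cancel_left using r_pos by auto
qed

lemma h_continuous: "continuous_on {-1..1} h"
proof -
  have "continuous_on {-1..1} (\<lambda>x. Re (h_complex b b (complex_of_real x)) / r)"
    using continuous_on_h_complex_of_real[OF b_measurable b_le B_nonneg] r_pos by (intro continuous_intros) auto
  then show ?thesis
    by (rule continuous_on_eq) (use r_pos in \<open>simp add: h_complex_of_real abs_le_iff\<close>)
qed

lemma h_one: "h 1 = 1"
  using h_complex_of_real[of 1] h_complex_one[OF b_measurable] r_pos
  by (simp add: r_def flip: of_real_mult of_real_power)

lemma ex_power_series:
  "\<exists>c. (\<forall>k. 0 \<le> c k) \<and> c sums 1 \<and> (\<forall>x\<in>{0..1}. (\<lambda>k. c k * x ^ k) sums h x)"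
proof -
  have nonneg: "0 \<le> fdiff k (\<lambda>j. h (real j / real n))" if n: "0 < n" "k \<le> n" for n k
  proof -
    have eq: "h (real j / real n) = Re (h_complex b b (of_real (real j / real n))) / r" if "j \<le> k" for j
      using that n r_pos h_complex_of_real[of "real j / real n"] by (simp add: divide_le_eq)
    have "fdiff k (\<lambda>j. h (real j / real n)) =
        fdiff k (\<lambda>j. Re (h_complex b b (of_real (real j / real n)))) / r"
      unfolding fdiff_def sum_divide_distrib by (intro sum.cong refl) (simp add: eq)
    then show ?thesis
      using fdiff_h_complex_nonneg[OF b_measurable b_le B_nonneg n] r_pos by simp
  qed
  have cont: "continuous_on {0..1} h"
    by (rule continuous_on_subset[OF h_continuous]) auto
  obtain c where c: "\<And>k. 0 \<le> c k" "summable c" "\<And>x. x \<in> {0..1} \<Longrightarrow> (\<lambda>k. c k * x ^ k) sums h x"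
    using absolutely_monotone_power_series[OF cont nonneg] by blast
  have "c sums 1" using c(3)[of 1] h_one by simp
  with c show ?thesis by blast
qed

section \<open>The correlation function of a bounded function is not the identity\<close>

lemma ex_positive_part:
  "\<exists>\<epsilon>>0. emeasure std_cgaussian {z. \<epsilon> < Re (b z)} > 0"
proof (rule ccontr)
  assume neg: "\<not> ?thesis"
  have "AE z in std_cgaussian. Re (b z) \<le> 1 / real (Suc n)" for n
  proof -
    have "emeasure std_cgaussian {z. 1 / real (Suc n) < Re (b z)} = 0"
      using neg by (auto simp: zero_less_iff_neq_zero)
    then show ?thesis
      by (subst AE_iff_measurable[of "{z. 1 / real (Suc n) < Re (b z)}"]) (auto simp: not_le)
  qed
  then have "AE z in std_cgaussian. \<forall>n. Re (b z) \<le> 1 / real (Suc n)"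
    by (simp add: AE_all_countable)
  then have le: "AE z in std_cgaussian. Re (b z) \<le> 0"
  proof eventually_elim
    case (elim z)
    show ?case
      by (rule LIMSEQ_le_const[OF LIMSEQ_inverse_real_of_nat]) (use elim in \<open>auto simp: inverse_eq_divide\<close>)
  qed
  have rot: "AE z in std_cgaussian. Re (\<alpha> * b z) \<le> 0" if "cmod \<alpha> = 1" for \<alpha>
  proof -
    have "AE z in distr std_cgaussian borel ((*s) \<alpha>). Re (b z) \<le> 0"
      unfolding std_cgaussian_rotate[OF that] by (rule le)
    from AE_distrD[OF _ this] show ?thesis by (simp add: circular[OF that])
  qed
  \<comment> \<open>The four rotations bound Re b and Im b by 0 from both sides.\<close>
  have "AE z in std_cgaussian. b z = 0"
    using rot[of 1, simplified] rot[of "-1", simplified] rot[of \<i>, simplified] rot[of "-\<i>", simplified]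
    by eventually_elim (simp add: complex_eq_iff)
  from AE_lborel_of_std_cgaussian[OF this] nonzero show False by simp
qed

text \<open>If \<open>h\<close> were the identity, then \<open>b\<close> would be additive along orthogonal Gaussian vectors,
  and sums of many independent copies would be unbounded.\<close>

lemma h_not_identity: "\<exists>x\<in>{0..1}. h x \<noteq> x"
proof (rule ccontr)
  assume "\<not> ?thesis"
  then have h_id: "h x = x" if "x \<in> {0..1}" for x using that by blast
  obtain \<epsilon> where \<epsilon>: "\<epsilon> > 0" "emeasure std_cgaussian {z. \<epsilon> < Re (b z)} > 0"
    using ex_positive_part by blast
  \<comment> \<open>On the event \<open>E\<close> below, n \<epsilon> \<le> sqrt n * B would follow,
    which is impossible once n > (B / \<epsilon>)^2.\<close>
  obtain n0 :: nat where n0: "(B / \<epsilon>)\<^sup>2 < real n0" using reals_Archimedean2 by blast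
  define n where "n = Suc n0"
  have n: "0 < n" "(B / \<epsilon>)\<^sup>2 < real n" using n0 by (auto simp: n_def)
  \<comment> \<open>The vectors are the standard basis e_0, ..., e_(n-1) and u_n = (e_0 + ... +
    e_(n-1)) / sqrt n. The weights express the linear relation between them.\<close>
  define w :: "nat \<Rightarrow> real" where "w t = (if t = n then 1 else - 1 / sqrt (real n))" for t
  define u :: "nat \<Rightarrow> nat \<Rightarrow> real" where "u t l = (if t = n then 1 / sqrt (real n) else if l = t then 1 else 0)" for t l
  have fin: "finite {..<n}" "finite {..n}" by auto
  interpret P: prob_space "gproc {..<n} :: (nat \<Rightarrow> complex^'k) measure" by (rule prob_space_gproc)
  interpret product_sigma_finite "\<lambda>_::nat. std_cgaussian :: (complex^'k) measure"
    by unfold_locales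
  have unit: "(\<Sum>l<n. (cmod (of_real (u t l)))\<^sup>2) = 1" if "t \<in> {..n}" for t
  proof (cases "t = n")
    case True
    then show ?thesis using n by (simp add: u_def norm_divide power_divide)
  next
    case False
    then have "(\<Sum>l<n. (cmod (of_real (u t l)))\<^sup>2) = (\<Sum>l<n. if l = t then 1 else 0)"
      by (intro sum.cong refl) (simp add: u_def)
    then show ?thesis using that False by simp
  qed
  have h_uu: "h_complex b b (\<Sum>l<n. of_real (u s l) * cnj (of_real (u t l))) = of_real (r * (\<Sum>l<n. u s l * u t l))"
    if "s \<in> {..n}" "t \<in> {..n}" for s t
  proof -
    have eq: "(\<Sum>l<n. complex_of_real (u s l) * cnj (of_real (u t l))) = of_real (\<Sum>l<n. u s l * u t l)" by simp
    have "cmod (\<Sum>l<n. complex_of_real (u s l) * cnj (of_real (u t l))) \<le> 1"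
      using unit[OF that(1)] unit[OF that(2)] by (intro cmod_sum_cnj_le) auto
    then have "\<bar>\<Sum>l<n. u s l * u t l\<bar> \<le> 1" unfolding eq norm_of_real .
    \<comment> \<open>\<open>h_id\<close> covers [0,1] only, so the vectors are chosen with
      nonnegative mutual inner products.\<close>
    moreover have "0 \<le> (\<Sum>l<n. u s l * u t l)" by (intro sum_nonneg) (auto simp: u_def)
    ultimately show ?thesis unfolding eq by (simp add: h_complex_of_real h_id abs_le_iff del: of_real_sum of_real_mult)
  qed
  have zero: "(\<Sum>t\<le>n. w t * u t l) = 0" if "l < n" for l
  proof -
    have "(\<Sum>t\<le>n. w t * u t l) = (\<Sum>t<n. w t * u t l) + w n * u n l"
      by (simp add: lessThan_Suc_atMost [symmetric])
    also have "(\<Sum>t<n. w t * u t l) = (\<Sum>t<n. if t = l then - 1 / sqrt (real n) else 0)"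
      by (intro sum.cong refl) (auto simp: w_def u_def)
    finally show ?thesis using that by (simp add: w_def u_def)
  qed
  define S where "S \<omega> = (\<Sum>t\<le>n. of_real (w t) * b (gcomb {..<n} (\<lambda>l. of_real (u t l)) \<omega>))" for \<omega>
  have quad: "(\<Sum>s\<le>n. \<Sum>t\<le>n. of_real (w s) * of_real (w t) *
      h_complex b b (\<Sum>l<n. of_real (u s l) * cnj (of_real (u t l)))) =
      complex_of_real (\<integral>\<omega>. (cmod (S \<omega>))\<^sup>2 \<partial>gproc {..<n})"
    "integrable (gproc {..<n}) (\<lambda>\<omega>. (cmod (S \<omega>))\<^sup>2)"
    unfolding S_def by (rule h_complex_quadratic[OF b_measurable b_le B_nonneg fin unit]; assumption)+
  \<comment> \<open>With h the identity, the quadratic form is r times the squared length of the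
    vanishing combination of the \<open>u t\<close>. Hence \<open>S\<close> is zero almost surely:
    b(Z) for the vector u_n is the sum of the independent b(\<omega> t) divided by sqrt n.\<close>
  have "complex_of_real (\<integral>\<omega>. (cmod (S \<omega>))\<^sup>2 \<partial>gproc {..<n}) =
      (\<Sum>s\<le>n. \<Sum>t\<le>n. of_real (w s) * of_real (w t) * of_real (r * (\<Sum>l<n. u s l * u t l)))"
    unfolding quad(1) [symmetric] by (intro sum.cong refl) (simp only: h_uu)
  also have "\<dots> = of_real (r * (\<Sum>s\<le>n. \<Sum>t\<le>n. \<Sum>l<n. (w s * u s l) * (w t * u t l)))"
    by (simp add: sum_distrib_left mult_ac)
  also have "(\<Sum>s\<le>n. \<Sum>t\<le>n. \<Sum>l<n. (w s * u s l) * (w t * u t l)) = (\<Sum>s\<le>n. \<Sum>l<n. \<Sum>t\<le>n. (w s * u s l) * (w t * u t l))"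
    by (intro sum.cong refl sum.swap)
  also have "\<dots> = (\<Sum>l<n. \<Sum>s\<le>n. \<Sum>t\<le>n. (w s * u s l) * (w t * u t l))"
    by (rule sum.swap)
  also have "\<dots> = (\<Sum>l<n. (\<Sum>s\<le>n. w s * u s l) * (\<Sum>t\<le>n. w t * u t l))"
    by (simp only: sum_product)
  also have "\<dots> = 0" using zero by simp
  finally have "(\<integral>\<omega>. (cmod (S \<omega>))\<^sup>2 \<partial>gproc {..<n}) = 0" by simp
  then have S0: "AE \<omega> in gproc {..<n}. (cmod (S \<omega>))\<^sup>2 = 0"
    using quad(2) by (subst (asm) integral_nonneg_eq_0_iff_AE) auto
  have Bn: "AE \<omega> in gproc {..<n}. cmod (b (gcomb {..<n} (\<lambda>l. of_real (u n l)) \<omega>)) \<le> B"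
    by (rule AE_gcomb[OF fin(1) _ b_le]) (use unit[of n] in simp)
  have comp: "gcomb {..<n} (\<lambda>l. of_real (u t l)) \<omega> = \<omega> t" if "t < n" for t and \<omega> :: "nat \<Rightarrow> complex^'k"
  proof -
    have "gcomb {..<n} (\<lambda>l. of_real (u t l)) \<omega> = (\<Sum>l<n. if l = t then \<omega> l else 0)"
      unfolding gcomb_def using that by (intro sum.cong refl) (auto simp: u_def)
    then show ?thesis using that by simp
  qed
  have bd: "AE \<omega> in gproc {..<n}. cmod (\<Sum>t<n. b (\<omega> t)) \<le> sqrt (real n) * B"
    using S0 Bn
  proof eventually_elim
    case (elim \<omega>)
    have "S \<omega> = (\<Sum>t<n. of_real (w t) * b (gcomb {..<n} (\<lambda>l. of_real (u t l)) \<omega>)) +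
        of_real (w n) * b (gcomb {..<n} (\<lambda>l. of_real (u n l)) \<omega>)"
      by (simp add: S_def lessThan_Suc_atMost [symmetric])
    also have "(\<Sum>t<n. of_real (w t) * b (gcomb {..<n} (\<lambda>l. of_real (u t l)) \<omega>)) =
        (\<Sum>t<n. of_real (- 1 / sqrt (real n)) * b (\<omega> t))"
      by (intro sum.cong refl) (simp add: comp w_def)
    also have "\<dots> = - (\<Sum>t<n. b (\<omega> t)) / of_real (sqrt (real n))"
      by (simp add: sum_negf sum_divide_distrib)
    finally have "(\<Sum>t<n. b (\<omega> t)) = of_real (sqrt (real n)) * b (gcomb {..<n} (\<lambda>l. of_real (u n l)) \<omega>)"
      using elim(1) n by (simp add: w_def field_simps)
    then show ?case using elim(2) n by (simp add: norm_mult)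
  qed
  \<comment> \<open>By independence all n coordinates satisfy Re b > \<epsilon> simultaneously with
    positive probability, which \<open>bd\<close> excludes almost surely.\<close>
  define E where "E = Pi\<^sub>E {..<n} (\<lambda>_. {z. \<epsilon> < Re (b z)})"
  have "emeasure (gproc {..<n}) E = (\<Prod>i<n. emeasure std_cgaussian {z. \<epsilon> < Re (b z)})"
    unfolding gproc_def E_def by (rule emeasure_PiM) auto
  then have E: "emeasure (gproc {..<n}) E \<noteq> 0" using \<epsilon>(2) by simp
  have "AE \<omega> in gproc {..<n}. \<omega> \<notin> E"
    using bd
  proof eventually_elim
    case (elim \<omega>)
    show ?case
    proof
      assume "\<omega> \<in> E"
      then have "\<epsilon> < Re (b (\<omega> t))" if "t < n" for t using that by (auto simp: E_def PiE_iff)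
      then have "(\<Sum>t<n. \<epsilon>) \<le> (\<Sum>t<n. Re (b (\<omega> t)))" by (intro sum_mono) (simp add: less_imp_le)
      then have "real n * \<epsilon> \<le> Re (\<Sum>t<n. b (\<omega> t))" by simp
      also have "\<dots> \<le> sqrt (real n) * B" using elim complex_Re_le_cmod order.trans by blast
      finally have "sqrt (real n) * (sqrt (real n) * \<epsilon>) \<le> sqrt (real n) * B" by (simp flip: mult.assoc)
      then have "sqrt (real n) * \<epsilon> \<le> B" using n by simp
      then have "sqrt (real n) \<le> B / \<epsilon>" using \<epsilon> by (simp add: pos_le_divide_eq)
      then have "(sqrt (real n))\<^sup>2 \<le> (B / \<epsilon>)\<^sup>2" by (intro power_mono) auto
      then show False using n by simp
    qed
  qed
  moreover have "E \<in> sets (gproc {..<n})"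
    unfolding E_def gproc_def by (intro sets_PiM_I_finite) auto
  ultimately have "emeasure (gproc {..<n}) E = 0"
    using sets.sets_into_space by (subst (asm) AE_iff_measurable[of E]) auto
  with E show False by simp
qed

end

section \<open>The two bounds for the constant when the inverse has an absolutely summable Taylor
  series\<close>

locale circular_function_W = circular_function +
  assumes inverse_W: "H_inv (re_part b) (im_part b) \<in> W_plus ((gauss_norm b)\<^sup>2)"
begin

lemma inverse_h: "the_inv_into {-1..1} h = (\<lambda>y. H_inv (re_part b) (im_part b) (r * y))"
  unfolding H_inv_def the_inv_into_def h_def using r_pos by (auto simp: fun_eq_iff divide_eq_eq mult.commute)

text \<open>A fixed choice of coefficients, to serve as a parameter of the sublocale.\<close>

definition "corr_coeff = (SOME c. (\<forall>k. 0 \<le> c k) \<and> c sums 1 \<and> (\<forall>x\<in>{0..1}. (\<lambda>k. c k * x ^ k) sums h x))"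

lemma corr_coeff: "0 \<le> corr_coeff k" "corr_coeff sums 1" "x \<in> {0..1} \<Longrightarrow> (\<lambda>k. corr_coeff k * x ^ k) sums h x"
proof -
  have "(\<forall>k. 0 \<le> corr_coeff k) \<and> corr_coeff sums 1 \<and>
      (\<forall>x\<in>{0..1}. (\<lambda>k. corr_coeff k * x ^ k) sums h x)"
    unfolding corr_coeff_def by (rule someI_ex[OF ex_power_series])
  then show "0 \<le> corr_coeff k" "corr_coeff sums 1"
    "x \<in> {0..1} \<Longrightarrow> (\<lambda>k. corr_coeff k * x ^ k) sums h x"
    by auto
qed

sublocale odd_corr h corr_coeff
proof
  show "the_inv_into {-1..1} h \<in> W_plus 1"
    unfolding inverse_h by (rule W_plus_rescale(1)[OF r_pos inverse_W[folded r_def]])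
qed (use corr_coeff h_odd in auto)

text \<open>The strictness is what places \<open>hyp 1\<close> below 1, since \<open>hyp\<close>
  inverts the increasing function \<open>F\<close>.\<close>

lemma F1_gt: "1 < F 1"
proof (rule ccontr)
  assume "\<not> 1 < F 1"
  then have "F 1 = 1" using F1_ge by simp
  from identity_if_F1_eq[OF this] h_not_identity show False by blast
qed

lemma coeff_twisted_power:
  assumes "cmod \<alpha> = 1"
  shows "of_real (a k) * twisted_power k (\<alpha> * of_real x) = \<alpha> * of_real (a k * x ^ k)"
  using twisted_power_polar[OF _ assms, of k x] a_even[of k] by (cases "even k") auto

text \<open>Only partial sums \<open>MK K\<close> of the entrywise series \<phi>(s M) are formed,
  which keeps the vectors finite-dimensional; the limit is taken after \<open>h_complex\<close> has
  been applied. The scale s = \<open>hyp 1\<close> solves F s = 1, so the partial sums of |a k| s^k,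
  which bound the squared lengths, stay at most 1.\<close>

lemma grothendieck_bound_hyp: "grothendieck_bound (B\<^sup>2 / (r * hyp 1))"
proof (rule grothendieck_boundI)
  fix m n A N M assume N: "bil_bound m n A N" and M: "cgram 1 M"
  define s where "s = hyp 1"
  have s: "0 < s" "s \<le> 1" "F s = 1"
    unfolding s_def using hyp_bounds[of 1] hyp[of 1] F1_gt by auto
  define MK where "MK K i j = (\<Sum>k<K. of_real (a k * s ^ k) * twisted_power k (M i j))" for K :: nat and i j
  have MK: "cgram 1 (MK K)" for K
  proof -
    have "(\<Sum>k<K. \<bar>a k * s ^ k\<bar>) \<le> (\<Sum>k. \<bar>a k\<bar> * s ^ k)"
      using F_sums[of s] s by (subst abs_mult, simp) (intro sum_le_suminf; simp add: sums_iff)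
    also have "\<dots> = 1" using s(3) by (simp add: F_eq)
    finally have "(\<Sum>k<K. \<bar>a k * s ^ k\<bar>) \<le> 1" .
    from cgram_mono[OF cgram_sum[OF cgram_twisted_power[OF M]] this] show ?thesis
      unfolding MK_def .
  qed
  \<comment> \<open>A phase \<alpha> common to \<open>M i j\<close> and all \<open>MK K i j\<close>
    reduces the limit to real arguments: y K tends to \<phi> (s x), and continuity of h on the
    closed interval gives h (\<phi> (s x)) = s x.\<close>
  have lim: "(\<lambda>K. h_complex b b (MK K i j)) \<longlonglongrightarrow> of_real (r * s) * M i j" for i j
  proof -
    obtain \<alpha> where \<alpha>: "cmod \<alpha> = 1" "M i j = \<alpha> * of_real (cmod (M i j))" by (rule complex_polarE)
    define x where "x = cmod (M i j)"
    have Mx: "M i j = \<alpha> * of_real x" using \<alpha>(2) by (simp add: x_def)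
    have x: "0 \<le> x" "x \<le> 1" using cgram_cmod_le[OF M] by (auto simp: x_def)
    define y where "y K = (\<Sum>k<K. a k * (s * x) ^ k)" for K
    have MKy: "MK K i j = \<alpha> * of_real (y K)" for K
    proof -
      have eq: "of_real (a k * s ^ k) * twisted_power k (M i j) = \<alpha> * of_real (a k * (s * x) ^ k)" for k
      proof -
        have "of_real (a k * s ^ k) * twisted_power k (M i j) = of_real (s ^ k) * (of_real (a k) * twisted_power k (M i j))"
          by simp
        also have "\<dots> = \<alpha> * of_real (a k * (s * x) ^ k)"
          unfolding Mx coeff_twisted_power[OF \<alpha>(1)] by (simp add: power_mult_distrib mult_ac)
        finally show ?thesis .
      qed
      show ?thesis
        unfolding MK_def y_def of_real_sum sum_distrib_left by (intro sum.cong refl eq)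
    qed
    have y: "\<bar>y K\<bar> \<le> 1" for K
      using cgram_cmod_le[OF MK, of K i j] unfolding MKy norm_mult \<alpha>(1) by simp
    have sx: "s * x \<in> {0..1}" using s x by (auto simp: mult_le_one)
    then have "y \<longlonglongrightarrow> \<phi> (s * x)" using phi_sums[of "s * x"] by (simp add: y_def [abs_def] sums_def)
    moreover have "\<phi> (s * x) \<in> {-1..1}" using phi_nonneg[OF sx] by auto
    ultimately have "(\<lambda>K. h (y K)) \<longlonglongrightarrow> h (\<phi> (s * x))"
      using y by (intro continuous_on_tendsto_compose[OF h_continuous]) (auto simp: abs_le_iff)
    then have "(\<lambda>K. h (y K)) \<longlonglongrightarrow> s * x" using h_phi[of "s * x"] sx by simp
    then have "(\<lambda>K. \<alpha> * of_real (r * h (y K))) \<longlonglongrightarrow> \<alpha> * of_real (r * (s * x))"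
      by (intro tendsto_intros)
    moreover have "h_complex b b (MK K i j) = \<alpha> * of_real (r * h (y K))" for K
      unfolding MKy by (rule h_complex_polar[OF \<alpha>(1) y])
    moreover have "\<alpha> * of_real (r * (s * x)) = of_real (r * s) * M i j"
      by (simp add: Mx)
    ultimately show ?thesis by (simp only:)
  qed
  have "(\<lambda>K. cmod (\<Sum>i<m. \<Sum>j<n. A i j * h_complex b b (MK K i j))) \<longlonglongrightarrow>
      cmod (\<Sum>i<m. \<Sum>j<n. A i j * (of_real (r * s) * M i j))"
    by (intro tendsto_intros lim)
  then have "cmod (\<Sum>i<m. \<Sum>j<n. A i j * (of_real (r * s) * M i j)) \<le> B * B * N"
    by (rule LIMSEQ_le_const2)
      (use bil_bound_h_complex_cgram[OF N b_measurable b_measurable b_le B_nonneg b_le B_nonneg MK] in auto)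
  also have "(\<Sum>i<m. \<Sum>j<n. A i j * (of_real (r * s) * M i j)) = of_real (r * s) * (\<Sum>i<m. \<Sum>j<n. A i j * M i j)"
    by (simp add: sum_distrib_left mult_ac)
  finally have "(r * s) * cmod (\<Sum>i<m. \<Sum>j<n. A i j * M i j) \<le> B * B * N"
    using r_pos s by (simp add: norm_mult)
  then show "cmod (\<Sum>i<m. \<Sum>j<n. A i j * M i j) \<le> B\<^sup>2 / (r * hyp 1) * N"
    using r_pos s by (simp add: s_def [symmetric] pos_le_divide_eq power2_eq_square mult.commute)
qed

text \<open>Here \<phi> is applied after h rather than before it, so nothing has to be rescaled; the
  price is the sum of all |a k|, that is \<open>F 1\<close>. The equality of sup norm and Gaussian
  norm makes the factor B^2 / r in the bound for the matrices \<open>W\<close> equal to 1.\<close>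

lemma grothendieck_bound_F1:
  assumes "B\<^sup>2 = r"
  shows "grothendieck_bound (F 1)"
proof (rule grothendieck_boundI)
  fix m n A N M assume N: "bil_bound m n A N" and M: "cgram 1 M"
  define W where "W i j = h_complex b b (M i j) / of_real r" for i j
  have W: "dual_unit W"
    unfolding dual_unit_def
  proof (intro allI impI)
    fix m n A N assume N: "bil_bound m n A N"
    have "cmod (\<Sum>i<m. \<Sum>j<n. A i j * h_complex b b (M i j)) \<le> r * N"
      using bil_bound_h_complex_cgram[OF N b_measurable b_measurable b_le B_nonneg b_le B_nonneg M] assms
      by (simp add: power2_eq_square)
    moreover have "(\<Sum>i<m. \<Sum>j<n. A i j * W i j) = (\<Sum>i<m. \<Sum>j<n. A i j * h_complex b b (M i j)) / of_real r"
      by (simp add: W_def sum_divide_distrib)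
    ultimately show "cmod (\<Sum>i<m. \<Sum>j<n. A i j * W i j) \<le> N"
      using r_pos by (simp add: norm_divide divide_le_eq mult.commute)
  qed
  have "(\<lambda>k. of_real (a k) * twisted_power k (W i j)) sums M i j" for i j
  proof -
    obtain \<alpha> where \<alpha>: "cmod \<alpha> = 1" "M i j = \<alpha> * of_real (cmod (M i j))" by (rule complex_polarE)
    define x where "x = cmod (M i j)"
    have Mx: "M i j = \<alpha> * of_real x" using \<alpha>(2) by (simp add: x_def)
    have x: "x \<in> {0..1}" using cgram_cmod_le[OF M] by (auto simp: x_def)
    have "W i j = \<alpha> * of_real (h x)"
      unfolding W_def Mx using x r_pos by (simp add: h_complex_polar[OF \<alpha>(1)])
    then have "of_real (a k) * twisted_power k (W i j) = \<alpha> * of_real (a k * h x ^ k)" for k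
      by (simp only: coeff_twisted_power[OF \<alpha>(1)])
    moreover have "(\<lambda>k. \<alpha> * complex_of_real (a k * h x ^ k)) sums (\<alpha> * of_real (\<phi> (h x)))"
      using h_nonneg[OF x] by (intro sums_mult sums_of_real phi_sums) auto
    moreover have "\<alpha> * of_real (\<phi> (h x)) = M i j"
    proof -
      have "\<phi> (h x) = x" using x by (intro phi_h) auto
      then show ?thesis by (simp add: Mx)
    qed
    ultimately show ?thesis by (simp only:)
  qed
  then have sums: "(\<lambda>k. \<Sum>i<m. \<Sum>j<n. A i j * (of_real (a k) * twisted_power k (W i j))) sums
      (\<Sum>i<m. \<Sum>j<n. A i j * M i j)"
    by (intro sums_sum sums_mult)
  have "cmod (\<Sum>i<m. \<Sum>j<n. A i j * (of_real (a k) * twisted_power k (W i j))) \<le> \<bar>a k\<bar> * N" for k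
  proof -
    have "cmod (\<Sum>i<m. \<Sum>j<n. A i j * twisted_power k (W i j)) \<le> N"
      using dual_unit_twisted_power[OF W] N by (simp add: dual_unit_def)
    moreover have "(\<Sum>i<m. \<Sum>j<n. A i j * (of_real (a k) * twisted_power k (W i j))) =
        of_real (a k) * (\<Sum>i<m. \<Sum>j<n. A i j * twisted_power k (W i j))"
      by (simp add: sum_distrib_left mult_ac)
    ultimately show ?thesis by (simp add: norm_mult mult_left_mono)
  qed
  moreover have F: "(\<lambda>k. \<bar>a k\<bar> * N) sums (F 1 * N)"
    using F_sums[of 1] by (intro sums_mult2) simp
  ultimately have "cmod (\<Sum>k. \<Sum>i<m. \<Sum>j<n. A i j * (of_real (a k) * twisted_power k (W i j))) \<le> (\<Sum>k. \<bar>a k\<bar> * N)"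
    by (intro norm_suminf_le) (auto simp: sums_iff)
  then show "cmod (\<Sum>i<m. \<Sum>j<n. A i j * M i j) \<le> F 1 * N"
    using sums F by (simp add: sums_iff)
qed

lemma K_G_le_hyp: "r * K_G \<le> B\<^sup>2 / hyp 1"
proof -
  have "r * K_G \<le> r * (B\<^sup>2 / (r * hyp 1))"
    using K_G_le[OF grothendieck_bound_hyp] r_pos by (intro mult_left_mono) auto
  then show ?thesis using r_pos by simp
qed

lemma H_fun_normalized:
  "H_fun (\<lambda>w. re_part b w / sqrt r) (\<lambda>w. im_part b w / sqrt r) = h"
  unfolding H_fun_scaled using r_pos by (simp add: h_def fun_eq_iff)

lemma H_inv_normalized:
  "H_inv (\<lambda>w. re_part b w / sqrt r) (\<lambda>w. im_part b w / sqrt r) = \<phi>"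
  unfolding H_inv_def H_fun_normalized \<phi>_def ..

lemma H_hyp_normalized:
  "H_hyp (\<lambda>w. re_part b w / sqrt r) (\<lambda>w. im_part b w / sqrt r) = hyp"
  unfolding H_hyp_def H_inv_normalized hyp_def ..

lemma abs_series_H_inv: "abs_series (H_inv (re_part b) (im_part b)) (r * x) = F x"
  unfolding \<phi>_def inverse_h by (rule W_plus_rescale(2)[OF r_pos inverse_W[folded r_def]])

text \<open>The number sought is \<open>hyp K_G\<close>: the bound K_G \<le> F 1 puts K_G into the
  range of \<open>F\<close>, strict monotonicity places the number above
  \<open>hyp \<kappa>\<close>, and injectivity of \<open>F\<close> makes it unique.\<close>

lemma K_G_representation:
  assumes \<kappa>: "1 \<le> \<kappa>" "\<kappa> < K_G" and B: "B = sqrt r"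
  shows "0 < hyp \<kappa>" "hyp \<kappa> < 1"
    "\<exists>!\<gamma>. \<gamma> \<in> {hyp \<kappa> <.. 1} \<and> K_G = F \<gamma> \<and> F \<gamma> \<le> min (1 / hyp 1) (F 1)"
proof -
  have B2: "B\<^sup>2 = r" using B r_pos by simp
  have le: "K_G \<le> F 1" "K_G \<le> 1 / hyp 1"
    using K_G_le[OF grothendieck_bound_F1[OF B2]] K_G_le[OF grothendieck_bound_hyp] r_pos by (auto simp: B2)
  show hk: "0 < hyp \<kappa>" "hyp \<kappa> < 1" using hyp_bounds[of \<kappa>] \<kappa> le by auto
  have F_hk: "F (hyp \<kappa>) = \<kappa>" using hyp(2)[of \<kappa>] \<kappa> le by auto
  have F_hG: "F (hyp K_G) = K_G" "hyp K_G \<in> {0..1}" using hyp[of K_G] \<kappa> le by auto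
  show "\<exists>!\<gamma>. \<gamma> \<in> {hyp \<kappa> <.. 1} \<and> K_G = F \<gamma> \<and> F \<gamma> \<le> min (1 / hyp 1) (F 1)"
  proof (rule ex1I[of _ "hyp K_G"])
    have "hyp \<kappa> < hyp K_G"
    proof (rule ccontr)
      assume "\<not> hyp \<kappa> < hyp K_G"
      then have "F (hyp K_G) \<le> F (hyp \<kappa>)"
        using F_strict_mono_nonneg[of "hyp K_G" "hyp \<kappa>"] hk F_hG(2) by (cases "hyp K_G = hyp \<kappa>") auto
      then show False using F_hk F_hG \<kappa> by simp
    qed
    then show "hyp K_G \<in> {hyp \<kappa> <.. 1} \<and> K_G = F (hyp K_G) \<and> F (hyp K_G) \<le> min (1 / hyp 1) (F 1)"
      using F_hG le by auto
  next
    fix \<gamma> assume \<gamma>: "\<gamma> \<in> {hyp \<kappa> <.. 1} \<and> K_G = F \<gamma> \<and> F \<gamma> \<le> min (1 / hyp 1) (F 1)"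
    then show "\<gamma> = hyp K_G" using hyp_F[of \<gamma>] hk by auto
  qed
qed

end

theorem theorem7p3p3:
  fixes b c :: "complex^'k \<Rightarrow> complex" and m n :: nat
  assumes "1 \<le> m" and "1 \<le> n" and "b \<in> L_inf" and "c \<in> L_inf"
  shows
    "let r = (gauss_norm b)\<^sup>2;
         b_inf = real_of_ereal (Linf_norm b);
         c_inf = real_of_ereal (Linf_norm c);
         \<psi> = H_inv (re_part b) (im_part b);
         f = (\<lambda>w. re_part b w / sqrt r);
         g = (\<lambda>w. im_part b w / sqrt r);
         c_star = H_hyp f g 1
     in
       0 \<le> r \<and> (\<integral>\<^sup>+ z. ennreal ((cmod (b z))\<^sup>2) \<partial>std_cgaussian) < \<infinity> \<and> sqrt r \<le> b_inf \<and>
       (\<forall>A \<in> carrier_mat m n. \<forall>S \<in> Q_mat m n.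
          cmod (mat_trace (mat_adjoint A * map_mat (h_complex b c) S))
            \<le> b_inf * c_inf * norm_inf_1 A) \<and>
       (\<not> (AE z in lborel. b z = 0) \<longrightarrow>
        (\<forall>\<alpha> z. cmod \<alpha> = 1 \<longrightarrow> b (\<alpha> *s z) = \<alpha> * b z) \<longrightarrow>
        \<psi> \<in> W_plus r \<longrightarrow>
          0 < c_star \<and> c_star < 1 \<and>
          r * K_G \<le> b_inf\<^sup>2 / c_star \<and>
          ((\<forall>j. sgn ((deriv ^^ (2 * j + 1)) (H_inv f g) 0) = (- 1) ^ j) \<longrightarrow>
             (let bound = \<i> * (complex_of_real (b_inf\<^sup>2) / complex_series (H_fun f g) \<i>)
              in Im bound = 0 \<and> r * K_G \<le> Re bound)) \<and>
          (\<forall>\<kappa>. 1 \<le> \<kappa> \<longrightarrow> \<kappa> < K_G \<longrightarrow> b_inf = sqrt r \<longrightarrow>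
             0 < H_hyp f g \<kappa> \<and> H_hyp f g \<kappa> < 1 \<and>
             (\<exists>!\<gamma>. \<gamma> \<in> {H_hyp f g \<kappa> <.. 1} \<and>
                K_G = abs_series \<psi> (r * \<gamma>) \<and>
                abs_series \<psi> (r * \<gamma>) \<le> min (1 / c_star) (abs_series \<psi> r))))"
proof -
  note b = \<open>b \<in> L_inf\<close> and c = \<open>c \<in> L_inf\<close>
  have norm: "0 \<le> gauss_norm b" by (simp add: gauss_norm_def)
  define r where "r = (gauss_norm b)\<^sup>2"
  define b_inf where "b_inf = real_of_ereal (Linf_norm b)"
  define f where "f = (\<lambda>w. re_part b w / sqrt r)"
  define g where "g = (\<lambda>w. im_part b w / sqrt r)"
  define \<psi> where "\<psi> = H_inv (re_part b) (im_part b)"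
  have part_ii: "0 < H_hyp f g 1 \<and> H_hyp f g 1 < 1 \<and> r * K_G \<le> b_inf\<^sup>2 / H_hyp f g 1 \<and>
      ((\<forall>j. sgn ((deriv ^^ (2 * j + 1)) (H_inv f g) 0) = (- 1) ^ j) \<longrightarrow>
         (let bound = \<i> * (complex_of_real (b_inf\<^sup>2) / complex_series (H_fun f g) \<i>)
          in Im bound = 0 \<and> r * K_G \<le> Re bound)) \<and>
      (\<forall>\<kappa>. 1 \<le> \<kappa> \<longrightarrow> \<kappa> < K_G \<longrightarrow> b_inf = sqrt r \<longrightarrow>
         0 < H_hyp f g \<kappa> \<and> H_hyp f g \<kappa> < 1 \<and>
         (\<exists>!\<gamma>. \<gamma> \<in> {H_hyp f g \<kappa> <.. 1} \<and> K_G = abs_series \<psi> (r * \<gamma>) \<and>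
            abs_series \<psi> (r * \<gamma>) \<le> min (1 / H_hyp f g 1) (abs_series \<psi> r)))"
    if "\<not> (AE z in lborel. b z = 0)" "\<forall>\<alpha> z. cmod \<alpha> = 1 \<longrightarrow> b (\<alpha> *s z) = \<alpha> * b z" "\<psi> \<in> W_plus r"
  proof -
    interpret C: circular_function_W b
      by unfold_locales (use b that in \<open>auto simp: \<psi>_def r_def\<close>)
    have eq: "r = C.r" "b_inf = C.B" "H_hyp f g = C.hyp" "H_inv f g = C.\<phi>" "H_fun f g = C.h"
      unfolding f_def g_def r_def b_inf_def C.r_def [symmetric] C.B_def
      by (simp_all only: C.H_hyp_normalized C.H_inv_normalized C.H_fun_normalized)
    have F: "abs_series \<psi> (C.r * x) = C.F x" for x
      unfolding \<psi>_def by (rule C.abs_series_H_inv)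
    have star: "0 < C.hyp 1" "C.hyp 1 < 1" using C.hyp_bounds[of 1] C.F1_gt by auto
    \<comment> \<open>The denominator is i times \<open>hyp 1\<close>, so the factors i cancel and
      the value is the real bound of the general estimate.\<close>
    have bound: "\<i> * (complex_of_real (C.B\<^sup>2) / complex_series C.h \<i>) = of_real (C.B\<^sup>2 / C.hyp 1)"
      if "\<forall>j. sgn ((deriv ^^ (2 * j + 1)) C.\<phi> 0) = (- 1) ^ j"
      using C.complex_series_at_ii[OF that[rule_format]] by simp
    show ?thesis
      unfolding eq Let_def F F[of 1, simplified]
      using star C.K_G_le_hyp C.K_G_representation bound by (auto simp del: of_real_divide of_real_power)
  qed
  have "0 \<le> r" "sqrt r \<le> b_inf"
    using gauss_norm_bounds(2)[OF b] norm by (simp_all add: r_def b_inf_def)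
  moreover have "\<forall>A \<in> carrier_mat m n. \<forall>S \<in> Q_mat m n.
      cmod (mat_trace (mat_adjoint A * map_mat (h_complex b c) S)) \<le>
        b_inf * real_of_ereal (Linf_norm c) * norm_inf_1 A"
    using trace_adjoint_h_complex[OF b c] by (simp add: b_inf_def)
  moreover note gauss_norm_bounds(1)[OF b]
  ultimately show ?thesis
    unfolding Let_def r_def [symmetric] b_inf_def [symmetric] \<psi>_def [symmetric] f_def [symmetric] g_def [symmetric]
    by (intro conjI) (assumption | (intro impI, rule part_ii[unfolded Let_def]; assumption))+
qed

end
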